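(* For all integers $n\geq1$ and all symmetric $f\in H^1_{\mathbb{R}}(\mu_n)$, $$\operatorname{Var}_{\mu_n}(f)\leq\frac12\,\mathcal{E}_{\mu_n}(f,f),$$ where $$\operatorname{Var}_{\mu_n}(f)=\int_{\mathbb{C}^n}f^2\,\mathrm{d}\mu_n-\Bigl(\int_{\mathbb{C}^n}f\,\mathrm{d}\mu_n\Bigr)^2,\qquad \mathcal{E}_{\mu_n}(f,f)=\frac1n\int_{\mathbb{C}^n}|\nabla f|^2\,\mathrm{d}\mu_n.$$ Moreover, equality is achieved for $f=a\varphi_\Re+b\varphi_\Im$, for all $a,b\in\mathbb{R}$, where $\varphi_\Re(z)=\sum_{k=1}^n\Re z_k$ and $\varphi_\Im(z)=\sum_{k=1}^n\Im z_k$.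
   Context: For $n\ge1$, $\mu_n$ is the probability measure on $\mathbb{C}^n\equiv\mathbb{R}^{2n}$ given by $\mathrm{d}\mu_n(z)=\frac1{c_n}\mathrm{e}^{-n\sum_{k=1}^n|z_k|^2}\prod_{1\le j<k\le n}|z_j-z_k|^2\,\mathrm{d}z$, with $\mathrm{d}z$ Lebesgue measure and $c_n$ the normalizing constant. A function $f$ on $\mathbb{C}^n$ is symmetric if $f(z_{\sigma(1)},\ldots,z_{\sigma(n)})=f(z_1,\ldots,z_n)$ for all $z$ and all permutations $\sigma$ of $\{1,\dots,n\}$. $\nabla f$ is the Euclidean gradient on $\mathbb{R}^{2n}\equiv\mathbb{C}^n$ and $|\nabla f|$ its Euclidean norm. $\mathcal{C}^\infty_c(\mathbb{C}^n,\mathbb{R})$ is the space of real-valued compactly supported $\mathcal C^\infty$ functions on $\mathbb{C}^n$. $H^1_{\mathbb{R}}(\mu_n)$ is the completion of $\mathcal{C}^\infty_c(\mathbb{C}^n,\mathbb{R})$ for the norm $\|f\|_{H^1_{\mathbb{R}}(\mu_n)}=\bigl(\|f\|_{L^2(\mu_n)}^2+\|\nabla f\|_{L^2(\mu_n)}^2\bigr)^{1/2}$; it is identified with the domain in $L^2(\mu_n)$ of the closure of $\nabla:\mathcal{C}^\infty_c(\mathbb{C}^n,\mathbb{R})\to L^2(\mu_n,\mathbb{R}^{2n})$, and $\nabla f$ for $f\in H^1_{\mathbb{R}}(\mu_n)$ is understood accordingly. *)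

theory Defs
  imports "HOL-Analysis.Analysis"
begin

section \<open>The measure\<close>

text \<open>
  The index type \<open>'n\<close> plays the role of \<open>{1,\<dots>,n}\<close>, with \<open>n = CARD('n)\<close>. Its linear order only
  serves to write the product over pairs \<open>j < k\<close>. The Euclidean structure and Lebesgue measure of
  \<^typ>\<open>complex ^ 'n\<close> are those of \<open>\<real>\<^sup>2\<^sup>n\<close>.
\<close>

definition ginibre_weight :: "complex ^ 'n::{finite,linorder} \<Rightarrow> real" where
  "ginibre_weight z =
     exp (- real CARD('n) * (\<Sum>k\<in>UNIV. (cmod (z $ k))\<^sup>2)) *
     (\<Prod>(j, k) \<in> {(j, k). j < k}. (cmod (z $ j - z $ k))\<^sup>2)"

definition ginibre_const :: "'n::{finite,linorder} itself \<Rightarrow> real" where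
  "ginibre_const _ = (LINT z|lborel. ginibre_weight (z :: complex ^ 'n::{finite,linorder}))"

definition ginibre :: "(complex ^ 'n::{finite,linorder}) measure" where
  "ginibre = density lborel (\<lambda>z. ennreal (ginibre_weight z / ginibre_const TYPE('n)))"

definition symmetric_fun :: "(complex ^ 'n::finite \<Rightarrow> real) \<Rightarrow> bool" where
  "symmetric_fun f \<longleftrightarrow> (\<forall>\<sigma> z. \<sigma> permutes (UNIV :: 'n set) \<longrightarrow> f (\<chi> k. z $ \<sigma> k) = f z)"

section \<open>Test functions and the Sobolev space\<close>

text \<open>
  \<open>C\<^sup>k\<close> over the reals: every directional derivative of a \<open>C\<^sup>k\<^sup>+\<^sup>1\<close> function is \<open>C\<^sup>k\<close>.
\<close>

primrec times_cont_diff :: "nat \<Rightarrow> ('a::euclidean_space \<Rightarrow> real) \<Rightarrow> bool" where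
  "times_cont_diff 0 f \<longleftrightarrow> continuous_on UNIV f"
| "times_cont_diff (Suc k) f \<longleftrightarrow>
     (\<forall>x. f differentiable (at x)) \<and>
     (\<forall>v. times_cont_diff k (\<lambda>x. frechet_derivative f (at x) v))"

definition test_functions :: "('a::euclidean_space \<Rightarrow> real) set" where
  "test_functions = {f. (\<forall>k. times_cont_diff k f) \<and> compact (closure {x. f x \<noteq> 0})}"

definition grad :: "('a::euclidean_space \<Rightarrow> real) \<Rightarrow> 'a \<Rightarrow> 'a" where
  "grad f x = (THE D. GDERIV f x :> D)"

definition L2 :: "'a measure \<Rightarrow> ('a \<Rightarrow> 'b::euclidean_space) set" where
  "L2 M = {f \<in> borel_measurable M. integrable M (\<lambda>x. (norm (f x))\<^sup>2)}"

definition L2_norm :: "'a measure \<Rightarrow> ('a \<Rightarrow> 'b::euclidean_space) \<Rightarrow> real" where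
  "L2_norm M f = sqrt (LINT x|M. (norm (f x))\<^sup>2)"

text \<open>
  \<open>grad_closure M f g\<close>: the pair \<open>(f, g)\<close> lies in the closure, in \<open>L\<^sup>2 \<times> L\<^sup>2\<close>, of the graph of the
  gradient on test functions. Functions stand for their classes modulo \<open>M\<close>-null sets: the relation
  does not change when \<open>f\<close> or \<open>g\<close> is altered on a null set.
\<close>

definition grad_closure ::
  "'a::euclidean_space measure \<Rightarrow> ('a \<Rightarrow> real) \<Rightarrow> ('a \<Rightarrow> 'a) \<Rightarrow> bool" where
  "grad_closure M f g \<longleftrightarrow> f \<in> L2 M \<and> g \<in> L2 M \<and>
     (\<exists>\<phi> :: nat \<Rightarrow> 'a \<Rightarrow> real. (\<forall>m. \<phi> m \<in> test_functions) \<and>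
        (\<lambda>m. L2_norm M (\<lambda>x. \<phi> m x - f x)) \<longlonglongrightarrow> 0 \<and>
        (\<lambda>m. L2_norm M (\<lambda>x. grad (\<phi> m) x - g x)) \<longlonglongrightarrow> 0)"

definition H1 :: "'a::euclidean_space measure \<Rightarrow> ('a \<Rightarrow> real) set" where
  "H1 M = {f. \<exists>g. grad_closure M f g}"

text \<open>
  Where the gradient is closable, as it is for \<^const>\<open>ginibre\<close>, the function \<open>g\<close> is unique up to
  null sets, and the choice below only selects a representative of its class.
\<close>

definition H1_grad :: "'a::euclidean_space measure \<Rightarrow> ('a \<Rightarrow> real) \<Rightarrow> 'a \<Rightarrow> 'a" where
  "H1_grad M f = (SOME g. grad_closure M f g)"

section \<open>Variance and Dirichlet energy\<close>

definition Var :: "'a measure \<Rightarrow> ('a \<Rightarrow> real) \<Rightarrow> real" where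
  "Var M f = (LINT x|M. (f x)\<^sup>2) - (LINT x|M. f x)\<^sup>2"

definition dirichlet_energy ::
  "(complex ^ 'n::finite) measure \<Rightarrow> (complex ^ 'n \<Rightarrow> real) \<Rightarrow> real" where
  "dirichlet_energy M f = 1 / real CARD('n) * (LINT z|M. (norm (H1_grad M f z))\<^sup>2)"

definition sum_Re :: "complex ^ 'n::finite \<Rightarrow> real" where
  "sum_Re z = (\<Sum>k\<in>UNIV. Re (z $ k))"

definition sum_Im :: "complex ^ 'n::finite \<Rightarrow> real" where
  "sum_Im z = (\<Sum>k\<in>UNIV. Im (z $ k))"

end

theory Submission
  imports Defs "HOL-Probability.Distributions"
begin

text \<open>
Write \<open>n\<close> for the dimension, \<open>V\<close> for the Vandermonde product and \<open>\<gamma>\<close> for the Gaussian weight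
\<open>exp(-n |z|\<^sup>2)\<close>, so that the Ginibre weight is \<open>|V|\<^sup>2 \<gamma>\<close>. The inequality comes from the spectral gap of the
Landau operator together with the fact that a real function has at most half of its mass in the
holomorphic functions.

For a symmetric real \<open>\<psi>\<close> put \<open>g = \<psi> V\<close>. Since \<open>V\<close> is holomorphic, the Wirtinger derivatives of \<open>g\<close> are
\<open>V\<close> times those of \<open>\<psi>\<close>, and as \<open>\<psi>\<close> is real their squares add up to \<open>|\<nabla>\<psi>|\<^sup>2 |V|\<^sup>2 / 4\<close>. In \<open>L\<^sup>2(\<gamma>)\<close> the operator
\<open>dbar* dbar\<close> has spectrum \<open>0, n, 2 n, \<dots>\<close> and its kernel consists of the holomorphic functions, so with \<open>P\<close> the
projection onto these (the Bargmann projection), \<open>n \<parallel>g - P g\<parallel>\<^sup>2 \<le> \<parallel>dbar g\<parallel>\<^sup>2\<close>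
(\<open>landau_spectral_gap\<close>). The gap is read off from the semigroup: the kernel of the semigroup of \<open>dbar* dbar\<close> is
an explicit Gaussian, its quadratic form is positive because the kernel is an exponential of a Gram kernel,
and two integrations by parts give its derivative in time as the same form evaluated at \<open>dbar g\<close>.

It remains to see that \<open>\<parallel>P g\<parallel>\<^sup>2 \<le> \<parallel>g\<parallel>\<^sup>2 / 2\<close> when \<open>\<psi>\<close> has mean zero. The map \<open>J u = cnj u * V / cnj V\<close> is
antilinear, does not increase norms and fixes \<open>g\<close>. The polynomial \<open>P g\<close> is antisymmetric, so its homogeneous
components of degree less than \<open>D = deg V\<close> vanish and the one of degree \<open>D\<close> is a multiple of \<open>V\<close>, which is
excluded by the mean-zero condition (\<open>hmoment_eq_0\<close>). Hence \<open>P g\<close> and \<open>J P g\<close> are orthogonal: their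
inner product is the integral of \<open>(P g)\<^sup>2 cnj V / V\<close> against \<open>\<gamma>\<close>, whose integrand picks up only positive frequencies under
\<open>z \<mapsto> c z\<close> with \<open>|c| = 1\<close>. Bessel's inequality for \<open>P g\<close> and \<open>J P g\<close> is the claim
(\<open>bessel_with_conjugation\<close>). This proves the inequality for symmetric test functions, and \<open>poincare_ginibre\<close>
extends it to the Sobolev space by symmetrizing an approximating sequence and correcting its mean.

For the equality, the gradient of a function in the Sobolev space is determined up to null sets
(\<open>ginibre_gradient_closable\<close>), so the energy of a linear function is that of its constant gradient. The
weight is Gaussian along the direction \<open>(1, \<dots>, 1)\<close>, because \<open>V\<close> is invariant under simultaneous translation of all
coordinates, and this determines the variance (\<open>linear_second_moment\<close>).
\<close>

section \<open>Calculus of compactly supported functions\<close>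

definition C1 :: "('a::euclidean_space \<Rightarrow> complex) \<Rightarrow> bool" where
  "C1 u \<longleftrightarrow> (\<forall>x. u differentiable (at x)) \<and>
     (\<forall>v. continuous_on UNIV (\<lambda>x. frechet_derivative u (at x) v))"

abbreviation ddir :: "('a::euclidean_space \<Rightarrow> complex) \<Rightarrow> 'a \<Rightarrow> 'a \<Rightarrow> complex" where
  "ddir u v x \<equiv> frechet_derivative u (at x) v"

definition bdd_supp :: "('a::euclidean_space \<Rightarrow> 'b::zero) \<Rightarrow> bool" where
  "bdd_supp u \<longleftrightarrow> (\<exists>R. \<forall>x. norm x > R \<longrightarrow> u x = 0)"

lemma C1I:
  assumes "\<And>x. (u has_derivative u' x) (at x)" "\<And>v. continuous_on UNIV (\<lambda>x. u' x v)"
  shows "C1 u"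
proof -
  have "frechet_derivative u (at x) = u' x" for x
    using frechet_derivative_at[OF assms(1)] by simp
  then show ?thesis unfolding C1_def using assms by (auto simp: differentiable_def)
qed

lemma C1_has_derivative: "C1 u \<Longrightarrow> (u has_derivative (\<lambda>v. ddir u v x)) (at x)"
  unfolding C1_def using frechet_derivative_works by blast

lemma C1_continuous_ddir: "C1 u \<Longrightarrow> continuous_on UNIV (ddir u v)"
  unfolding C1_def by blast

lemma C1_continuous: "C1 u \<Longrightarrow> continuous_on UNIV u"
  unfolding C1_def
  by (meson continuous_at_imp_continuous_on differentiable_imp_continuous_within)

lemma ddir_eqI: "(u has_derivative u') (at x) \<Longrightarrow> ddir u v x = u' v"
  using frechet_derivative_at by fastforce

lemma bdd_supp_mult_left: "bdd_supp u \<Longrightarrow> bdd_supp (\<lambda>x. u x * e x :: complex)"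
  unfolding bdd_supp_def by fastforce

lemma bdd_supp_diff: 
  fixes u v :: "'a::euclidean_space \<Rightarrow> complex"
  assumes "bdd_supp u" "bdd_supp v" shows "bdd_supp (\<lambda>x. u x - v x)"
proof -
  from assms obtain R S where "\<forall>x. norm x > R \<longrightarrow> u x = 0" "\<forall>x. norm x > S \<longrightarrow> v x = 0"
    unfolding bdd_supp_def by blast
  then have "\<forall>x. norm x > max R S \<longrightarrow> u x - v x = 0" by auto
  then show ?thesis unfolding bdd_supp_def by blast
qed

lemma integrable_bdd_supp:
  fixes u :: "'a::euclidean_space \<Rightarrow> 'b::euclidean_space"
  assumes "continuous_on UNIV u" "bdd_supp u"
  shows "integrable lborel u"
proof -
  obtain R where R: "\<And>x. norm x > R \<Longrightarrow> u x = 0" using assms(2) unfolding bdd_supp_def by blast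
  have "integrable lborel (\<lambda>x. indicator (cball 0 R) x *\<^sub>R u x)"
    by (rule borel_integrable_compact) (auto intro: continuous_on_subset[OF assms(1)])
  also have "(\<lambda>x. indicator (cball 0 R) x *\<^sub>R u x) = u"
  proof
    fix x show "indicator (cball 0 R) x *\<^sub>R u x = u x"
      using R[of x] by (cases "norm x > R") (auto simp: indicator_def)
  qed
  finally show ?thesis .
qed

lemma bounded_bdd_supp:
  fixes u :: "'a::euclidean_space \<Rightarrow> 'b::real_normed_vector"
  assumes "continuous_on UNIV u" "bdd_supp u"
  obtains B where "B \<ge> 0" "\<And>x. norm (u x) \<le> B"
proof -
  obtain R where R: "\<And>x. norm x > R \<Longrightarrow> u x = 0" using assms(2) unfolding bdd_supp_def by blast
  have "compact (u ` cball 0 R)"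
    by (intro compact_continuous_image) (auto intro: continuous_on_subset[OF assms(1)])
  then have "bounded (u ` cball 0 R)" by (rule compact_imp_bounded)
  then obtain B where B: "\<And>x. x \<in> cball 0 R \<Longrightarrow> norm (u x) \<le> B"
    unfolding bounded_iff by blast
  have "norm (u x) \<le> max B 0" for x
    using B[of x] R[of x] by (cases "norm x > R") auto
  then show ?thesis by (intro that[of "max B 0"]) auto
qed

lemma integral_translation:
  fixes f :: "'a::euclidean_space \<Rightarrow> 'b::euclidean_space"
  assumes [measurable]: "f \<in> borel_measurable borel"
  shows "(LINT x|lborel. f (a + x)) = (LINT x|lborel. f x)"
proof -
  have "(LINT x|lborel. f x) = (LINT x|distr lborel borel ((+) a). f x)"
    by (simp add: lborel_distr_plus)
  also have "\<dots> = (LINT x|lborel. f (a + x))" by (subst integral_distr) auto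
  finally show ?thesis by simp
qed

lemma integrable_translation:
  fixes f :: "'a::euclidean_space \<Rightarrow> 'b::euclidean_space"
  assumes "integrable lborel f"
  shows "integrable lborel (\<lambda>x. f (a + x))"
proof -
  have [measurable]: "f \<in> borel_measurable borel" using assms by auto
  have "integrable (distr lborel borel ((+) a)) f" using assms by (simp add: lborel_distr_plus)
  then show ?thesis by (subst (asm) integrable_distr_eq) auto
qed

lemma ddir_zero_outside:
  assumes "\<And>x. norm x > R \<Longrightarrow> u x = 0" "norm x > R"
  shows "ddir u v x = 0"
proof -
  have op: "open {x::'a. norm x > R}" by (intro open_Collect_less continuous_intros)
  have "(u has_derivative (\<lambda>_. 0)) (at x)"
    by (rule has_derivative_transform_within_open[OF has_derivative_const[of 0] op])
       (use assms in auto)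
  then show ?thesis using ddir_eqI by metis
qed

lemma bdd_supp_ddir: "bdd_supp u \<Longrightarrow> bdd_supp (ddir u v)"
  unfolding bdd_supp_def using ddir_zero_outside by metis

text \<open>
  Integrals over the whole space are invariant under the translation by \<open>t v\<close>; the derivative at
  \<open>t = 0\<close> of this invariance is the vanishing of the integral of a directional derivative.
\<close>

lemma integral_ddir_eq_0:
  assumes "C1 u" "bdd_supp u"
  shows "(LINT x|lborel. ddir u v x) = 0"
proof -
  obtain R where R: "\<And>x. norm x > R \<Longrightarrow> u x = 0" using assms(2) unfolding bdd_supp_def by blast
  obtain B where B: "B \<ge> 0" "\<And>x. norm (ddir u v x) \<le> B"
    using bounded_bdd_supp[OF C1_continuous_ddir[OF assms(1), of v] bdd_supp_ddir[OF assms(2)]] by blast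
  define s where "s = (\<lambda>i::nat. inverse (real (Suc i)))"
  have s0: "s i > 0" "s i \<le> 1" for i by (auto simp: s_def inverse_le_1_iff)
  have slim: "s \<longlonglongrightarrow> 0" unfolding s_def by (rule LIMSEQ_inverse_real_of_nat)
  define q where "q = (\<lambda>i x. (u (s i *\<^sub>R v + x) - u x) /\<^sub>R s i)"
  have cu: "continuous_on UNIV u" using C1_continuous[OF assms(1)] .
  have meas [measurable]: "u \<in> borel_measurable borel" using cu by (rule borel_measurable_continuous_onI)
  have iu: "integrable lborel u" using integrable_bdd_supp[OF cu assms(2)] .
  have bound: "norm (u (r *\<^sub>R v + x) - u x) \<le> B * r" if "r > 0" for r x
  proof -
    have der: "((\<lambda>t. u (t *\<^sub>R v + x)) has_derivative (\<lambda>h. ddir u (h *\<^sub>R v) (t *\<^sub>R v + x))) (at t within {0..r})" for t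
      by (rule has_derivative_compose[OF _ C1_has_derivative[OF assms(1)]])
         (auto intro!: derivative_eq_intros)
    have "norm (ddir u (h *\<^sub>R v) y) \<le> B * norm h" for h y
    proof -
      have "linear (\<lambda>v. ddir u v y)" using C1_has_derivative[OF assms(1)] has_derivative_linear by blast
      then have "ddir u (h *\<^sub>R v) y = h *\<^sub>R ddir u v y" by (simp add: linear_scale)
      then show ?thesis using B(2)[of y] mult_left_mono[of "norm (ddir u v y)" B "\<bar>h\<bar>"] by (simp add: mult.commute)
    qed
    then have on: "onorm (\<lambda>h. ddir u (h *\<^sub>R v) (t *\<^sub>R v + x)) \<le> B" for t
      by (intro onorm_bound) (use B in auto)
    have "norm (u (r *\<^sub>R v + x) - u (0 *\<^sub>R v + x)) \<le> B * norm (r - 0)"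
      by (rule differentiable_bound[where S="{0..r}" and f="\<lambda>t. u (t *\<^sub>R v + x)", OF _ der on]) (use that in auto)
    then show ?thesis using that by simp
  qed
  have lim: "(\<lambda>i. LINT x|lborel. q i x) \<longlonglongrightarrow> (LINT x|lborel. ddir u v x)"
  proof (rule integral_dominated_convergence[where w="\<lambda>x. indicator (cball 0 (R + norm v)) x * B"])
    show "ddir u v \<in> borel_measurable lborel"
      using borel_measurable_continuous_onI[OF C1_continuous_ddir[OF assms(1)]] by simp
    show "q i \<in> borel_measurable lborel" for i unfolding q_def by measurable
    show "integrable lborel (\<lambda>x. indicator (cball 0 (R + norm v)) x * B)"
      using borel_integrable_compact[of "cball 0 (R + norm v)" "\<lambda>_. B"] by simp
    show "AE x in lborel. (\<lambda>i. q i x) \<longlonglongrightarrow> ddir u v x"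
    proof (rule AE_I2)
      fix x
      have "((\<lambda>t. u (t *\<^sub>R v + x)) has_vector_derivative ddir u v (0 *\<^sub>R v + x)) (at 0)"
        unfolding has_vector_derivative_def
      proof (rule has_derivative_eq_rhs[OF has_derivative_compose[OF _ C1_has_derivative[OF assms(1)]]])
        show "((\<lambda>t. t *\<^sub>R v + x) has_derivative (\<lambda>h. h *\<^sub>R v)) (at 0)"
          by (auto intro!: derivative_eq_intros)
        have "linear (\<lambda>w. ddir u w (0 *\<^sub>R v + x))"
          using C1_has_derivative[OF assms(1)] has_derivative_linear by blast
        then show "(\<lambda>h. ddir u (h *\<^sub>R v) (0 *\<^sub>R v + x)) = (\<lambda>h. h *\<^sub>R ddir u v (0 *\<^sub>R v + x))"
          by (simp add: linear_scale)
      qed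
      then have l1: "((\<lambda>t. norm (u (t *\<^sub>R v + x) - u x - t *\<^sub>R ddir u v x) / norm t) \<longlongrightarrow> 0) (at 0)"
        unfolding has_vector_derivative_def has_derivative_at by simp
      have l2: "norm (u (t *\<^sub>R v + x) - u x - t *\<^sub>R ddir u v x) / norm t
          = norm ((u (t *\<^sub>R v + x) - u x) /\<^sub>R t - ddir u v x)" if "t \<noteq> 0" for t
      proof -
        have "(u (t *\<^sub>R v + x) - u x) /\<^sub>R t - ddir u v x = (u (t *\<^sub>R v + x) - u x - t *\<^sub>R ddir u v x) /\<^sub>R t"
          using that by (simp add: algebra_simps)
        then show ?thesis by (simp add: divide_inverse mult.commute)
      qed
      have "((\<lambda>t. norm ((u (t *\<^sub>R v + x) - u x) /\<^sub>R t - ddir u v x)) \<longlongrightarrow> 0) (at 0)"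
        by (rule Lim_transform_eventually[OF l1]) (use l2 in \<open>auto simp: eventually_at intro!: exI[of _ 1]\<close>)
      then have "((\<lambda>t. (u (t *\<^sub>R v + x) - u x) /\<^sub>R t) \<longlongrightarrow> ddir u v x) (at 0)"
        by (simp add: tendsto_norm_zero_iff LIM_zero_iff)
      then show "(\<lambda>i. q i x) \<longlonglongrightarrow> ddir u v x"
        unfolding q_def
        by (rule filterlim_compose)
           (use slim s0 in \<open>auto simp: filterlim_at less_imp_neq[symmetric] intro!: always_eventually\<close>)
    qed
    show "AE x in lborel. norm (q i x) \<le> indicator (cball 0 (R + norm v)) x * B" for i
    proof (rule AE_I2)
      fix x
      show "norm (q i x) \<le> indicator (cball 0 (R + norm v)) x * B"
      proof (cases "norm x \<le> R + norm v")
        case True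
        have "norm (q i x) = norm (u (s i *\<^sub>R v + x) - u x) / s i"
          using s0[of i] by (simp add: q_def divide_inverse mult.commute)
        also have "\<dots> \<le> B" using bound[OF s0(1)[of i], of x] s0[of i] by (simp add: divide_le_eq)
        finally show ?thesis using True by simp
      next
        case False
        have "norm (s i *\<^sub>R v) \<le> norm v" using s0[of i] by (simp add: mult_left_le_one_le)
        moreover have "norm x - norm (s i *\<^sub>R v) \<le> norm (s i *\<^sub>R v + x)"
          by (metis add.commute norm_diff_ineq)
        ultimately have "norm (s i *\<^sub>R v + x) > R" "norm x > R" using False by (auto simp: not_le intro: le_less_trans[of _ "R + norm v"])
        then show ?thesis using R False by (simp add: q_def)
      qed
    qed
  qed
  have "(LINT x|lborel. q i x) = 0" for i
    unfolding q_def using iu integrable_translation[OF iu, of "s i *\<^sub>R v"] integral_translation[OF meas, of "s i *\<^sub>R v"]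
    by simp
  with lim show ?thesis by (simp add: LIMSEQ_const_iff)
qed

lemma C1_mult: assumes "C1 u" "C1 e" shows "C1 (\<lambda>x. u x * e x)"
  by (rule C1I[OF has_derivative_mult[OF C1_has_derivative C1_has_derivative]])
     (auto intro!: assms continuous_intros C1_continuous[OF assms(1)] C1_continuous[OF assms(2)]
       C1_continuous_ddir[OF assms(1)] C1_continuous_ddir[OF assms(2)])

lemma ddir_mult:
  assumes "C1 u" "C1 e" shows "ddir (\<lambda>x. u x * e x) v x = u x * ddir e v x + ddir u v x * e x"
  using ddir_eqI[OF has_derivative_mult[OF C1_has_derivative C1_has_derivative]] assms by blast

lemma C1_add: assumes "C1 u" "C1 e" shows "C1 (\<lambda>x. u x + e x)"
  by (rule C1I[OF has_derivative_add[OF C1_has_derivative C1_has_derivative]])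
     (auto intro!: assms continuous_intros C1_continuous[OF assms(1)] C1_continuous[OF assms(2)]
       C1_continuous_ddir[OF assms(1)] C1_continuous_ddir[OF assms(2)])

lemma C1_const: "C1 (\<lambda>x. c)"
  by (rule C1I[OF has_derivative_const]) auto

lemma integral_by_parts:
  assumes "C1 u" "bdd_supp u" "C1 e"
  shows "(LINT x|lborel. ddir u v x * e x) = - (LINT x|lborel. u x * ddir e v x)"
proof -
  have i1: "integrable lborel (\<lambda>x. ddir u v x * e x)"
    by (intro integrable_bdd_supp continuous_intros C1_continuous[OF assms(1)] C1_continuous[OF assms(3)]
         C1_continuous_ddir[OF assms(1)] C1_continuous_ddir[OF assms(3)] bdd_supp_mult_left bdd_supp_ddir assms)
  have i2: "integrable lborel (\<lambda>x. u x * ddir e v x)"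
    by (intro integrable_bdd_supp continuous_intros C1_continuous[OF assms(1)] C1_continuous[OF assms(3)]
         C1_continuous_ddir[OF assms(1)] C1_continuous_ddir[OF assms(3)] bdd_supp_mult_left bdd_supp_ddir assms)
  have "0 = (LINT x|lborel. ddir (\<lambda>x. u x * e x) v x)"
    using integral_ddir_eq_0[OF C1_mult bdd_supp_mult_left] assms by simp
  also have "\<dots> = (LINT x|lborel. u x * ddir e v x) + (LINT x|lborel. ddir u v x * e x)"
    using i1 i2 assms by (simp add: ddir_mult)
  finally show ?thesis by (simp add: eq_neg_iff_add_eq_0 add.commute)
qed

section \<open>The Wirtinger operators\<close>

definition dbar :: "'n::finite \<Rightarrow> (complex ^ 'n \<Rightarrow> complex) \<Rightarrow> complex ^ 'n \<Rightarrow> complex" where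
  "dbar k u z = (ddir u (axis k 1) z + \<i> * ddir u (axis k \<i>) z) / 2"

lemma continuous_dbar: "C1 u \<Longrightarrow> continuous_on UNIV (dbar k u)"
  unfolding dbar_def by (intro continuous_intros C1_continuous_ddir) auto

lemma bdd_supp_dbar: 
  assumes "bdd_supp u" shows "bdd_supp (dbar k u)"
proof -
  obtain R where R: "\<And>x. norm x > R \<Longrightarrow> u x = 0" using assms unfolding bdd_supp_def by blast
  have "dbar k u x = 0" if "norm x > R" for x
    unfolding dbar_def using ddir_zero_outside[of R u, OF R that] by simp
  then show ?thesis unfolding bdd_supp_def by blast
qed

lemma dbar_mult:
  assumes "C1 u" "C1 e" shows "dbar k (\<lambda>x. u x * e x) x = u x * dbar k e x + dbar k u x * e x"
  unfolding dbar_def using assms by (simp add: ddir_mult field_simps)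

text \<open>
Both sides are complex-linear combinations of the integration by parts formulas in the two real directions of the \<open>k\<close>-th coordinate.
\<close>

lemma integral_by_parts_dbar:
  assumes "C1 u" "bdd_supp u" "C1 e"
  shows "(LINT x|lborel. dbar k u x * e x) = - (LINT x|lborel. u x * dbar k e x)"
proof -
  have i1: "integrable lborel (\<lambda>x. ddir u v x * e x)" for v
    by (intro integrable_bdd_supp continuous_intros C1_continuous[OF assms(1)] C1_continuous[OF assms(3)]
         C1_continuous_ddir[OF assms(1)] C1_continuous_ddir[OF assms(3)] bdd_supp_mult_left bdd_supp_ddir assms)
  have i2: "integrable lborel (\<lambda>x. u x * ddir e v x)" for v
    by (intro integrable_bdd_supp continuous_intros C1_continuous[OF assms(1)] C1_continuous[OF assms(3)]
         C1_continuous_ddir[OF assms(1)] C1_continuous_ddir[OF assms(3)] bdd_supp_mult_left bdd_supp_ddir assms)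
  have "(LINT x|lborel. dbar k u x * e x) =
    (LINT x|lborel. (1/2) * (ddir u (axis k 1) x * e x) + (\<i>/2) * (ddir u (axis k \<i>) x * e x))"
    by (rule Bochner_Integration.integral_cong) (auto simp: dbar_def field_simps)
  also have "\<dots> = (1/2) * (LINT x|lborel. ddir u (axis k 1) x * e x) + (\<i>/2) * (LINT x|lborel. ddir u (axis k \<i>) x * e x)"
    using i1 by simp
  also have "\<dots> = - ((1/2) * (LINT x|lborel. u x * ddir e (axis k 1) x) + (\<i>/2) * (LINT x|lborel. u x * ddir e (axis k \<i>) x))"
    using assms by (simp add: integral_by_parts)
  also have "(1/2) * (LINT x|lborel. u x * ddir e (axis k 1) x) + (\<i>/2) * (LINT x|lborel. u x * ddir e (axis k \<i>) x)
     = (LINT x|lborel. (1/2) * (u x * ddir e (axis k 1) x) + (\<i>/2) * (u x * ddir e (axis k \<i>) x))"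
    using i2 by simp
  also have "\<dots> = (LINT x|lborel. u x * dbar k e x)"
    by (rule Bochner_Integration.integral_cong) (auto simp: dbar_def field_simps)
  finally show ?thesis .
qed

definition hdot :: "complex ^ 'n::finite \<Rightarrow> complex ^ 'n \<Rightarrow> complex" where
  "hdot z w = (\<Sum>k\<in>UNIV. z $ k * cnj (w $ k))"

lemma bounded_bilinear_hdot: "bounded_bilinear hdot"
proof
  show "hdot (a + a') b = hdot a b + hdot a' b" for a a' b :: "complex ^ 'n"
    by (simp add: hdot_def algebra_simps sum.distrib)
  show "hdot a (b + b') = hdot a b + hdot a b'" for a b b' :: "complex ^ 'n"
    by (simp add: hdot_def algebra_simps sum.distrib)
  show "hdot (r *\<^sub>R a) b = r *\<^sub>R hdot a b" for r and a b :: "complex ^ 'n"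
    by (simp add: hdot_def scaleR_sum_right)
  show "hdot a (r *\<^sub>R b) = r *\<^sub>R hdot a b" for r and a b :: "complex ^ 'n"
    by (simp add: hdot_def scaleR_sum_right)
  show "\<exists>K. \<forall>a b :: complex ^ 'n. norm (hdot a b) \<le> norm a * norm b * K"
  proof (intro exI allI)
    fix a b :: "complex ^ 'n"
    have "norm (hdot a b) \<le> (\<Sum>k\<in>UNIV. norm (a $ k * cnj (b $ k)))"
      unfolding hdot_def by (rule norm_sum)
    also have "\<dots> \<le> (\<Sum>k\<in>(UNIV::'n set). norm a * norm b)"
      by (intro sum_mono) (auto simp: norm_mult intro!: mult_mono Finite_Cartesian_Product.norm_nth_le)
    finally show "norm (hdot a b) \<le> norm a * norm b * real CARD('n)" by (simp add: mult.commute)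
  qed
qed

lemmas continuous_hdot [continuous_intros] = bounded_bilinear.continuous_on[OF bounded_bilinear_hdot]
lemmas has_derivative_hdot = bounded_bilinear.FDERIV[OF bounded_bilinear_hdot]

lemma hdot_self: "hdot z z = of_real ((norm z)\<^sup>2)"
  by (simp add: hdot_def norm_vec_def L2_set_def sum_nonneg complex_norm_square[symmetric])

lemma Re_hdot: "Re (hdot z w) = inner z w"
  by (simp add: hdot_def inner_vec_def inner_complex_def)

lemma cnj_hdot: "cnj (hdot z w) = hdot w z"
  by (simp add: hdot_def mult.commute)

lemma hdot_axis_right: "hdot z (axis k c) = z $ k * cnj c"
  by (simp add: hdot_def axis_def if_distrib cong: if_cong)

lemma hdot_axis_left: "hdot (axis k c) z = c * cnj (z $ k)"
  by (simp add: hdot_def axis_def if_distrib[of "\<lambda>x. x * _"] cong: if_cong)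

section \<open>Hermitian forms given by a kernel\<close>

definition kform :: "('a::euclidean_space \<Rightarrow> 'a \<Rightarrow> complex) \<Rightarrow> ('a \<Rightarrow> complex) \<Rightarrow> ('a \<Rightarrow> complex) \<Rightarrow> complex" where
  "kform K u v = (LINT p|lborel. cnj (u (fst p)) * v (snd p) * K (fst p) (snd p))"

definition Cc :: "('a::euclidean_space \<Rightarrow> complex) \<Rightarrow> bool" where
  "Cc u \<longleftrightarrow> continuous_on UNIV u \<and> bdd_supp u"

abbreviation ckernel :: "('a::euclidean_space \<Rightarrow> 'a \<Rightarrow> complex) \<Rightarrow> bool" where
  "ckernel K \<equiv> continuous_on UNIV (\<lambda>p. K (fst p) (snd p))"

lemma Cc_mult_right: "Cc u \<Longrightarrow> continuous_on UNIV e \<Longrightarrow> Cc (\<lambda>x. u x * e x)"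
  unfolding Cc_def by (auto intro!: continuous_intros bdd_supp_mult_left)

lemma Cc_diff: "Cc u \<Longrightarrow> Cc v \<Longrightarrow> Cc (\<lambda>x. u x - v x)"
  unfolding Cc_def by (auto intro!: continuous_intros bdd_supp_diff)

lemma Cc_integrable: "Cc u \<Longrightarrow> integrable lborel u"
  unfolding Cc_def by (auto intro!: integrable_bdd_supp)

lemma Cc_dbar: "C1 u \<Longrightarrow> bdd_supp u \<Longrightarrow> Cc (dbar k u)"
  unfolding Cc_def by (auto intro!: continuous_dbar bdd_supp_dbar)

lemma C1_Cc: "C1 u \<Longrightarrow> bdd_supp u \<Longrightarrow> Cc u"
  unfolding Cc_def by (auto intro!: C1_continuous)

lemma Cc_tensor:
  assumes "Cc u" "Cc v" "ckernel K"
  shows "Cc (\<lambda>p. cnj (u (fst p)) * v (snd p) * K (fst p) (snd p))"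
  unfolding Cc_def
proof
  have "continuous_on UNIV u" "continuous_on UNIV v" using assms by (auto simp: Cc_def)
  then have "continuous_on UNIV (\<lambda>p. u (fst p))" "continuous_on UNIV (\<lambda>p. v (snd p))"
    by (auto intro!: continuous_on_compose2[OF _ continuous_on_fst[OF continuous_on_id]]
         continuous_on_compose2[OF _ continuous_on_snd[OF continuous_on_id]])
  then show "continuous_on UNIV (\<lambda>p. cnj (u (fst p)) * v (snd p) * K (fst p) (snd p))"
    using assms(3) by (intro continuous_on_mult continuous_on_cnj)
  obtain R S where RS: "\<And>x. norm x > R \<Longrightarrow> u x = 0" "\<And>x. norm x > S \<Longrightarrow> v x = 0"
    using assms(1,2) unfolding Cc_def bdd_supp_def by blast
  have "cnj (u (fst p)) * v (snd p) * K (fst p) (snd p) = 0" if "norm p > \<bar>R\<bar> + \<bar>S\<bar>" for p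
  proof -
    have "norm p \<le> norm (fst p) + norm (snd p)" by (metis norm_Pair_le prod.collapse)
    then have "norm (fst p) > R \<or> norm (snd p) > S" using that by linarith
    then show ?thesis using RS by auto
  qed
  then show "bdd_supp (\<lambda>p. cnj (u (fst p)) * v (snd p) * K (fst p) (snd p))"
    unfolding bdd_supp_def by blast
qed

lemma kform_integrable:
  assumes "Cc u" "Cc v" "ckernel K"
  shows "integrable lborel (\<lambda>p. cnj (u (fst p)) * v (snd p) * K (fst p) (snd p))"
  using Cc_integrable[OF Cc_tensor[OF assms]] .

lemma kform_iterated:
  assumes "Cc u" "Cc v" "ckernel K"
  shows "kform K u v = (LINT z|lborel. LINT w|lborel. cnj (u z) * v w * K z w)"
    and "kform K u v = (LINT w|lborel. LINT z|lborel. cnj (u z) * v w * K z w)"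
proof -
  have i: "integrable (lborel \<Otimes>\<^sub>M lborel) (\<lambda>(z, w). cnj (u z) * v w * K z w)"
    using kform_integrable[OF assms] by (simp add: lborel_prod case_prod_unfold)
  show "kform K u v = (LINT z|lborel. LINT w|lborel. cnj (u z) * v w * K z w)"
    using lborel_pair.integral_fst[OF i] by (simp add: kform_def lborel_prod case_prod_unfold)
  show "kform K u v = (LINT w|lborel. LINT z|lborel. cnj (u z) * v w * K z w)"
    using lborel_pair.integral_snd[OF i] by (simp add: kform_def lborel_prod case_prod_unfold)
qed

lemma kform_diff:
  assumes "Cc u" "Cc v" "ckernel K"
  shows "kform K (\<lambda>x. u x - v x) (\<lambda>x. u x - v x) = kform K u u - kform K u v - kform K v u + kform K v v"
proof -
  have "kform K (\<lambda>x. u x - v x) (\<lambda>x. u x - v x) =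
    (LINT p|lborel. cnj (u (fst p)) * u (snd p) * K (fst p) (snd p)
       - cnj (u (fst p)) * v (snd p) * K (fst p) (snd p)
       - cnj (v (fst p)) * u (snd p) * K (fst p) (snd p)
       + cnj (v (fst p)) * v (snd p) * K (fst p) (snd p))"
    unfolding kform_def by (rule Bochner_Integration.integral_cong) (auto simp: algebra_simps)
  also have "\<dots> = kform K u u - kform K u v - kform K v u + kform K v v"
    unfolding kform_def using assms by (simp add: kform_integrable)
  finally show ?thesis .
qed

lemma kform_sum:
  assumes "Cc u" "Cc v" "finite I" "\<And>i. i \<in> I \<Longrightarrow> ckernel (K i)"
  shows "kform (\<lambda>z w. \<Sum>i\<in>I. K i z w) u v = (\<Sum>i\<in>I. kform (K i) u v)"
  unfolding kform_def sum_distrib_left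
  by (subst Bochner_Integration.integral_sum) (auto intro!: kform_integrable assms)

lemma kform_scale: "kform (\<lambda>z w. c * K z w) u v = c * kform K u v"
  unfolding kform_def by (subst integral_mult_right_zero[symmetric]) (simp add: mult_ac)

lemma ckernel_sum_power:
  assumes "finite I" "\<And>i. i \<in> I \<Longrightarrow> continuous_on UNIV (b i)"
  shows "ckernel (\<lambda>z w. (\<Sum>i\<in>I. b i z * cnj (b i w)) ^ m)"
  by (intro continuous_intros continuous_on_compose2[OF assms(2)] ) auto

text \<open>
  The kernels \<open>\<langle>b(z), b(w)\<rangle>\<^sup>m\<close> are positive: a factor \<open>b i z * cnj (b i w)\<close> can be absorbed into
  the function to which the form is applied.
\<close>

lemma kform_power_nonneg:
  assumes "finite I" "\<And>i. i \<in> I \<Longrightarrow> continuous_on UNIV (b i)" "Cc u"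
  shows "0 \<le> Re (kform (\<lambda>z w. (\<Sum>i\<in>I. b i z * cnj (b i w)) ^ m) u u)"
  using assms(3)
proof (induction m arbitrary: u)
  case 0
  have "kform (\<lambda>z w. 1) u u = (LINT z|lborel. LINT w|lborel. cnj (u z) * u w * 1)"
    by (rule kform_iterated) (use 0 in auto)
  also have "\<dots> = cnj (LINT w|lborel. u w) * (LINT w|lborel. u w)"
    using Cc_integrable[OF 0] by simp
  also have "\<dots> = of_real ((cmod (LINT w|lborel. u w))\<^sup>2)"
    by (simp add: complex_norm_square mult.commute del: of_real_power)
  finally show ?case by simp
next
  case (Suc m)
  define B where "B = (\<lambda>z w. \<Sum>i\<in>I. b i z * cnj (b i w))"
  have cu: "Cc (\<lambda>x. u x * cnj (b i x))" if "i \<in> I" for i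
    using Suc.prems assms(2)[OF that] by (intro Cc_mult_right continuous_intros)
  have ck: "ckernel (\<lambda>z w. b i z * cnj (b i w) * B z w ^ m)" if "i \<in> I" for i
    unfolding B_def using assms that
    by (intro continuous_intros continuous_on_compose2[OF assms(2)] ) auto
  have "kform (\<lambda>z w. B z w ^ Suc m) u u = kform (\<lambda>z w. \<Sum>i\<in>I. b i z * cnj (b i w) * B z w ^ m) u u"
    by (simp add: B_def sum_distrib_right)
  also have "\<dots> = (\<Sum>i\<in>I. kform (\<lambda>z w. b i z * cnj (b i w) * B z w ^ m) u u)"
    by (rule kform_sum[OF Suc.prems Suc.prems assms(1) ck])
  also have "\<dots> = (\<Sum>i\<in>I. kform (\<lambda>z w. B z w ^ m) (\<lambda>x. u x * cnj (b i x)) (\<lambda>x. u x * cnj (b i x)))"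
    unfolding kform_def by (intro sum.cong refl Bochner_Integration.integral_cong) (auto simp: mult_ac)
  finally show ?case using Suc.IH[OF cu] unfolding B_def by (auto intro!: sum_nonneg simp: Re_sum)
qed

lemma norm_exp_partial_sum_le:
  fixes x :: complex
  shows "norm (\<Sum>m<N. x ^ m / fact m) \<le> exp (norm x)"
proof -
  have "norm (\<Sum>m<N. x ^ m / fact m) \<le> (\<Sum>m<N. norm x ^ m / fact m)"
    by (rule order_trans[OF norm_sum]) (simp add: norm_divide norm_power)
  also have "\<dots> \<le> exp (norm x)"
    using exp_converges[of "norm x"] unfolding sums_iff
    by (metis (mono_tags, lifting) divide_inverse_commute norm_ge_zero real_scaleR_def sum_le_suminf
        zero_le_divide_iff zero_le_power fact_ge_zero finite_lessThan sum.cong)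
  finally show ?thesis .
qed

lemma kform_exp_partial_sums:
  assumes "Cc u" "Cc v" "ckernel B"
  shows "(\<lambda>N. kform (\<lambda>z w. \<Sum>m<N. B z w ^ m / fact m) u v) \<longlonglongrightarrow> kform (\<lambda>z w. exp (B z w)) u v"
  unfolding kform_def
proof (rule integral_dominated_convergence[where
    w="\<lambda>p. norm (cnj (u (fst p)) * v (snd p) * of_real (exp (norm (B (fst p) (snd p)))))"])
  let ?t = "\<lambda>K p. cnj (u (fst p)) * v (snd p) * K (fst p) (snd p)"
  have ce: "ckernel (\<lambda>z w. exp (B z w))" and cs: "ckernel (\<lambda>z w. \<Sum>m<N. B z w ^ m / fact m)" for N
    using assms(3) by (auto intro!: continuous_intros)
  have cm: "ckernel (\<lambda>z w. of_real (exp (norm (B z w))))"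
    using assms(3) by (auto intro!: continuous_intros)
  show "(\<lambda>p. ?t (\<lambda>z w. exp (B z w)) p) \<in> borel_measurable lborel"
    using kform_integrable[OF assms(1,2) ce] by auto
  show "(\<lambda>p. ?t (\<lambda>z w. \<Sum>m<N. B z w ^ m / fact m) p) \<in> borel_measurable lborel" for N
    using kform_integrable[OF assms(1,2) cs] by auto
  show "integrable lborel (\<lambda>p. norm (?t (\<lambda>z w. of_real (exp (norm (B z w)))) p))"
    using kform_integrable[OF assms(1,2) cm] by (rule integrable_norm)
  show "AE p in lborel. (\<lambda>N. ?t (\<lambda>z w. \<Sum>m<N. B z w ^ m / fact m) p) \<longlonglongrightarrow> ?t (\<lambda>z w. exp (B z w)) p"
  proof (rule AE_I2)
    fix p
    have "(\<lambda>N. \<Sum>m<N. B (fst p) (snd p) ^ m / fact m) \<longlonglongrightarrow> exp (B (fst p) (snd p))"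
      using exp_converges[of "B (fst p) (snd p)"]
      by (simp add: sums_def scaleR_conv_of_real divide_inverse mult.commute)
    then show "(\<lambda>N. ?t (\<lambda>z w. \<Sum>m<N. B z w ^ m / fact m) p) \<longlonglongrightarrow> ?t (\<lambda>z w. exp (B z w)) p"
      by (intro tendsto_mult tendsto_const)
  qed
  show "AE p in lborel. norm (?t (\<lambda>z w. \<Sum>m<N. B z w ^ m / fact m) p)
      \<le> norm (?t (\<lambda>z w. of_real (exp (norm (B z w)))) p)" for N
    by (rule AE_I2) (auto simp: norm_mult intro!: mult_left_mono norm_exp_partial_sum_le)
qed

text \<open>
Each term of the exponential series is a nonnegative multiple of a power of a Gram kernel, so the partial sums of the
form increase to the form of the exponential.
\<close>

lemma kform_exp_partial_sums_mono:
  assumes "finite I" "\<And>i. i \<in> I \<Longrightarrow> continuous_on UNIV (b i)" "Cc u"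
  shows "0 \<le> Re (kform (\<lambda>z w. \<Sum>m<N. (\<Sum>i\<in>I. b i z * cnj (b i w)) ^ m / fact m) u u)"
    and "Re (kform (\<lambda>z w. \<Sum>m<N. (\<Sum>i\<in>I. b i z * cnj (b i w)) ^ m / fact m) u u)
      \<le> Re (kform (\<lambda>z w. exp (\<Sum>i\<in>I. b i z * cnj (b i w))) u u)"
proof -
  define B where "B = (\<lambda>z w. \<Sum>i\<in>I. b i z * cnj (b i w))"
  define S where "S = (\<lambda>N. Re (kform (\<lambda>z w. \<Sum>m<N. B z w ^ m / fact m) u u))"
  have ck: "ckernel (\<lambda>z w. B z w ^ m)" for m
    unfolding B_def by (rule ckernel_sum_power[OF assms(1,2)])
  have "S N = (\<Sum>m<N. Re (kform (\<lambda>z w. B z w ^ m) u u) / fact m)" for N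
  proof -
    have "kform (\<lambda>z w. \<Sum>m<N. B z w ^ m / fact m) u u = (\<Sum>m<N. kform (\<lambda>z w. B z w ^ m / fact m) u u)"
      by (rule kform_sum[OF assms(3) assms(3)]) (auto intro!: continuous_on_divide ck)
    also have "\<dots> = (\<Sum>m<N. of_real (1 / fact m) * kform (\<lambda>z w. B z w ^ m) u u)"
      by (intro sum.cong refl, subst kform_scale[symmetric]) (simp add: mult.commute)
    finally have "S N = (\<Sum>m<N. Re (of_real (1 / fact m) * kform (\<lambda>z w. B z w ^ m) u u))"
      by (simp only: S_def Re_sum)
    also have "\<dots> = (\<Sum>m<N. Re (kform (\<lambda>z w. B z w ^ m) u u) / fact m)"
      by (simp only: times_complex.sel Re_complex_of_real Im_complex_of_real) simp
    finally show ?thesis .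
  qed
  moreover have "0 \<le> Re (kform (\<lambda>z w. B z w ^ m) u u) / fact m" for m
    unfolding B_def using kform_power_nonneg[OF assms, where m=m] by simp
  ultimately have nn: "0 \<le> S N" and "incseq S" for N
    by (auto intro!: sum_nonneg incseq_SucI)
  have ck1: "ckernel B" using ck[of 1] by simp
  have lim: "S \<longlonglongrightarrow> Re (kform (\<lambda>z w. exp (B z w)) u u)"
    unfolding S_def by (intro tendsto_intros kform_exp_partial_sums assms ck1)
  show "0 \<le> Re (kform (\<lambda>z w. \<Sum>m<N. (\<Sum>i\<in>I. b i z * cnj (b i w)) ^ m / fact m) u u)"
    using nn unfolding S_def B_def .
  show "Re (kform (\<lambda>z w. \<Sum>m<N. (\<Sum>i\<in>I. b i z * cnj (b i w)) ^ m / fact m) u u)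
      \<le> Re (kform (\<lambda>z w. exp (\<Sum>i\<in>I. b i z * cnj (b i w))) u u)"
    using incseq_le[OF \<open>incseq S\<close> lim, of N] unfolding S_def B_def .
qed

lemma has_vector_derivative_integral_exp:
  fixes \<Phi> A B :: "'a::euclidean_space \<Rightarrow> complex"
  assumes "Cc \<Phi>" "continuous_on UNIV A" "continuous_on UNIV B"
  shows "((\<lambda>t::real. LINT x|lborel. \<Phi> x * exp (A x + t * B x)) has_vector_derivative
           (LINT x|lborel. \<Phi> x * (B x * exp (A x + t * B x)))) (at t)"
proof -
  have c\<Phi>: "continuous_on UNIV \<Phi>" using assms(1) by (simp add: Cc_def)
  obtain R where R: "\<And>x. norm x > R \<Longrightarrow> \<Phi> x = 0" using assms(1) unfolding Cc_def bdd_supp_def by blast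
  obtain a b :: 'a where ab: "cball 0 R \<subseteq> cbox a b"
    using bounded_subset_cbox_symmetric[OF bounded_cball] by metis
  have out: "\<Phi> x = 0" if "x \<notin> cbox a b" for x
    using R[of x] ab that by (cases "norm x > R") (auto simp: subset_iff not_le not_less)
  have eq: "(LINT x|lborel. \<Phi> x * e x) = integral (cbox a b) (\<lambda>x. \<Phi> x * e x)"
    if "continuous_on UNIV e" for e
  proof -
    have i: "integrable lborel (\<lambda>x. \<Phi> x * e x)"
      using Cc_integrable[OF Cc_mult_right[OF assms(1) that]] .
    have "integral (cbox a b) (\<lambda>x. \<Phi> x * e x) = integral UNIV (\<lambda>x. if x \<in> cbox a b then \<Phi> x * e x else 0)"
      by (simp add: integral_restrict_UNIV)
    also have "(\<lambda>x. if x \<in> cbox a b then \<Phi> x * e x else 0) = (\<lambda>x. \<Phi> x * e x)"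
      using out by auto
    finally show ?thesis using integral_lborel[OF i] by simp
  qed
  have "((\<lambda>t::real. integral (cbox a b) (\<lambda>x. \<Phi> x * exp (A x + t * B x))) has_vector_derivative
           integral (cbox a b) (\<lambda>x. \<Phi> x * (B x * exp (A x + t * B x)))) (at t within UNIV)"
  proof (rule leibniz_rule_vector_derivative)
    fix s :: real and x
    show "((\<lambda>s. \<Phi> x * exp (A x + complex_of_real s * B x)) has_vector_derivative \<Phi> x * (B x * exp (A x + complex_of_real s * B x))) (at s within UNIV)"
      by (rule has_vector_derivative_real_field) (auto intro!: derivative_eq_intros)
    show "(\<lambda>x. \<Phi> x * exp (A x + complex_of_real s * B x)) integrable_on cbox a b"
      by (intro integrable_continuous continuous_intros continuous_on_subset[OF c\<Phi>]
           continuous_on_subset[OF assms(2)] continuous_on_subset[OF assms(3)]) auto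
  next
    have c: "continuous_on UNIV (\<lambda>p::real \<times> 'a. f (snd p))" if "continuous_on UNIV f" for f :: "'a \<Rightarrow> complex"
      by (intro continuous_on_compose2[OF that] continuous_intros) auto
    have "continuous_on UNIV (\<lambda>p::real \<times> 'a. \<Phi> (snd p) * (B (snd p) * exp (A (snd p) + complex_of_real (fst p) * B (snd p))))"
      by (intro continuous_intros c c\<Phi> assms)
    then show "continuous_on (UNIV \<times> cbox a b) (\<lambda>(s, x). \<Phi> x * (B x * exp (A x + complex_of_real s * B x)))"
      unfolding case_prod_beta by (rule continuous_on_subset) auto
  qed auto
  moreover have "(\<lambda>t::real. LINT x|lborel. \<Phi> x * exp (A x + t * B x)) = (\<lambda>t. integral (cbox a b) (\<lambda>x. \<Phi> x * exp (A x + t * B x)))"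
    by (intro ext eq continuous_intros assms)
  moreover have "(LINT x|lborel. \<Phi> x * (B x * exp (A x + t * B x))) = integral (cbox a b) (\<lambda>x. \<Phi> x * (B x * exp (A x + t * B x)))"
    by (intro eq continuous_intros assms)
  ultimately show ?thesis by simp
qed

section \<open>Gaussian kernels on complex space\<close>

definition gauss :: "real \<Rightarrow> complex ^ 'n::finite \<Rightarrow> real" where
  "gauss \<beta> z = exp (- \<beta> * (norm z)\<^sup>2)"

text \<open>
With Gaussian factors \<open>exp(-\<beta> |z|\<^sup>2)\<close> and \<open>exp(-\<beta> |w|\<^sup>2)\<close> included and up to normalization, this is the kernel of the semigroup
\<open>exp(-s dbar* dbar / \<beta>)\<close> at the time \<open>s\<close> with \<open>exp(-s) = 1 - 1/t\<close>. At \<open>t = 1\<close> (infinite time) it is the Bargmann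
kernel of the projection onto holomorphic functions, and as \<open>t\<close> tends to infinity (time zero) it concentrates on the diagonal.
\<close>

definition gkernel :: "real \<Rightarrow> real \<Rightarrow> complex ^ 'n::finite \<Rightarrow> complex ^ 'n \<Rightarrow> complex" where
  "gkernel \<beta> t z w = exp (of_real \<beta> * (of_real t * hdot z w + of_real (t - 1) * hdot w z
     - of_real t * hdot z z - of_real t * hdot w w))"

text \<open>
The Gaussian is a product over the coordinates of one-dimensional normal densities.
\<close>

lemma integrable_gauss:
  assumes "\<beta> > 0"
  shows "integrable lborel (\<lambda>x::'a::euclidean_space. exp (- \<beta> * (norm x)\<^sup>2))"
proof (rule integrableI_nonneg)
  have i1: "integrable lborel (\<lambda>x::real. exp (- \<beta> * x\<^sup>2))"
  proof -
    have "integrable lborel (\<lambda>x. sqrt (pi / \<beta>) * normal_density 0 (1 / sqrt (2 * \<beta>)) x)"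
      using assms by (intro integrable_mult_right integrable_normal_density) auto
    also have "(\<lambda>x. sqrt (pi / \<beta>) * normal_density 0 (1 / sqrt (2 * \<beta>)) x) = (\<lambda>x. exp (- \<beta> * x\<^sup>2))"
      using assms by (auto simp: normal_density_def power_divide real_sqrt_divide field_simps)
    finally show ?thesis .
  qed
  have "(\<integral>\<^sup>+x. ennreal (exp (- \<beta> * (norm (x::'a))\<^sup>2)) \<partial>lborel) =
      (\<integral>\<^sup>+x. (\<Prod>b\<in>Basis. ennreal (exp (- \<beta> * ((x::'a) \<bullet> b)\<^sup>2))) \<partial>lborel)"
  proof (intro nn_integral_cong)
    fix x :: 'a
    have "(norm x)\<^sup>2 = (\<Sum>b\<in>Basis. (x \<bullet> b)\<^sup>2)"
      unfolding power2_norm_eq_inner by (subst euclidean_inner) (simp add: power2_eq_square)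
    then show "ennreal (exp (- \<beta> * (norm x)\<^sup>2)) = (\<Prod>b\<in>Basis. ennreal (exp (- \<beta> * (x \<bullet> b)\<^sup>2)))"
      by (simp add: prod_ennreal exp_sum[symmetric] sum_distrib_left sum_negf)
  qed
  also have "\<dots> = (\<Prod>b\<in>(Basis::'a set). (\<integral>\<^sup>+x. ennreal (exp (- \<beta> * x\<^sup>2)) \<partial>lborel))"
    by (rule nn_integral_lborel_prod) auto
  also have "\<dots> < \<infinity>"
    using i1 by (auto simp: prod_constant nn_integral_eq_integral power_less_top_ennreal)
  finally show "(\<integral>\<^sup>+x. ennreal (exp (- \<beta> * (norm (x::'a))\<^sup>2)) \<partial>lborel) < \<infinity>" .
qed auto

definition gmass :: "real \<Rightarrow> 'n::finite itself \<Rightarrow> real" where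
  "gmass \<beta> _ = (LINT z|lborel. gauss \<beta> (z :: complex ^ 'n))"

lemma continuous_gauss: "continuous_on A (gauss \<beta>)"
  unfolding gauss_def by (intro continuous_intros)

lemma ckernel_gkernel: "ckernel (gkernel \<beta> t)"
  unfolding gkernel_def by (intro continuous_intros)

lemma cnj_gkernel: "cnj (gkernel \<beta> t z w) = gkernel \<beta> t w z"
  by (simp add: gkernel_def exp_cnj cnj_hdot del: of_real_diff) (simp add: algebra_simps)

lemma gkernel_has_derivative:
  "(gkernel \<beta> t z has_derivative (\<lambda>v. of_real \<beta> * (of_real t * hdot z v + of_real (t - 1) * hdot v z
      - of_real t * (hdot w v + hdot v w)) * gkernel \<beta> t z w)) (at w)"
proof -
  let ?E = "\<lambda>w. of_real \<beta> * (of_real t * hdot z w + of_real (t - 1) * hdot w z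
     - of_real t * hdot z z - of_real t * hdot w w)"
  have "(?E has_derivative (\<lambda>v. of_real \<beta> * (of_real t * hdot z v + of_real (t - 1) * hdot v z
      - of_real t * (hdot w v + hdot v w)))) (at w)"
    by (rule has_derivative_eq_rhs, (rule derivative_intros has_derivative_hdot)+)
       (auto simp: bounded_bilinear.zero_left[OF bounded_bilinear_hdot]
          bounded_bilinear.zero_right[OF bounded_bilinear_hdot] algebra_simps)
  from has_derivative_compose[OF this DERIV_exp[unfolded has_field_derivative_def]]
  show ?thesis unfolding gkernel_def by (simp add: mult.commute)
qed

lemma C1_gkernel: "C1 (gkernel \<beta> t z)"
proof (rule C1I[OF gkernel_has_derivative])
  fix v
  have "continuous_on UNIV (\<lambda>w. gkernel \<beta> t z w)" unfolding gkernel_def by (intro continuous_intros)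
  then show "continuous_on UNIV (\<lambda>w. of_real \<beta> * (of_real t * hdot z v + of_real (t - 1) * hdot v z
      - of_real t * (hdot w v + hdot v w)) * gkernel \<beta> t z w)"
    by (intro continuous_intros)
qed

text \<open>
The part of the exponent that depends holomorphically on \<open>w\<close> is annihilated by \<open>dbar\<close>, and only the terms
\<open>t * hdot z w\<close> and \<open>- t * hdot w w\<close> contribute.
\<close>

lemma dbar_gkernel: "dbar k (gkernel \<beta> t z) w = of_real (\<beta> * t) * (z $ k - w $ k) * gkernel \<beta> t z w"
  unfolding dbar_def ddir_eqI[OF gkernel_has_derivative]
  by (simp add: hdot_axis_left hdot_axis_right field_simps)

lemma C1_cnj_component: "C1 (\<lambda>z. cnj (z $ k) - c)"
  and dbar_cnj_component: "dbar k (\<lambda>z. cnj (z $ k) - c) z = 1"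
proof -
  have bl: "bounded_linear (\<lambda>z::complex^'n. cnj (z $ k))" for k
    by (intro bounded_linear_compose[OF bounded_linear_cnj] bounded_linear_vec_nth)
  have d: "((\<lambda>z. cnj (z $ k) - c) has_derivative (\<lambda>v. cnj (v $ k))) (at z)" for z k and c
    using has_derivative_diff[OF bounded_linear.has_derivative[OF bl has_derivative_ident] has_derivative_const[of c]]
    by simp
  show "C1 (\<lambda>z. cnj (z $ k) - c)" by (rule C1I[OF d]) auto
  show "dbar k (\<lambda>z. cnj (z $ k) - c) z = 1"
    unfolding dbar_def ddir_eqI[OF d] by (simp add: axis_def)
qed

text \<open>
  Integration by parts in \<open>w\<close> produces the factor \<open>\<beta> t (z $ k - w $ k)\<close>. In the second one, in \<open>z\<close>, the derivative hits this factor, which gives the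
  constant term, and the kernel, which gives the quadratic one.
\<close>

lemma kform_gkernel_dbar:
  assumes "C1 u" "bdd_supp u"
  shows "kform (gkernel \<beta> t) (dbar k u) (dbar k u) = 
    of_real (\<beta> * t) * kform (\<lambda>z w. (1 - of_real (\<beta> * t) * ((z $ k - w $ k) * cnj (z $ k - w $ k))) * gkernel \<beta> t z w) u u"
proof -
  note cc = Cc_dbar[OF assms, of k] C1_Cc[OF assms]
  let ?c = "complex_of_real (\<beta> * t)"
  have ck1: "ckernel (\<lambda>z w. (z $ k - w $ k) * gkernel \<beta> t z w)"
    unfolding gkernel_def by (intro continuous_intros)
  have ck2: "ckernel (\<lambda>z w. (1 - ?c * ((z $ k - w $ k) * cnj (z $ k - w $ k))) * gkernel \<beta> t z w)"
    unfolding gkernel_def by (intro continuous_intros)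
  have s1: "(LINT w|lborel. cnj (dbar k u z) * dbar k u w * gkernel \<beta> t z w)
     = - ?c * (LINT w|lborel. cnj (dbar k u z) * u w * ((z $ k - w $ k) * gkernel \<beta> t z w))" for z
  proof -
    have "(LINT w|lborel. cnj (dbar k u z) * dbar k u w * gkernel \<beta> t z w)
      = cnj (dbar k u z) * (LINT w|lborel. dbar k u w * gkernel \<beta> t z w)"
      by (subst integral_mult_right_zero[symmetric]) (simp add: mult_ac)
    also have "\<dots> = - cnj (dbar k u z) * (LINT w|lborel. u w * dbar k (gkernel \<beta> t z) w)"
      by (subst integral_by_parts_dbar[OF assms C1_gkernel]) simp
    also have "(LINT w|lborel. u w * dbar k (gkernel \<beta> t z) w) = ?c * (LINT w|lborel. u w * ((z $ k - w $ k) * gkernel \<beta> t z w))"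
      unfolding dbar_gkernel by (subst integral_mult_right_zero[symmetric]) (simp add: mult_ac)
    also have "- cnj (dbar k u z) * (?c * (LINT w|lborel. u w * ((z $ k - w $ k) * gkernel \<beta> t z w)))
       = - ?c * (cnj (dbar k u z) * (LINT w|lborel. u w * ((z $ k - w $ k) * gkernel \<beta> t z w)))" by simp
    also have "cnj (dbar k u z) * (LINT w|lborel. u w * ((z $ k - w $ k) * gkernel \<beta> t z w))
      = (LINT w|lborel. cnj (dbar k u z) * u w * ((z $ k - w $ k) * gkernel \<beta> t z w))"
      by (subst integral_mult_right_zero[symmetric]) (simp add: mult_ac)
    finally show ?thesis .
  qed
  have s2: "(LINT z|lborel. cnj (dbar k u z) * u w * ((z $ k - w $ k) * gkernel \<beta> t z w))
     = - (LINT z|lborel. cnj (u z) * u w * ((1 - ?c * ((z $ k - w $ k) * cnj (z $ k - w $ k))) * gkernel \<beta> t z w))" for w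
  proof -
    let ?e = "\<lambda>z. (cnj (z $ k) - cnj (w $ k)) * gkernel \<beta> t w z"
    have de: "dbar k ?e z = (cnj (z $ k) - cnj (w $ k)) * (?c * (w $ k - z $ k) * gkernel \<beta> t w z) + gkernel \<beta> t w z" for z
      by (simp only: dbar_mult[OF C1_cnj_component C1_gkernel] dbar_cnj_component dbar_gkernel mult_1)
    have "(LINT z|lborel. cnj (dbar k u z) * u w * ((z $ k - w $ k) * gkernel \<beta> t z w))
       = (LINT z|lborel. cnj (dbar k u z * ?e z) * u w)"
      by (rule Bochner_Integration.integral_cong) (auto simp: cnj_gkernel)
    also have "\<dots> = cnj (LINT z|lborel. dbar k u z * ?e z) * u w"
      by (simp del: complex_cnj_mult)
    also have "(LINT z|lborel. dbar k u z * ?e z) = - (LINT z|lborel. u z * dbar k ?e z)"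
      by (rule integral_by_parts_dbar[OF assms C1_mult[OF C1_cnj_component C1_gkernel]])
    also have "cnj (- (LINT z|lborel. u z * dbar k ?e z)) * u w = - (LINT z|lborel. cnj (u z * dbar k ?e z) * u w)"
      by (simp del: complex_cnj_mult)
    also have "(LINT z|lborel. cnj (u z * dbar k ?e z) * u w) = (LINT z|lborel. cnj (u z) * u w * ((1 - ?c * ((z $ k - w $ k) * cnj (z $ k - w $ k))) * gkernel \<beta> t z w))"
      by (rule Bochner_Integration.integral_cong)
         (simp_all only: de complex_cnj_mult complex_cnj_add complex_cnj_diff complex_cnj_cnj cnj_gkernel complex_cnj_complex_of_real, simp_all add: algebra_simps)
    finally show ?thesis .
  qed
  have "kform (gkernel \<beta> t) (dbar k u) (dbar k u) = (LINT z|lborel. LINT w|lborel. cnj (dbar k u z) * dbar k u w * gkernel \<beta> t z w)"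
    by (rule kform_iterated(1)[OF cc(1) cc(1) ckernel_gkernel])
  also have "\<dots> = - ?c * (LINT z|lborel. LINT w|lborel. cnj (dbar k u z) * u w * ((z $ k - w $ k) * gkernel \<beta> t z w))"
    unfolding s1 by (rule integral_mult_right_zero)
  also have "(LINT z|lborel. LINT w|lborel. cnj (dbar k u z) * u w * ((z $ k - w $ k) * gkernel \<beta> t z w))
    = (LINT w|lborel. LINT z|lborel. cnj (dbar k u z) * u w * ((z $ k - w $ k) * gkernel \<beta> t z w))"
    using kform_iterated[OF cc ck1] by simp
  also have "\<dots> = - (LINT w|lborel. LINT z|lborel. cnj (u z) * u w * ((1 - ?c * ((z $ k - w $ k) * cnj (z $ k - w $ k))) * gkernel \<beta> t z w))"
    unfolding s2 by (rule Bochner_Integration.integral_minus)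
  also have "(LINT w|lborel. LINT z|lborel. cnj (u z) * u w * ((1 - ?c * ((z $ k - w $ k) * cnj (z $ k - w $ k))) * gkernel \<beta> t z w))
     = kform (\<lambda>z w. (1 - ?c * ((z $ k - w $ k) * cnj (z $ k - w $ k))) * gkernel \<beta> t z w) u u"
    by (rule kform_iterated(2)[OF cc(2) cc(2) ck2, symmetric])
  finally show ?thesis by simp
qed

text \<open>
The power of \<open>t\<close> makes the total mass of the kernel in one variable comparable for all \<open>t\<close>, so that the form has a limit as \<open>t\<close> tends to
infinity.
\<close>

definition gform :: "real \<Rightarrow> (complex ^ 'n::finite \<Rightarrow> complex) \<Rightarrow> real \<Rightarrow> real" where
  "gform \<beta> u t = t ^ CARD('n) * Re (kform (gkernel \<beta> t) u u)"

text \<open>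
The semigroup satisfies \<open>d/ds exp(-s L) = - L exp(-s L)\<close> and \<open>dbar\<close> intertwines \<open>L\<close> with \<open>L + 1\<close>; in the
parameter \<open>t\<close> both facts together become this formula. Here it is a direct comparison: differentiating the kernel in \<open>t\<close> produces the factor
\<open>n/t - \<beta> |z - w|\<^sup>2\<close>, which is what the sum over \<open>k\<close> of the double integrations by parts produces.
\<close>

lemma gform_has_derivative:
  fixes u :: "complex ^ 'n::finite \<Rightarrow> complex"
  assumes "C1 u" "bdd_supp u" "\<beta> > 0" "t > 0"
  shows "(gform \<beta> u has_real_derivative (\<Sum>k\<in>UNIV. gform \<beta> (dbar k u) t) / (\<beta> * t\<^sup>2)) (at t)"
proof -
  let ?n = "CARD('n)"
  define d where "d = (\<lambda>z w :: complex ^ 'n. \<Sum>k\<in>UNIV. (z $ k - w $ k) * cnj (z $ k - w $ k))"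
  define a where "a = Re (kform (gkernel \<beta> t) u u)"
  define b where "b = Re (kform (\<lambda>z w. d z w * gkernel \<beta> t z w) u u)"
  note cu = C1_Cc[OF assms(1,2)]
  let ?\<Phi> = "\<lambda>p. cnj (u (fst p)) * u (snd p) * 1"
  let ?A = "\<lambda>p. - of_real \<beta> * hdot (snd p) (fst p)"
  let ?B = "\<lambda>p. - of_real \<beta> * d (fst p) (snd p)"
  have gkernel_eq: "gkernel \<beta> s z w = exp (- of_real \<beta> * hdot w z + of_real s * (- of_real \<beta> * d z w))" for s z w
  proof -
    have "d z w = hdot z z - hdot z w - hdot w z + hdot w w"
      unfolding d_def hdot_def sum_subtractf[symmetric] sum.distrib[symmetric]
      by (intro sum.cong) (auto simp: algebra_simps)
    then show ?thesis
      unfolding gkernel_def by (simp only:) (intro arg_cong[of _ _ exp], simp add: algebra_simps)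
  qed
  have "((\<lambda>s. kform (gkernel \<beta> s) u u) has_vector_derivative
     (LINT p|lborel. ?\<Phi> p * (?B p * exp (?A p + of_real t * ?B p)))) (at t)"
  proof -
    have "Cc ?\<Phi>" by (rule Cc_tensor[OF cu cu, of "\<lambda>_ _. 1"]) auto
    moreover have "continuous_on UNIV ?A" "continuous_on UNIV ?B"
      unfolding d_def by (auto intro!: continuous_intros)
    ultimately show ?thesis
      using has_vector_derivative_integral_exp[of ?\<Phi> ?A ?B t] by (simp add: kform_def gkernel_eq)
  qed
  also have "(LINT p|lborel. ?\<Phi> p * (?B p * exp (?A p + of_real t * ?B p))) = - of_real \<beta> * kform (\<lambda>z w. d z w * gkernel \<beta> t z w) u u"
    unfolding kform_scale[symmetric] unfolding kform_def gkernel_eq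
    by (rule Bochner_Integration.integral_cong) (auto simp: mult_ac)
  finally have "((\<lambda>s. Re (kform (gkernel \<beta> s) u u)) has_real_derivative (- \<beta> * b)) (at t)"
    unfolding has_real_derivative_iff_has_vector_derivative
    by (rule has_vector_derivative_eq_rhs[OF bounded_linear.has_vector_derivative[OF bounded_linear_Re]])
       (simp add: b_def)
  then have "(gform \<beta> u has_real_derivative (of_nat ?n * t ^ (?n - 1) * a + t ^ ?n * (- \<beta> * b))) (at t)"
    unfolding gform_def a_def
    by (intro DERIV_cong[OF DERIV_mult[OF DERIV_power[OF DERIV_ident]]]) (assumption, simp)
  also have "of_nat ?n * t ^ (?n - 1) * a + t ^ ?n * (- \<beta> * b) = (\<Sum>k\<in>UNIV. gform \<beta> (dbar k u) t) / (\<beta> * t\<^sup>2)"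
  proof -
    let ?q = "\<lambda>k z w. (z $ k - w $ k) * cnj (z $ k - w $ k)"
    have ckq: "ckernel (\<lambda>z w. ?q k z w * gkernel \<beta> t z w)" for k
      unfolding gkernel_def by (intro continuous_intros)
    have ckq': "ckernel (\<lambda>z w. of_real (\<beta> * t) * (?q k z w * gkernel \<beta> t z w))" for k
      unfolding gkernel_def by (intro continuous_intros)
    have "kform (\<lambda>z w. (1 - of_real (\<beta> * t) * ?q k z w) * gkernel \<beta> t z w) u u
      = kform (gkernel \<beta> t) u u - of_real (\<beta> * t) * kform (\<lambda>z w. ?q k z w * gkernel \<beta> t z w) u u" for k
      unfolding kform_scale[symmetric] unfolding kform_def
      by (subst Bochner_Integration.integral_diff[symmetric, OF kform_integrable[OF cu cu ckernel_gkernel] kform_integrable[OF cu cu ckq']])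
         (auto intro!: Bochner_Integration.integral_cong simp: algebra_simps)
    then have k1: "Re (kform (gkernel \<beta> t) (dbar k u) (dbar k u)) = \<beta> * t * (a - \<beta> * t * Re (kform (\<lambda>z w. ?q k z w * gkernel \<beta> t z w) u u))" for k
      unfolding kform_gkernel_dbar[OF assms(1,2)] a_def by simp
    have "b = (\<Sum>k\<in>UNIV. Re (kform (\<lambda>z w. ?q k z w * gkernel \<beta> t z w) u u))"
      unfolding b_def d_def sum_distrib_right
      by (subst kform_sum[OF cu cu finite ckq]) (simp_all only: Re_sum)
    then have "(\<Sum>k\<in>UNIV. Re (kform (gkernel \<beta> t) (dbar k u) (dbar k u))) = \<beta> * t * (of_nat ?n * a - \<beta> * t * b)"
      unfolding k1 by (simp add: sum_distrib_left[symmetric] sum_subtractf)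
    then have "(\<Sum>k\<in>UNIV. gform \<beta> (dbar k u) t) = t ^ ?n * (\<beta> * t * (of_nat ?n * a - \<beta> * t * b))"
      unfolding gform_def by (simp add: sum_distrib_left[symmetric])
    moreover have "t ^ ?n = t * t ^ (?n - 1)" by (simp flip: power_Suc)
    ultimately show ?thesis using assms(3,4) by (simp add: field_simps power2_eq_square)
  qed
  finally show ?thesis .
qed

text \<open>
For \<open>t \<ge> 1\<close> both \<open>t * hdot z w\<close> and \<open>(t - 1) * hdot w z\<close> are Gram kernels; the remaining exponents factor and are absorbed in \<open>u\<close>.
\<close>

lemma gform_nonneg:
  fixes u :: "complex ^ 'n::finite \<Rightarrow> complex"
  assumes "Cc u" "\<beta> > 0" "t \<ge> 1"
  shows "gform \<beta> u t \<ge> 0"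
proof -
  define I where "I = (UNIV :: 'n set) \<times> (UNIV :: bool set)"
  define b :: "'n \<times> bool \<Rightarrow> complex ^ 'n \<Rightarrow> complex" where
    "b = (\<lambda>(k, c) z. if c then of_real (sqrt (\<beta> * t)) * z $ k else of_real (sqrt (\<beta> * (t - 1))) * cnj (z $ k))"
  let ?u = "\<lambda>z. u z * of_real (gauss (\<beta> * t) z)"
  have sq: "complex_of_real (sqrt x) * complex_of_real (sqrt x) = of_real x" if "x \<ge> 0" for x
    using that by (simp flip: of_real_mult)
  have B: "(\<Sum>i\<in>I. b i z * cnj (b i w)) = of_real \<beta> * (of_real t * hdot z w + of_real (t - 1) * hdot w z)" for z w
  proof -
    have e: "b (k, True) z * cnj (b (k, True) w) = of_real (\<beta> * t) * (z $ k * cnj (w $ k))"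
         "b (k, False) z * cnj (b (k, False) w) = of_real (\<beta> * (t - 1)) * (w $ k * cnj (z $ k))" for k
      using sq[of "\<beta> * t"] sq[of "\<beta> * (t - 1)"] assms by (auto simp: b_def simp del: of_real_mult of_real_diff)
    have "(\<Sum>i\<in>I. b i z * cnj (b i w)) = (\<Sum>k\<in>UNIV. b (k, True) z * cnj (b (k, True) w) + b (k, False) z * cnj (b (k, False) w))"
      unfolding I_def sum.cartesian_product' by (simp add: UNIV_bool add.commute)
    also have "\<dots> = of_real \<beta> * (of_real t * hdot z w + of_real (t - 1) * hdot w z)"
      unfolding e hdot_def sum_distrib_left sum.distrib[symmetric]
      by (intro sum.cong) (auto simp: algebra_simps)
    finally show ?thesis .
  qed
  have "continuous_on UNIV (b i)" for i
    unfolding b_def by (cases i; cases "snd i") (auto intro!: continuous_intros)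
  moreover have "Cc ?u" using assms(1) by (auto intro!: Cc_mult_right continuous_intros continuous_gauss)
  ultimately have "0 \<le> Re (kform (\<lambda>z w. exp (\<Sum>i\<in>I. b i z * cnj (b i w))) ?u ?u)"
    by (intro order_trans[OF kform_exp_partial_sums_mono(1) kform_exp_partial_sums_mono(2)[where N=0]]) (auto simp: I_def)
  also have "kform (\<lambda>z w. exp (\<Sum>i\<in>I. b i z * cnj (b i w))) ?u ?u = kform (gkernel \<beta> t) u u"
  proof -
    have "gkernel \<beta> t z w = of_real (gauss (\<beta> * t) z) * of_real (gauss (\<beta> * t) w)
        * exp (of_real \<beta> * (of_real t * hdot z w + of_real (t - 1) * hdot w z))" for z w :: "complex ^ 'n"
      unfolding gkernel_def gauss_def hdot_self exp_of_real[symmetric] exp_add[symmetric]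
      by (rule arg_cong[of _ _ exp]) (simp add: algebra_simps)
    then show ?thesis unfolding kform_def B
      by (intro Bochner_Integration.integral_cong refl) (simp add: mult_ac)
  qed
  finally show ?thesis unfolding gform_def using assms(3) by simp
qed

lemma integral_affine_subst:
  fixes f :: "'a::euclidean_space \<Rightarrow> complex"
  assumes "s > 0" and [measurable]: "f \<in> borel_measurable borel"
  shows "(LINT w|lborel. f w) = of_real (s ^ DIM('a)) * (LINT v|lborel. f (z + s *\<^sub>R v))"
proof -
  have "(LINT w|lborel. f w) = (LINT w|density (distr lborel borel (\<lambda>x. z + s *\<^sub>R x)) (\<lambda>_. ennreal (\<bar>s\<bar>^DIM('a))). f w)"
    using lborel_affine[of s z] assms(1) by simp
  also have "\<dots> = (LINT w|distr lborel borel (\<lambda>x. z + s *\<^sub>R x). (s^DIM('a)) *\<^sub>R f w)"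
    using assms by (subst integral_density) auto
  also have "\<dots> = (LINT v|lborel. (s^DIM('a)) *\<^sub>R f (z + s *\<^sub>R v))"
    by (subst integral_distr) auto
  finally show ?thesis by (simp add: scaleR_conv_of_real)
qed

text \<open>
Around the diagonal the natural length is \<open>s = t\<^sup>-\<^sup>1\<^sup>/\<^sup>2\<close>; in the scaled variable the kernel depends continuously on \<open>s\<close> up to \<open>s = 0\<close>.
\<close>

lemma gkernel_scaled:
  assumes "s > 0"
  shows "gkernel \<beta> (1 / s\<^sup>2) z (z + s *\<^sub>R v) = exp (of_real \<beta> * (hdot z (z + s *\<^sub>R v) - hdot z z
     - hdot (z + s *\<^sub>R v) (z + s *\<^sub>R v) - of_real (1 - s\<^sup>2) * hdot v v))"
proof -
  note bb = bounded_bilinear.add_left[OF bounded_bilinear_hdot] bounded_bilinear.add_right[OF bounded_bilinear_hdot]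
     bounded_bilinear.scaleR_left[OF bounded_bilinear_hdot] bounded_bilinear.scaleR_right[OF bounded_bilinear_hdot]
  have "complex_of_real s \<noteq> 0" using assms by simp
  then show ?thesis
    unfolding gkernel_def bb
    by (intro arg_cong[of _ _ exp]) (simp add: scaleR_conv_of_real field_simps power2_eq_square)
qed

lemma norm_gkernel_scaled_le:
  assumes "0 < s" "s \<le> 1" "\<beta> > 0"
  shows "norm (gkernel \<beta> (1 / s\<^sup>2) z (z + s *\<^sub>R v)) \<le> gauss (\<beta> / 2) v"
proof -
  let ?w = "z + s *\<^sub>R v"
  have "2 * inner z ?w = (norm z)\<^sup>2 + (norm ?w)\<^sup>2 - (norm (s *\<^sub>R v))\<^sup>2"
    by (simp add: power2_norm_eq_inner inner_add_left inner_add_right inner_commute del: norm_scaleR)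
  then have "inner z ?w - (norm z)\<^sup>2 - (norm ?w)\<^sup>2 - (1 - s\<^sup>2) * (norm v)\<^sup>2
     = - (norm z)\<^sup>2 / 2 - (norm ?w)\<^sup>2 / 2 - (1 - s\<^sup>2 / 2) * (norm v)\<^sup>2"
    by (simp add: power_mult_distrib field_simps)
  also have "\<dots> \<le> - (1 - s\<^sup>2 / 2) * (norm v)\<^sup>2"
    using zero_le_power2[of "norm z"] zero_le_power2[of "norm ?w"] by (simp add: algebra_simps)
  also have "\<dots> \<le> - (1 / 2) * (norm v)\<^sup>2"
    using assms power_le_one[of s 2] by (intro mult_right_mono) auto
  finally have "\<beta> * (inner z ?w - (norm z)\<^sup>2 - (norm ?w)\<^sup>2 - (1 - s\<^sup>2) * (norm v)\<^sup>2) \<le> \<beta> * (- (1 / 2) * (norm v)\<^sup>2)"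
    using assms by (intro mult_left_mono) auto
  then show ?thesis
    unfolding gkernel_scaled[OF assms(1)] norm_exp_eq_Re gauss_def by (simp add: Re_hdot hdot_self algebra_simps)
qed

text \<open>
After the substitution \<open>w = z + s v\<close> with \<open>t = 1 / s\<^sup>2\<close> the Jacobian cancels the power of \<open>t\<close>, and dominated convergence applies with the
Gaussian bound of \<open>norm_gkernel_scaled_le\<close>. The sequence \<open>s = 1/(i+1)\<close> is enough.
\<close>

lemma gform_tendsto:
  fixes u :: "complex ^ 'n::finite \<Rightarrow> complex"
  assumes "Cc u" "\<beta> > 0"
  shows "(\<lambda>i. gform \<beta> u ((real (Suc i))\<^sup>2)) \<longlonglongrightarrow> gmass \<beta> TYPE('n) * (LINT z|lborel. (cmod (u z))\<^sup>2 * gauss \<beta> z)"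
proof -
  define s where "s = (\<lambda>i::nat. inverse (real (Suc i)))"
  have s0: "s i > 0" "s i \<le> 1" for i by (auto simp: s_def inverse_le_1_iff)
  have slim: "s \<longlonglongrightarrow> 0" unfolding s_def by (rule LIMSEQ_inverse_real_of_nat)
  have ts: "(real (Suc i))\<^sup>2 = 1 / (s i)\<^sup>2" for i by (simp add: s_def field_simps)
  obtain C where C: "C \<ge> 0" "\<And>x. norm (u x) \<le> C"
    using bounded_bdd_supp assms(1) unfolding Cc_def by metis
  have cu: "continuous_on UNIV u" using assms(1) by (simp add: Cc_def)
  have iu: "integrable lborel u" using Cc_integrable[OF assms(1)] .
  have ig: "integrable lborel (gauss (\<beta> / 2) :: complex ^ 'n \<Rightarrow> real)"
    using integrable_gauss[of "\<beta> / 2"] assms(2) by (simp add: gauss_def[abs_def])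
  define J where "J = (\<lambda>i z. LINT v|lborel. cnj (u z) * u (z + s i *\<^sub>R v) * gkernel \<beta> (1 / (s i)\<^sup>2) z (z + s i *\<^sub>R v))"
  define L where "L = (\<lambda>z. (cnj (u z) * u z * of_real (gauss \<beta> z)) * of_real (gmass \<beta> TYPE('n)))"
  have cgk: "continuous_on UNIV (gkernel \<beta> t z)" for t and z :: "complex ^ 'n" by (rule C1_continuous[OF C1_gkernel])
  have cus: "continuous_on UNIV (\<lambda>v. u (z + r *\<^sub>R v))" for z r
    by (intro continuous_on_compose2[OF cu] continuous_intros) auto
  have cgs: "continuous_on UNIV (\<lambda>v. gkernel \<beta> t z (z + r *\<^sub>R v))" for z :: "complex ^ 'n" and r t
    by (rule continuous_on_compose2[where g="gkernel \<beta> t z", OF cgk]) (auto intro!: continuous_intros)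
  have J_eq: "J i z = of_real (((real (Suc i))\<^sup>2) ^ CARD('n)) * (LINT w|lborel. cnj (u z) * u w * gkernel \<beta> ((real (Suc i))\<^sup>2) z w)" for i z
  proof -
    have m: "(\<lambda>w. cnj (u z) * u w * gkernel \<beta> ((real (Suc i))\<^sup>2) z w) \<in> borel_measurable borel"
      by (intro borel_measurable_continuous_onI continuous_intros cu cgk)
    have "s i ^ DIM(complex ^ 'n) * ((real (Suc i))\<^sup>2) ^ CARD('n) = 1"
      unfolding ts using s0[of i] by (simp add: power_one_over flip: power_mult) (simp add: mult.commute)
    then have one: "complex_of_real (((real (Suc i))\<^sup>2) ^ CARD('n)) * of_real (s i ^ DIM(complex ^ 'n)) = 1"
      by (metis mult.commute of_real_1 of_real_mult)
    have "(LINT w|lborel. cnj (u z) * u w * gkernel \<beta> ((real (Suc i))\<^sup>2) z w) = of_real (s i ^ DIM(complex ^ 'n)) * J i z"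
      unfolding J_def ts[symmetric] by (rule integral_affine_subst[OF s0(1)[of i] m])
    then show ?thesis using one by (metis mult.assoc mult_1)
  qed
  have kf: "of_real (((real (Suc i))\<^sup>2) ^ CARD('n)) * kform (gkernel \<beta> ((real (Suc i))\<^sup>2)) u u = (LINT z|lborel. J i z)" for i
    unfolding kform_iterated(1)[OF assms(1) assms(1) ckernel_gkernel] J_eq by (rule integral_mult_right_zero[symmetric])
  have Jmeas: "J i \<in> borel_measurable lborel" for i
  proof -
    have "integrable (lborel \<Otimes>\<^sub>M lborel) (\<lambda>(z, w). cnj (u z) * u w * gkernel \<beta> ((real (Suc i))\<^sup>2) z w)"
      using kform_integrable[OF assms(1) assms(1) ckernel_gkernel[of \<beta> "(real (Suc i))\<^sup>2"]] by (simp add: lborel_prod case_prod_unfold)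
    from lborel_pair.integrable_fst[OF this] show ?thesis unfolding J_eq[abs_def] by measurable
  qed
  have bnd: "norm (cnj (u z) * u (z + s i *\<^sub>R v) * gkernel \<beta> (1 / (s i)\<^sup>2) z (z + s i *\<^sub>R v)) \<le> (norm (u z) * C) * gauss (\<beta> / 2) v" for i z v
    unfolding norm_mult complex_mod_cnj
    by (intro mult_mono norm_gkernel_scaled_le s0 assms C) (auto simp: C gauss_def)
  have Jlim: "(\<lambda>i. J i z) \<longlonglongrightarrow> L z" for z
  proof -
    have "(\<lambda>i. J i z) \<longlonglongrightarrow> (LINT v|lborel. cnj (u z) * u z * of_real (gauss \<beta> z) * of_real (gauss \<beta> (v :: complex ^ 'n)))"
      unfolding J_def
    proof (rule integral_dominated_convergence[where w="\<lambda>v::complex ^ 'n. (norm (u z) * C) * gauss (\<beta> / 2) v"])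
      show "(\<lambda>v::complex ^ 'n. cnj (u z) * u z * of_real (gauss \<beta> z) * of_real (gauss \<beta> v)) \<in> borel_measurable lborel"
        unfolding gauss_def by measurable
      show "(\<lambda>v. cnj (u z) * u (z + s i *\<^sub>R v) * gkernel \<beta> (1 / (s i)\<^sup>2) z (z + s i *\<^sub>R v)) \<in> borel_measurable lborel" for i
        by (simp, intro borel_measurable_continuous_onI continuous_intros cus cgs)
      show "integrable lborel (\<lambda>v::complex ^ 'n. (norm (u z) * C) * gauss (\<beta> / 2) v)"
        using ig by (rule integrable_mult_right)
      show "AE v in lborel. norm (cnj (u z) * u (z + s i *\<^sub>R v) * gkernel \<beta> (1 / (s i)\<^sup>2) z (z + s i *\<^sub>R v)) \<le> (norm (u z) * C) * gauss (\<beta> / 2) v" for i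
        using bnd by (intro AE_I2)
      show "AE v in lborel. (\<lambda>i. cnj (u z) * u (z + s i *\<^sub>R v) * gkernel \<beta> (1 / (s i)\<^sup>2) z (z + s i *\<^sub>R v))
          \<longlonglongrightarrow> cnj (u z) * u z * of_real (gauss \<beta> z) * of_real (gauss \<beta> v)"
      proof (rule AE_I2)
        fix v
        let ?f = "\<lambda>r. cnj (u z) * u (z + r *\<^sub>R v) * exp (of_real \<beta> * (hdot z (z + r *\<^sub>R v) - hdot z z
             - hdot (z + r *\<^sub>R v) (z + r *\<^sub>R v) - of_real (1 - r\<^sup>2) * hdot v v))"
        have "continuous_on UNIV ?f"
          by (intro continuous_intros continuous_on_compose2[OF cu]) auto
        then have "isCont ?f 0" by (simp add: continuous_on_eq_continuous_at)
        from isCont_tendsto_compose[OF this slim] have l1: "(\<lambda>i. ?f (s i)) \<longlonglongrightarrow> ?f 0" .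
        have l2: "?f 0 = cnj (u z) * u z * of_real (gauss \<beta> z) * of_real (gauss \<beta> v)"
          unfolding gauss_def exp_of_real[symmetric] mult.assoc exp_add[symmetric]
          by (simp add: hdot_self ring_distribs)
        show "(\<lambda>i. cnj (u z) * u (z + s i *\<^sub>R v) * gkernel \<beta> (1 / (s i)\<^sup>2) z (z + s i *\<^sub>R v))
          \<longlonglongrightarrow> cnj (u z) * u z * of_real (gauss \<beta> z) * of_real (gauss \<beta> v)"
          using l1 unfolding l2 gkernel_scaled[OF s0(1)] .
      qed
    qed
    then show ?thesis by (simp add: L_def gmass_def)
  qed
  define G2 where "G2 = (LINT v|lborel. gauss (\<beta> / 2) (v :: complex ^ 'n))"
  have "(\<lambda>i. LINT z|lborel. J i z) \<longlonglongrightarrow> (LINT z|lborel. L z)"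
  proof (rule integral_dominated_convergence[where w="\<lambda>z. norm (u z) * C * G2"])
    show "L \<in> borel_measurable lborel"
      unfolding L_def by (simp, intro borel_measurable_continuous_onI continuous_intros cu continuous_gauss)
    show "integrable lborel (\<lambda>z. norm (u z) * C * G2)" using iu by auto
    show "AE z in lborel. norm (J i z) \<le> norm (u z) * C * G2" for i
    proof (rule AE_I2)
      fix z
      have ii: "integrable lborel (\<lambda>v. (norm (u z) * C) * gauss (\<beta> / 2) (v :: complex ^ 'n))"
        using ig by (rule integrable_mult_right)
      have "norm (J i z) \<le> (LINT v|lborel. (norm (u z) * C) * gauss (\<beta> / 2) (v :: complex ^ 'n))"
        unfolding J_def
      proof (rule order_trans[OF integral_norm_bound integral_mono[OF _ ii]])
        show "integrable lborel (\<lambda>v. norm (cnj (u z) * u (z + s i *\<^sub>R v) * gkernel \<beta> (1 / (s i)\<^sup>2) z (z + s i *\<^sub>R v)))"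
        proof (rule integrable_norm, rule Bochner_Integration.integrable_bound[OF ii])
          show "(\<lambda>v. cnj (u z) * u (z + s i *\<^sub>R v) * gkernel \<beta> (1 / (s i)\<^sup>2) z (z + s i *\<^sub>R v)) \<in> borel_measurable lborel"
            by (simp, intro borel_measurable_continuous_onI continuous_intros cus cgs)
          show "AE v in lborel. norm (cnj (u z) * u (z + s i *\<^sub>R v) * gkernel \<beta> (1 / (s i)\<^sup>2) z (z + s i *\<^sub>R v)) \<le> norm ((norm (u z) * C) * gauss (\<beta> / 2) v)"
            by (intro AE_I2 order_trans[OF bnd]) simp
        qed
      qed (rule bnd)
      then show "norm (J i z) \<le> norm (u z) * C * G2" by (simp add: G2_def)
    qed
  qed (use Jmeas Jlim in auto)
  then have "(\<lambda>i. Re (LINT z|lborel. J i z)) \<longlonglongrightarrow> Re (LINT z|lborel. L z)" by (rule tendsto_Re)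
  moreover have "Re (LINT z|lborel. J i z) = gform \<beta> u ((real (Suc i))\<^sup>2)" for i
    unfolding kf[symmetric] gform_def by (simp del: of_real_power of_nat_Suc)
  moreover have "Re (LINT z|lborel. L z) = gmass \<beta> TYPE('n) * (LINT z|lborel. (cmod (u z))\<^sup>2 * gauss \<beta> z)"
  proof -
    have "(LINT z|lborel. L z) = (LINT z|lborel. cnj (u z) * u z * of_real (gauss \<beta> z)) * of_real (gmass \<beta> TYPE('n))"
      unfolding L_def by (rule integral_mult_left_zero)
    also have "(\<lambda>z. cnj (u z) * u z * of_real (gauss \<beta> z)) = (\<lambda>z. complex_of_real ((cmod (u z))\<^sup>2 * gauss \<beta> z))"
      by (simp only: of_real_mult complex_norm_square mult.commute)
    finally have "(LINT z|lborel. L z) = (LINT z|lborel. complex_of_real ((cmod (u z))\<^sup>2 * gauss \<beta> z)) * of_real (gmass \<beta> TYPE('n))" .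
    then show ?thesis by (simp only: integral_complex_of_real times_complex.sel Re_complex_of_real Im_complex_of_real) simp
  qed
  ultimately show ?thesis by simp
qed

text \<open>
The derivative in \<open>t\<close> is a positive form evaluated at the functions \<open>dbar k u\<close>, so the form increases to its limit: the semigroup is
a contraction.
\<close>

lemma gform_le:
  fixes u :: "complex ^ 'n::finite \<Rightarrow> complex"
  assumes "C1 u" "bdd_supp u" "\<beta> > 0" "t \<ge> 1"
  shows "gform \<beta> u t \<le> gmass \<beta> TYPE('n) * (LINT z|lborel. (cmod (u z))\<^sup>2 * gauss \<beta> z)"
proof (rule tendsto_lowerbound[OF gform_tendsto[OF C1_Cc[OF assms(1,2)] assms(3)]])
  have monomial: "gform \<beta> u t \<le> gform \<beta> u t'" if "t \<le> t'" for t'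
  proof (rule DERIV_nonneg_imp_nondecreasing[OF that])
    fix x assume "t \<le> x" "x \<le> t'"
    then have "x \<ge> 1" using assms by simp
    then show "\<exists>y. (gform \<beta> u has_real_derivative y) (at x) \<and> 0 \<le> y"
      using gform_has_derivative[OF assms(1-3), of x] assms
      by (intro exI conjI) (auto intro!: divide_nonneg_pos sum_nonneg gform_nonneg Cc_dbar)
  qed
  show "\<forall>\<^sub>F i in sequentially. gform \<beta> u t \<le> gform \<beta> u ((real (Suc i))\<^sup>2)"
  proof -
    obtain N :: nat where N: "t \<le> real N" using real_arch_simple by blast
    have "t \<le> (real (Suc i))\<^sup>2" if "i \<ge> N" for i
    proof -
      have "real (Suc i) \<le> (real (Suc i))\<^sup>2" by (simp add: power2_eq_square)
      then show ?thesis using N that by linarith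
    qed
    then show ?thesis using monomial unfolding eventually_sequentially by blast
  qed
qed simp

text \<open>
By contractivity the derivative of the form at \<open>t\<close> is at most a constant multiple of \<open>1/t\<^sup>2\<close>; integrating it from \<open>t = 1\<close> to infinity
compares the projection with the identity.
\<close>

theorem landau_spectral_gap:
  fixes g :: "complex ^ 'n::finite \<Rightarrow> complex"
  assumes "C1 g" "bdd_supp g" "\<beta> > 0" "\<And>k. C1 (dbar k g)"
  shows "gmass \<beta> TYPE('n) * (LINT z|lborel. (cmod (g z))\<^sup>2 * gauss \<beta> z) - Re (kform (gkernel \<beta> 1) g g)
    \<le> gmass \<beta> TYPE('n) / \<beta> * (\<Sum>k\<in>UNIV. LINT z|lborel. (cmod (dbar k g z))\<^sup>2 * gauss \<beta> z)"
proof -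
  define G where "G = gmass \<beta> TYPE('n)"
  define S where "S = G * (\<Sum>k\<in>UNIV. LINT z|lborel. (cmod (dbar k g z))\<^sup>2 * gauss \<beta> z)"
  \<comment> \<open>The correction \<open>S / (\<beta> t)\<close> has the derivative that bounds the growth of the form, so the sum is nonincreasing.\<close>
  define h where "h = (\<lambda>t. gform \<beta> g t + S / \<beta> * (1 / t))"
  have anti: "h t \<le> h 1" if "t \<ge> 1" for t
  proof (rule DERIV_nonpos_imp_nonincreasing[OF that])
    fix x :: real assume "1 \<le> x"
    have "(h has_real_derivative (\<Sum>k\<in>UNIV. gform \<beta> (dbar k g) x) / (\<beta> * x\<^sup>2) + S / \<beta> * (- (1 / x\<^sup>2))) (at x)"
      unfolding h_def using \<open>1 \<le> x\<close> assms(3)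
      by (intro DERIV_add gform_has_derivative assms DERIV_cmult)
         (auto intro!: derivative_eq_intros simp: power2_eq_square)
    moreover have "(\<Sum>k\<in>UNIV. gform \<beta> (dbar k g) x) / (\<beta> * x\<^sup>2) + S / \<beta> * (- (1 / x\<^sup>2)) \<le> 0"
    proof -
      have "(\<Sum>k\<in>UNIV. gform \<beta> (dbar k g) x) \<le> S"
        unfolding S_def G_def sum_distrib_left using assms \<open>1 \<le> x\<close>
        by (intro sum_mono gform_le bdd_supp_dbar) auto
      then have "(\<Sum>k\<in>UNIV. gform \<beta> (dbar k g) x) / (\<beta> * x\<^sup>2) \<le> S / (\<beta> * x\<^sup>2)"
        using assms by (intro divide_right_mono) auto
      then show ?thesis by simp
    qed
    ultimately show "\<exists>y. (h has_real_derivative y) (at x) \<and> y \<le> 0" by blast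
  qed
  have S0: "S \<ge> 0" unfolding S_def G_def gmass_def
    by (intro mult_nonneg_nonneg sum_nonneg Bochner_Integration.integral_nonneg) (auto simp: gauss_def)
  have "gform \<beta> g ((real (Suc i))\<^sup>2) \<le> Re (kform (gkernel \<beta> 1) g g) + S / \<beta>" for i
  proof -
    have "gform \<beta> g ((real (Suc i))\<^sup>2) \<le> h ((real (Suc i))\<^sup>2)" unfolding h_def using S0 assms(3) by simp
    also have "\<dots> \<le> h 1" by (rule anti, rule one_le_power) simp
    finally show ?thesis by (simp add: h_def gform_def)
  qed
  then have "G * (LINT z|lborel. (cmod (g z))\<^sup>2 * gauss \<beta> z) \<le> Re (kform (gkernel \<beta> 1) g g) + S / \<beta>"
    unfolding G_def by (intro tendsto_upperbound[OF gform_tendsto[OF C1_Cc[OF assms(1,2)] assms(3)]]) auto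
  then show ?thesis by (simp add: S_def G_def)
qed

section \<open>Invariance of Lebesgue measure under isometries\<close>

lemma nn_integral_translation:
  fixes f :: "'a::euclidean_space \<Rightarrow> ennreal"
  assumes [measurable]: "f \<in> borel_measurable borel"
  shows "(\<integral>\<^sup>+x. f (x + a) \<partial>lborel) = (\<integral>\<^sup>+x. f x \<partial>lborel)"
proof -
  have "(\<integral>\<^sup>+x. f x \<partial>lborel) = (\<integral>\<^sup>+x. f x \<partial>distr lborel borel ((+) a))"
    by (simp add: lborel_distr_plus)
  also have "\<dots> = (\<integral>\<^sup>+x. f (x + a) \<partial>lborel)" by (subst nn_integral_distr) (auto simp: add.commute)
  finally show ?thesis by simp
qed

text \<open>
This is the uniqueness argument for Haar measure. Multiply by the integral of a radial Gaussian \<open>h\<close>, translate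
\<open>x\<close> by the preimage of \<open>y\<close>, exchange the integrals and translate back: the map \<open>T\<close> ends up in \<open>h\<close>, which is invariant under it.
\<close>

lemma nn_integral_orthogonal_transformation:
  fixes f :: "'a::euclidean_space \<Rightarrow> ennreal" and T :: "'a \<Rightarrow> 'a"
  assumes T: "orthogonal_transformation T" and [measurable]: "f \<in> borel_measurable borel"
  shows "(\<integral>\<^sup>+x. f (T x) \<partial>lborel) = (\<integral>\<^sup>+x. f x \<partial>lborel)"
proof -
  have lin: "linear T" using T by (simp add: orthogonal_transformation_def)
  then have "continuous_on UNIV T" by (simp add: linear_continuous_on linear_conv_bounded_linear)
  then have [measurable]: "T \<in> borel_measurable borel" by (rule borel_measurable_continuous_onI)
  have iso: "norm (T x) = norm x" for x using T by (simp add: orthogonal_transformation)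
  define T' where "T' = inv T"
  have TT': "T (T' y) = y" for y
    unfolding T'_def using orthogonal_transformation_surj[OF T] by (simp add: surj_f_inv_f)
  define h where "h = (\<lambda>x::'a. ennreal (exp (- 1 * (norm x)\<^sup>2)))"
  have [measurable]: "h \<in> borel_measurable borel" unfolding h_def by measurable
  define H where "H = (\<integral>\<^sup>+x. h x \<partial>lborel)"
  have int: "integrable lborel (\<lambda>x::'a. exp (- 1 * (norm x)\<^sup>2))" by (rule integrable_gauss) simp
  have "H \<noteq> \<infinity>"
    unfolding H_def h_def using nn_integral_eq_integral[OF int] by simp
  moreover have "H \<noteq> 0"
    unfolding H_def h_def by (subst nn_integral_0_iff_AE) (auto simp: trivial_limit_def[symmetric] ae_filter_eq_bot_iff)
  ultimately have H: "H \<noteq> 0" "H \<noteq> top" by auto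
  have "(\<integral>\<^sup>+x. f (T x) \<partial>lborel) * H = (\<integral>\<^sup>+y. (\<integral>\<^sup>+x. f (T x) \<partial>lborel) * h y \<partial>lborel)"
    unfolding H_def by (simp add: nn_integral_cmult)
  also have "\<dots> = (\<integral>\<^sup>+y. (\<integral>\<^sup>+x. f (T x) * h y \<partial>lborel) \<partial>lborel)"
    by (simp add: nn_integral_multc)
  also have "\<dots> = (\<integral>\<^sup>+y. (\<integral>\<^sup>+x. f (T x + y) * h y \<partial>lborel) \<partial>lborel)"
  proof (rule nn_integral_cong)
    fix y
    have "(\<integral>\<^sup>+x. f (T (x + T' y)) * h y \<partial>lborel) = (\<integral>\<^sup>+x. f (T x) * h y \<partial>lborel)"
      by (rule nn_integral_translation) measurable
    then show "(\<integral>\<^sup>+x. f (T x) * h y \<partial>lborel) = (\<integral>\<^sup>+x. f (T x + y) * h y \<partial>lborel)"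
      by (simp add: linear_add[OF lin] TT')
  qed
  also have "\<dots> = (\<integral>\<^sup>+x. (\<integral>\<^sup>+y. f (T x + y) * h y \<partial>lborel) \<partial>lborel)"
    by (rule lborel_pair.Fubini') measurable
  also have "\<dots> = (\<integral>\<^sup>+x. (\<integral>\<^sup>+y. f y * h (y - T x) \<partial>lborel) \<partial>lborel)"
  proof (rule nn_integral_cong)
    fix x
    have "(\<integral>\<^sup>+y. f (y + T x) * h ((y + T x) - T x) \<partial>lborel) = (\<integral>\<^sup>+y. f y * h (y - T x) \<partial>lborel)"
      by (rule nn_integral_translation) measurable
    then show "(\<integral>\<^sup>+y. f (T x + y) * h y \<partial>lborel) = (\<integral>\<^sup>+y. f y * h (y - T x) \<partial>lborel)"
      by (simp add: add.commute)
  qed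
  also have "\<dots> = (\<integral>\<^sup>+y. (\<integral>\<^sup>+x. f y * h (y - T x) \<partial>lborel) \<partial>lborel)"
    by (rule lborel_pair.Fubini') measurable
  also have "\<dots> = (\<integral>\<^sup>+y. f y * H \<partial>lborel)"
  proof (rule nn_integral_cong)
    fix y
    have "h (y - T x) = h (x + - T' y)" for x
    proof -
      have "norm (y - T x) = norm (T (T' y - x))" by (simp add: linear_diff[OF lin] TT')
      also have "\<dots> = norm (x + - T' y)" by (simp add: iso norm_minus_commute)
      finally show ?thesis by (simp add: h_def)
    qed
    then have "(\<integral>\<^sup>+x. f y * h (y - T x) \<partial>lborel) = f y * (\<integral>\<^sup>+x. h (x + - T' y) \<partial>lborel)"
      by (simp add: nn_integral_cmult)
    also have "(\<integral>\<^sup>+x. h (x + - T' y) \<partial>lborel) = H"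
      unfolding H_def by (rule nn_integral_translation) measurable
    finally show "(\<integral>\<^sup>+x. f y * h (y - T x) \<partial>lborel) = f y * H" .
  qed
  also have "\<dots> = (\<integral>\<^sup>+y. f y \<partial>lborel) * H" by (simp add: nn_integral_multc)
  finally show ?thesis
    using H by (metis mult_divide_eq_ennreal)
qed

lemma lborel_distr_orthogonal_transformation:
  fixes T :: "'a::euclidean_space \<Rightarrow> 'a"
  assumes T: "orthogonal_transformation T"
  shows "distr lborel borel T = lborel"
proof (rule measure_eqI)
  have lin: "linear T" using T by (simp add: orthogonal_transformation_def)
  then have "continuous_on UNIV T" by (simp add: linear_continuous_on linear_conv_bounded_linear)
  then have m [measurable]: "T \<in> borel_measurable borel" by (rule borel_measurable_continuous_onI)
  fix A :: "'a set" assume "A \<in> sets (distr lborel borel T)"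
  then have [measurable]: "A \<in> sets borel" by simp
  have "emeasure (distr lborel borel T) A = (\<integral>\<^sup>+x. indicator A x \<partial>distr lborel borel T)" by simp
  also have "\<dots> = (\<integral>\<^sup>+x. indicator A (T x) \<partial>lborel)" by (subst nn_integral_distr) auto
  also have "\<dots> = (\<integral>\<^sup>+x. indicator A x \<partial>lborel)"
    by (rule nn_integral_orthogonal_transformation[OF T]) measurable
  finally show "emeasure (distr lborel borel T) A = emeasure lborel A" by simp
qed simp

lemma integral_orthogonal_transformation:
  fixes f :: "'a::euclidean_space \<Rightarrow> 'b::euclidean_space" and T :: "'a \<Rightarrow> 'a"
  assumes T: "orthogonal_transformation T" and [measurable]: "f \<in> borel_measurable borel"
  shows "(LINT x|lborel. f (T x)) = (LINT x|lborel. f x)"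
proof -
  have "continuous_on UNIV T"
    using T by (simp add: orthogonal_transformation_def linear_continuous_on linear_conv_bounded_linear)
  then have m [measurable]: "T \<in> borel_measurable borel" by (rule borel_measurable_continuous_onI)
  have "(LINT x|lborel. f x) = (LINT x|distr lborel borel T. f x)"
    by (simp add: lborel_distr_orthogonal_transformation[OF T])
  also have "\<dots> = (LINT x|lborel. f (T x))" by (subst integral_distr) auto
  finally show ?thesis by simp
qed

section \<open>Smooth cut-off functions\<close>

lemma times_cont_diff_continuous: "times_cont_diff k f \<Longrightarrow> continuous_on UNIV f"
  by (cases k) (auto intro!: continuous_at_imp_continuous_on differentiable_imp_continuous_within)

lemma times_cont_diff_Suc: "times_cont_diff (Suc k) f \<Longrightarrow> times_cont_diff k f"
proof (induction k arbitrary: f)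
  case 0 then show ?case using times_cont_diff_continuous by (metis times_cont_diff.simps(1))
next
  case (Suc k)
  from Suc.prems show ?case using Suc.IH by (subst times_cont_diff.simps) (auto simp del: times_cont_diff.simps simp: times_cont_diff.simps(2)[of "Suc k"])
qed

lemma times_cont_diff_const: "times_cont_diff k (\<lambda>x::'a::euclidean_space. c)"
  by (induction k arbitrary: c) auto

lemma times_cont_diff_SucI:
  assumes "\<And>x. (f has_derivative f' x) (at x)" "\<And>v. times_cont_diff k (\<lambda>x. f' x v)"
  shows "times_cont_diff (Suc k) f"
proof -
  have "frechet_derivative f (at x) = f' x" for x
    using frechet_derivative_at[OF assms(1)] by simp
  then show ?thesis using assms by (auto simp: differentiable_def)
qed

lemma times_cont_diff_has_derivative:
  "times_cont_diff (Suc k) f \<Longrightarrow> (f has_derivative frechet_derivative f (at x)) (at x)"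
  using frechet_derivative_works by auto

lemma times_cont_diff_deriv:
  "times_cont_diff (Suc k) f \<Longrightarrow> times_cont_diff k (\<lambda>x. frechet_derivative f (at x) v)"
  by auto

lemma times_cont_diff_linear:
  fixes f :: "'a::euclidean_space \<Rightarrow> real"
  assumes "bounded_linear f" shows "times_cont_diff k f"
proof (cases k)
  case 0 then show ?thesis using assms by (simp add: linear_continuous_on)
next
  case (Suc j)
  show ?thesis unfolding Suc
    by (rule times_cont_diff_SucI[OF bounded_linear_imp_has_derivative[OF assms]]) (rule times_cont_diff_const)
qed

lemma times_cont_diff_add:
  "times_cont_diff k f \<Longrightarrow> times_cont_diff k g \<Longrightarrow> times_cont_diff k (\<lambda>x. f x + g x)"
proof (induction k arbitrary: f g)
  case 0 then show ?case by (auto intro: continuous_intros)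
next
  case (Suc k)
  show ?case
    by (rule times_cont_diff_SucI[OF has_derivative_add[OF times_cont_diff_has_derivative times_cont_diff_has_derivative]])
       (use Suc in auto)
qed

lemma times_cont_diff_mult:
  "times_cont_diff k f \<Longrightarrow> times_cont_diff k g \<Longrightarrow> times_cont_diff k (\<lambda>x. f x * g x)"
proof (induction k arbitrary: f g)
  case 0 then show ?case by (auto intro: continuous_intros)
next
  case (Suc k)
  show ?case
    by (rule times_cont_diff_SucI[OF has_derivative_mult[OF times_cont_diff_has_derivative times_cont_diff_has_derivative]])
       (use Suc in \<open>auto intro!: times_cont_diff_add Suc.IH intro: times_cont_diff_Suc simp del: times_cont_diff.simps simp: times_cont_diff_deriv\<close>)
qed

lemma times_cont_diff_compose_linear:
  fixes f :: "'a::euclidean_space \<Rightarrow> real" and L :: "'b::euclidean_space \<Rightarrow> 'a"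
  assumes "bounded_linear L"
  shows "times_cont_diff k f \<Longrightarrow> times_cont_diff k (\<lambda>x. f (L x))"
proof (induction k arbitrary: f)
  case 0 then show ?case
    using continuous_on_compose2[of UNIV f UNIV L] linear_continuous_on[OF assms] by auto
next
  case (Suc k)
  show ?case
    by (rule times_cont_diff_SucI[OF has_derivative_compose[OF bounded_linear_imp_has_derivative[OF assms] times_cont_diff_has_derivative]])
       (use Suc in auto)
qed

text \<open>
  The functions \<open>x \<mapsto> p(1/x) exp(-1/x)\<close>, extended by 0 to the left of the origin, form a class that is closed
  under differentiation.
\<close>

definition flat :: "real poly \<Rightarrow> real \<Rightarrow> real" where
  "flat p x = (if x > 0 then poly p (1 / x) * exp (- (1 / x)) else 0)"

lemma flat_tendsto_0:
  fixes p :: "real poly"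
  shows "((\<lambda>x. poly p (1 / x) * exp (- (1 / x))) \<longlongrightarrow> 0) (at_right 0)"
proof -
  have "((\<lambda>y. poly p y * exp (- y)) \<longlongrightarrow> 0) at_top"
  proof -
    have "((\<lambda>y. \<Sum>i\<le>degree p. coeff p i * (y ^ i / exp y)) \<longlongrightarrow> (\<Sum>i\<le>degree p. coeff p i * 0)) at_top"
      by (intro tendsto_sum tendsto_mult tendsto_const tendsto_power_div_exp_0)
    then show ?thesis by (simp add: poly_altdef sum_distrib_left sum_distrib_right exp_minus divide_inverse mult_ac)
  qed
  from filterlim_compose[OF this filterlim_inverse_at_top_right] show ?thesis
    by (simp add: inverse_eq_divide)
qed

text \<open>
At the origin all one-sided limits vanish because the exponential beats every polynomial in \<open>1/x\<close>.
\<close>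

lemma flat_has_derivative:
  "(flat p has_real_derivative flat ([:0, 0, 1:] * (p - pderiv p)) x) (at x)"
proof -
  consider "x > 0" | "x < 0" | "x = 0" by linarith
  then show ?thesis
  proof cases
    case 1
    have inv: "((\<lambda>x. 1 / x) has_real_derivative - (1 / x\<^sup>2)) (at x)"
      using 1 by (auto intro!: derivative_eq_intros simp: power2_eq_square)
    have "((\<lambda>x. poly p (1 / x)) has_real_derivative poly (pderiv p) (1 / x) * (- (1 / x\<^sup>2))) (at x)"
      by (rule DERIV_chain2[OF poly_DERIV inv])
    moreover have "((\<lambda>x. exp (- (1 / x))) has_real_derivative exp (- (1 / x)) * (- (- (1 / x\<^sup>2)))) (at x)"
      by (rule DERIV_chain2[OF DERIV_exp DERIV_minus[OF inv]])
    ultimately have "((\<lambda>x. poly p (1 / x) * exp (- (1 / x))) has_real_derivative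
        poly (pderiv p) (1 / x) * (- (1 / x\<^sup>2)) * exp (- (1 / x)) + exp (- (1 / x)) * (- (- (1 / x\<^sup>2))) * poly p (1 / x)) (at x)"
      by (rule DERIV_mult)
    also have "poly (pderiv p) (1 / x) * (- (1 / x\<^sup>2)) * exp (- (1 / x)) + exp (- (1 / x)) * (- (- (1 / x\<^sup>2))) * poly p (1 / x)
        = flat ([:0, 0, 1:] * (p - pderiv p)) x"
      using 1 by (simp add: flat_def algebra_simps power2_eq_square)
    finally show ?thesis
      by (rule has_field_derivative_transform_within_open[where S="{0<..}"]) (use 1 in \<open>auto simp: flat_def\<close>)
  next
    case 2
    have "((\<lambda>x. 0) has_real_derivative flat ([:0, 0, 1:] * (p - pderiv p)) x) (at x)"
      using 2 by (simp add: flat_def)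
    then show ?thesis
      by (rule has_field_derivative_transform_within_open[where S="{..<0}"]) (use 2 in \<open>auto simp: flat_def\<close>)
  next
    case 3
    have "((\<lambda>h. flat p h / h) \<longlongrightarrow> 0) (at_right 0)"
      by (rule Lim_transform_eventually[OF flat_tendsto_0[of "[:0, 1:] * p"]])
         (auto simp: flat_def eventually_at_right_less intro!: eventually_at_rightI[of 0 1])
    moreover have "((\<lambda>h. flat p h / h) \<longlongrightarrow> 0) (at_left 0)"
      by (rule Lim_transform_eventually[OF tendsto_const])
         (auto simp: flat_def intro!: eventually_at_leftI[of "-1"])
    ultimately have "((\<lambda>h. flat p h / h) \<longlongrightarrow> 0) (at 0)" by (simp add: filterlim_split_at)
    then show ?thesis using 3 by (simp add: DERIV_def flat_def)
  qed
qed

lemma times_cont_diff_flat_compose: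
  fixes s :: "'a::euclidean_space \<Rightarrow> real"
  assumes s: "\<And>k. times_cont_diff k s"
  shows "times_cont_diff k (\<lambda>x. flat p (s x))"
proof (induction k arbitrary: p)
  have der: "((\<lambda>x. flat p (s x)) has_derivative (\<lambda>v. flat ([:0, 0, 1:] * (p - pderiv p)) (s x) * frechet_derivative s (at x) v)) (at x)" for x p
    using has_derivative_compose[OF times_cont_diff_has_derivative[OF s] flat_has_derivative[unfolded has_field_derivative_def]] .
  {
    case 0
    show ?case unfolding times_cont_diff.simps
      by (intro continuous_at_imp_continuous_on ballI) (rule has_derivative_continuous[OF der])
  next
    case (Suc k)
    show ?case
      by (rule times_cont_diff_SucI[OF der]) (intro times_cont_diff_mult Suc times_cont_diff_deriv s)
  }
qed

text \<open>
The factor \<open>exp 1\<close> normalizes the value at the origin to 1, and \<open>Suc R\<close> keeps the radius positive.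
\<close>

definition cutoff :: "nat \<Rightarrow> 'a::euclidean_space \<Rightarrow> real" where
  "cutoff R x = exp 1 * flat 1 (1 - (norm x)\<^sup>2 / (real (Suc R))\<^sup>2)"

lemma times_cont_diff_norm_square: "times_cont_diff k (\<lambda>x::'a::euclidean_space. (norm x)\<^sup>2)"
proof (cases k)
  case 0 then show ?thesis by (auto intro!: continuous_intros)
next
  case (Suc j)
  show ?thesis unfolding Suc power2_norm_eq_inner
    by (rule times_cont_diff_SucI[where f'="\<lambda>x v. 2 * inner x v"])
       (auto intro!: derivative_eq_intros times_cont_diff_linear bounded_linear_intros simp: inner_commute)
qed

lemma times_cont_diff_cutoff: "times_cont_diff k (cutoff R)"
proof -
  have "times_cont_diff k (\<lambda>x::'a. 1 + (- 1 / (real (Suc R))\<^sup>2) * (norm x)\<^sup>2)" for k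
    by (intro times_cont_diff_add times_cont_diff_const times_cont_diff_mult times_cont_diff_norm_square)
  then show ?thesis
    unfolding cutoff_def
    by (intro times_cont_diff_mult times_cont_diff_const times_cont_diff_flat_compose) simp
qed

lemma flat_1_nonneg: "flat 1 y \<ge> 0"
  by (simp add: flat_def)

lemma exp_flat_1_le: assumes "y \<le> 1" shows "exp 1 * flat 1 y \<le> 1"
proof (cases "y > 0")
  case True
  then have "1 \<le> 1 / y" using assms by simp
  then have "exp (1 + - (1 / y)) \<le> exp (0::real)" by (subst exp_le_cancel_iff) simp
  then have "exp 1 * exp (- (1 / y)) \<le> (1::real)" unfolding exp_add exp_zero .
  then show ?thesis using True by (simp only: flat_def if_True poly_1 mult_1)
qed (simp add: flat_def)

lemma cutoff_nonneg: "cutoff R x \<ge> 0"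
  unfolding cutoff_def by (rule mult_nonneg_nonneg[OF exp_ge_zero flat_1_nonneg])

lemma cutoff_le_1: "cutoff R x \<le> 1"
proof -
  have "0 \<le> (norm x)\<^sup>2 / (real (Suc R))\<^sup>2" by (intro divide_nonneg_nonneg) auto
  then show ?thesis unfolding cutoff_def by (intro exp_flat_1_le) linarith
qed

lemma flat_nonpos: "y \<le> 0 \<Longrightarrow> flat p y = 0"
  by (simp add: flat_def)

lemma cutoff_eq_0:
  assumes "norm x \<ge> real (Suc R)" shows "cutoff R x = 0"
proof -
  have "(real (Suc R))\<^sup>2 \<le> (norm x)\<^sup>2" using assms by (intro power_mono) auto
  then have "(norm x)\<^sup>2 / (real (Suc R))\<^sup>2 \<ge> 1" by (subst le_divide_eq_1_pos) auto
  then have "flat 1 (1 - (norm x)\<^sup>2 / (real (Suc R))\<^sup>2) = 0" by (intro flat_nonpos) linarith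
  then show ?thesis unfolding cutoff_def by (simp only: mult_zero_right)
qed

lemma cutoff_tendsto_1: "(\<lambda>R. cutoff R x) \<longlonglongrightarrow> 1"
proof -
  let ?r = "\<lambda>R. 1 - (norm x)\<^sup>2 * (inverse (real (Suc R)))\<^sup>2"
  have l: "?r \<longlonglongrightarrow> 1 - (norm x)\<^sup>2 * 0\<^sup>2"
    by (intro tendsto_intros LIMSEQ_inverse_real_of_nat)
  have "isCont (flat 1) 1" by (rule DERIV_isCont[OF flat_has_derivative])
  then have c: "isCont (flat 1) (1 - (norm x)\<^sup>2 * 0\<^sup>2)" by simp
  have "(\<lambda>R. exp 1 * flat 1 (?r R)) \<longlonglongrightarrow> exp 1 * flat 1 (1 - (norm x)\<^sup>2 * 0\<^sup>2)"
    by (intro tendsto_mult tendsto_const isCont_tendsto_compose[OF c l])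
  moreover have "exp 1 * flat 1 (1 - (norm x)\<^sup>2 * 0\<^sup>2) = 1"
    by (simp add: flat_def exp_minus)
  moreover have "exp 1 * flat 1 (?r R) = cutoff R x" for R
    by (simp only: cutoff_def divide_inverse power_inverse)
  ultimately show ?thesis by (simp only:)
qed

lemma cutoff_test_function: "cutoff R \<in> test_functions"
proof -
  have "{x. cutoff R x \<noteq> 0} \<subseteq> cball (0::'a) (real (Suc R))"
    using cutoff_eq_0[of R] by (force simp: not_le)
  then have "closure {x::'a. cutoff R x \<noteq> 0} \<subseteq> cball 0 (real (Suc R))"
    by (rule closure_minimal) simp
  then have "compact (closure {x::'a. cutoff R x \<noteq> 0})"
    by (metis bounded_cball bounded_subset closed_closure compact_eq_bounded_closed)
  then show ?thesis unfolding test_functions_def using times_cont_diff_cutoff by blast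
qed

lemma cutoff_derivative_bound:
  obtains C where "C \<ge> 0" "\<And>R x v. \<bar>frechet_derivative (cutoff R :: 'a::euclidean_space \<Rightarrow> real) (at x) v\<bar> \<le> C * norm v / real (Suc R)"
proof -
  let ?q = "flat ([:0, 0, 1:] * (1 - pderiv 1))"
  have "compact (?q ` {0..1})"
  proof (rule compact_continuous_image)
    have "isCont ?q x" for x by (rule DERIV_isCont[OF flat_has_derivative])
    then show "continuous_on {0..1} ?q" by (simp add: continuous_at_imp_continuous_on)
  qed auto
  then obtain B where B: "\<And>y. y \<in> {0..1} \<Longrightarrow> \<bar>?q y\<bar> \<le> B"
    using compact_imp_bounded bounded_iff by (metis imageI real_norm_def)
  have B0: "B \<ge> 0" using B[of 0] by auto
  have B': "\<bar>?q y\<bar> \<le> B" if "y \<le> 1" for y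
    using B[of y] B0 that by (cases "y \<ge> 0") (auto simp: flat_def)
  show ?thesis
  proof (rule that[of "exp 1 * B * 2"])
    show "exp 1 * B * 2 \<ge> 0" using B0 by simp
    fix R :: nat and x v :: 'a
    let ?S = "real (Suc R)"
    let ?y = "1 - (norm x)\<^sup>2 / ?S\<^sup>2"
    have "((\<lambda>x::'a. 1 - (norm x)\<^sup>2 / ?S\<^sup>2) has_derivative (\<lambda>v. - (2 * inner x v) / ?S\<^sup>2)) (at x)"
    proof -
      have "((\<lambda>x::'a. 1 - c * inner x x) has_derivative (\<lambda>v. - c * (2 * inner x v))) (at x)" for c :: real
        by (auto intro!: derivative_eq_intros simp: inner_commute algebra_simps)
      from this[of "1 / ?S\<^sup>2"] show ?thesis unfolding power2_norm_eq_inner by simp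
    qed
    from has_derivative_compose[OF this flat_has_derivative[unfolded has_field_derivative_def], of 1]
    have "(cutoff R has_derivative (\<lambda>v. exp 1 * (?q ?y * (- (2 * inner x v) / ?S\<^sup>2)))) (at x)"
      unfolding cutoff_def by (rule has_derivative_mult_right)
    then have eq: "frechet_derivative (cutoff R) (at x) v = exp 1 * (?q ?y * (- (2 * inner x v) / ?S\<^sup>2))"
      using frechet_derivative_at by metis
    \<comment> \<open>Inside the ball of radius \<open>?S\<close> use \<open>norm x \<le> ?S\<close> against the factor \<open>1 / ?S\<^sup>2\<close>; outside the cutoff vanishes.\<close>
    show "\<bar>frechet_derivative (cutoff R) (at x) v\<bar> \<le> exp 1 * B * 2 * norm v / ?S"
    proof (cases "norm x \<le> ?S")
      case True
      have "\<bar>inner x v\<bar> \<le> norm x * norm v" by (rule Cauchy_Schwarz_ineq2)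
      also have "\<dots> \<le> ?S * norm v" using True by (intro mult_right_mono) auto
      finally have "\<bar>- (2 * inner x v) / ?S\<^sup>2\<bar> \<le> 2 * (?S * norm v) / ?S\<^sup>2"
        by (simp add: abs_mult divide_right_mono)
      also have "\<dots> = 2 * norm v / ?S" by (simp add: power2_eq_square)
      finally have "\<bar>?q ?y\<bar> * \<bar>- (2 * inner x v) / ?S\<^sup>2\<bar> \<le> B * (2 * norm v / ?S)"
        by (intro mult_mono B' B0) auto
      then have "exp 1 * (\<bar>?q ?y\<bar> * \<bar>- (2 * inner x v) / ?S\<^sup>2\<bar>) \<le> exp 1 * (B * (2 * norm v / ?S))"
        by (intro mult_left_mono) auto
      then show ?thesis unfolding eq by (simp add: abs_mult mult_ac)
    next
      case False
      then have "?S\<^sup>2 \<le> (norm x)\<^sup>2" by (intro power_mono) (simp_all del: of_nat_Suc)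
      then have "(norm x)\<^sup>2 / ?S\<^sup>2 \<ge> 1"
        by (simp only: le_divide_eq_1_pos zero_less_power of_nat_0_less_iff zero_less_Suc)
      then have "?q ?y = 0" by (intro flat_nonpos) linarith
      then show ?thesis unfolding eq using B0 by simp
    qed
  qed
qed

section \<open>Holomorphic polynomials\<close>

inductive polyfun :: "(complex ^ 'n::finite \<Rightarrow> complex) \<Rightarrow> bool" where
  polyfun_const: "polyfun (\<lambda>z. c)"
| polyfun_coord: "polyfun (\<lambda>z. z $ k)"
| polyfun_add: "polyfun u \<Longrightarrow> polyfun v \<Longrightarrow> polyfun (\<lambda>z. u z + v z)"
| polyfun_mult: "polyfun u \<Longrightarrow> polyfun v \<Longrightarrow> polyfun (\<lambda>z. u z * v z)"

lemma polyfun_sum: "finite I \<Longrightarrow> (\<And>i. i \<in> I \<Longrightarrow> polyfun (u i)) \<Longrightarrow> polyfun (\<lambda>z. \<Sum>i\<in>I. u i z)"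
  by (induction I rule: finite_induct) (auto intro: polyfun_add polyfun_const)

lemma polyfun_prod: "finite I \<Longrightarrow> (\<And>i. i \<in> I \<Longrightarrow> polyfun (u i)) \<Longrightarrow> polyfun (\<lambda>z. \<Prod>i\<in>I. u i z)"
  by (induction I rule: finite_induct) (auto intro: polyfun_mult polyfun_const)

lemma coord_has_derivative: "((\<lambda>z::complex ^ 'n::finite. z $ k) has_derivative (\<lambda>v. v $ k)) (at z)"
  by (rule bounded_linear_imp_has_derivative) (rule bounded_linear_vec_nth)

lemma polyfun_C1: "polyfun u \<Longrightarrow> C1 u"
proof (induction rule: polyfun.induct)
  case (polyfun_coord k)
  show ?case by (rule C1I[OF coord_has_derivative]) auto
qed (auto intro: C1_const C1_add C1_mult)

lemma dbar_add:
  assumes "C1 u" "C1 e" shows "dbar k (\<lambda>x. u x + e x) x = dbar k u x + dbar k e x"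
  unfolding dbar_def ddir_eqI[OF has_derivative_add[OF C1_has_derivative[OF assms(1)] C1_has_derivative[OF assms(2)]]]
  by (simp add: field_simps)

lemma polyfun_dbar: "polyfun u \<Longrightarrow> dbar k u z = 0"
proof (induction rule: polyfun.induct)
  case (polyfun_coord j)
  show ?case unfolding dbar_def ddir_eqI[OF coord_has_derivative] by (simp add: axis_def)
next
  case (polyfun_const c)
  show ?case unfolding dbar_def by simp
qed (auto simp: dbar_add dbar_mult polyfun_C1)

lemma polyfun_growth: "polyfun u \<Longrightarrow> \<exists>C d. C \<ge> 0 \<and> (\<forall>z. cmod (u z) \<le> C * (1 + norm z) ^ d)"
proof (induction rule: polyfun.induct)
  case (polyfun_const c)
  show ?case by (rule exI[of _ "cmod c"], rule exI[of _ 0]) auto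
next
  case (polyfun_coord k)
  have "cmod (z $ k) \<le> 1 * (1 + norm z) ^ 1" for z :: "complex ^ 'a"
    using Finite_Cartesian_Product.norm_nth_le[of z k] by simp
  then show ?case by (intro exI[of _ 1]) auto
next
  case (polyfun_add u v)
  then obtain C d C' d' where *: "C \<ge> 0" "C' \<ge> 0" "\<And>z. cmod (u z) \<le> C * (1 + norm z) ^ d"
    "\<And>z. cmod (v z) \<le> C' * (1 + norm z) ^ d'" by blast
  have "cmod (u z + v z) \<le> (C + C') * (1 + norm z) ^ (d + d')" for z
  proof -
    have "C * (1 + norm z) ^ d \<le> C * (1 + norm z) ^ (d + d')" "C' * (1 + norm z) ^ d' \<le> C' * (1 + norm z) ^ (d + d')"
      using * by (auto intro!: mult_left_mono power_increasing)
    then show ?thesis using *(3)[of z] *(4)[of z] norm_triangle_ineq[of "u z" "v z"] by (simp add: algebra_simps)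
  qed
  then show ?case using * by (intro exI[of _ "C + C'"] exI[of _ "d + d'"]) auto
next
  case (polyfun_mult u v)
  then obtain C d C' d' where *: "C \<ge> 0" "C' \<ge> 0" "\<And>z. cmod (u z) \<le> C * (1 + norm z) ^ d"
    "\<And>z. cmod (v z) \<le> C' * (1 + norm z) ^ d'" by blast
  have "cmod (u z * v z) \<le> (C * C') * (1 + norm z) ^ (d + d')" for z
  proof -
    have "cmod (u z * v z) \<le> (C * (1 + norm z) ^ d) * (C' * (1 + norm z) ^ d')"
      unfolding norm_mult using * by (intro mult_mono) auto
    then show ?thesis by (simp add: power_add mult_ac)
  qed
  then show ?case using * by (intro exI[of _ "C * C'"] exI[of _ "d + d'"]) auto
qed

lemma power_div_fact_le_exp:
  assumes "x \<ge> 0" shows "x ^ d / fact d \<le> exp (x::real)"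
proof -
  have e: "(\<lambda>n. x ^ n / fact n) sums exp x"
    using exp_converges[of x] by (simp add: divide_inverse mult.commute)
  have "(\<Sum>n\<in>{d}. x ^ n / fact n) \<le> (\<Sum>n. x ^ n / fact n)"
    by (rule sum_le_suminf[OF sums_summable[OF e]]) (use assms in auto)
  then show ?thesis using sums_unique[OF e] by simp
qed

text \<open>
Polynomial growth is absorbed by half of the Gaussian: a power is bounded by an exponential, and
\<open>r - \<beta> r\<^sup>2 / 2 \<le> 1 / (2 \<beta>)\<close>.
\<close>

lemma integrable_growth_gauss:
  fixes u :: "complex ^ 'n::finite \<Rightarrow> 'b::{banach, second_countable_topology}"
  assumes [measurable]: "u \<in> borel_measurable borel" and \<beta>: "\<beta> > 0"
    and u: "\<And>z. norm (u z) \<le> C * (1 + norm z) ^ d"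
  shows "integrable lborel (\<lambda>z. gauss \<beta> z *\<^sub>R u z)"
proof -
  have ig: "integrable lborel (\<lambda>z::complex ^ 'n. (\<bar>C\<bar> * fact d * exp (1 + 1 / (2 * \<beta>))) * exp (- (\<beta> / 2) * (norm z)\<^sup>2))"
    using integrable_gauss[of "\<beta> / 2"] \<beta> by (intro integrable_mult_right) auto
  show ?thesis
  proof (rule Bochner_Integration.integrable_bound[OF ig])
    show "(\<lambda>z. gauss \<beta> z *\<^sub>R u z) \<in> borel_measurable lborel" unfolding gauss_def by measurable
    show "AE z in lborel. norm (gauss \<beta> z *\<^sub>R u z) \<le> norm ((\<bar>C\<bar> * fact d * exp (1 + 1 / (2 * \<beta>))) * exp (- (\<beta> / 2) * (norm z)\<^sup>2))"
    proof (rule AE_I2)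
      fix z :: "complex ^ 'n"
      let ?r = "norm z"
      have "(1 + ?r) ^ d / fact d \<le> exp (1 + ?r)"
        by (rule power_div_fact_le_exp) simp
      then have p: "(1 + ?r) ^ d \<le> fact d * exp (1 + ?r)" by (simp add: divide_le_eq mult.commute)
      have "0 \<le> (\<beta> * ?r - 1)\<^sup>2 / (2 * \<beta>)" using \<beta> by simp
      also have "\<dots> = \<beta> / 2 * ?r\<^sup>2 - ?r + 1 / (2 * \<beta>)" using \<beta> by (simp add: field_simps power2_eq_square)
      finally have q: "- \<beta> * ?r\<^sup>2 + (1 + ?r) \<le> 1 + 1 / (2 * \<beta>) + - (\<beta> / 2) * ?r\<^sup>2" by (simp add: field_simps)
      have "norm (gauss \<beta> z *\<^sub>R u z) \<le> exp (- \<beta> * ?r\<^sup>2) * (\<bar>C\<bar> * (1 + ?r) ^ d)"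
        unfolding norm_scaleR gauss_def
        by (intro mult_mono order_trans[OF u] mult_right_mono) auto
      also have "\<dots> \<le> exp (- \<beta> * ?r\<^sup>2) * (\<bar>C\<bar> * (fact d * exp (1 + ?r)))"
        by (intro mult_left_mono p) auto
      also have "\<dots> = \<bar>C\<bar> * fact d * exp (- \<beta> * ?r\<^sup>2 + (1 + ?r))" by (simp only: exp_add mult_ac)
      also have "\<dots> \<le> \<bar>C\<bar> * fact d * exp (1 + 1 / (2 * \<beta>) + - (\<beta> / 2) * ?r\<^sup>2)"
        using q by (intro mult_left_mono) auto
      also have "\<dots> = (\<bar>C\<bar> * fact d * exp (1 + 1 / (2 * \<beta>))) * exp (- (\<beta> / 2) * ?r\<^sup>2)" by (simp only: exp_add mult_ac)
      finally show "norm (gauss \<beta> z *\<^sub>R u z) \<le> norm ((\<bar>C\<bar> * fact d * exp (1 + 1 / (2 * \<beta>))) * exp (- (\<beta> / 2) * (norm z)\<^sup>2))"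
        by simp
    qed
  qed
qed

lemma polyfun_measurable: "polyfun u \<Longrightarrow> u \<in> borel_measurable borel"
  by (intro borel_measurable_continuous_onI C1_continuous polyfun_C1)

lemma polyfun_integrable:
  assumes "polyfun u" "\<beta> > 0"
  shows "integrable lborel (\<lambda>z. gauss \<beta> z *\<^sub>R u z)"
  using polyfun_growth[OF assms(1)] integrable_growth_gauss[OF polyfun_measurable[OF assms(1)] assms(2)] by blast

lemma polyfun_square_integrable:
  assumes "polyfun u" "\<beta> > 0"
  shows "integrable lborel (\<lambda>z. (cmod (u z))\<^sup>2 * gauss \<beta> z)"
  using integrable_norm[OF polyfun_integrable[OF polyfun_mult[OF assms(1) assms(1)] assms(2)]]
  by (simp add: norm_mult gauss_def power2_eq_square mult_ac)

section \<open>Projection onto holomorphic polynomials\<close>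

text \<open>
  Up to a constant this is the homogeneous component of degree \<open>m\<close> of the Bargmann projection of \<open>g\<close>.
\<close>

definition hmoment :: "real \<Rightarrow> nat \<Rightarrow> (complex ^ 'n::finite \<Rightarrow> complex) \<Rightarrow> complex ^ 'n \<Rightarrow> complex" where
  "hmoment \<beta> m g z = (LINT w|lborel. g w * of_real (gauss \<beta> w) * hdot z w ^ m)"

lemma hmoment_integrable:
  assumes "Cc g" shows "integrable lborel (\<lambda>w. g w * of_real (gauss \<beta> w) * hdot z w ^ m)"
  by (intro Cc_integrable Cc_mult_right assms continuous_intros continuous_gauss)

text \<open>
One factor \<open>hdot z w\<close> is split off and expanded; the factor \<open>cnj (w $ k)\<close> is absorbed in \<open>g\<close>.
\<close>

lemma polyfun_hmoment: "Cc g \<Longrightarrow> polyfun (hmoment \<beta> m g)"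
proof (induction m arbitrary: g)
  case 0
  then show ?case unfolding hmoment_def[abs_def] by (auto intro: polyfun_const)
next
  case (Suc m)
  have cg: "Cc (\<lambda>w. g w * cnj (w $ k))" for k
    by (intro Cc_mult_right Suc.prems continuous_intros)
  have "hmoment \<beta> (Suc m) g z = (\<Sum>k\<in>UNIV. z $ k * hmoment \<beta> m (\<lambda>w. g w * cnj (w $ k)) z)" for z
  proof -
    have "hmoment \<beta> (Suc m) g z = (LINT w|lborel. (\<Sum>k\<in>UNIV. z $ k * (g w * cnj (w $ k) * of_real (gauss \<beta> w) * hdot z w ^ m)))"
      unfolding hmoment_def power_Suc
      by (rule Bochner_Integration.integral_cong) (auto simp: hdot_def[of z] sum_distrib_left sum_distrib_right mult_ac)
    also have "\<dots> = (\<Sum>k\<in>UNIV. z $ k * hmoment \<beta> m (\<lambda>w. g w * cnj (w $ k)) z)"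
      unfolding hmoment_def
      by (subst Bochner_Integration.integral_sum) (auto intro!: integrable_mult_right hmoment_integrable[OF cg])
    finally show ?thesis .
  qed
  then have "hmoment \<beta> (Suc m) g = (\<lambda>z. \<Sum>k\<in>UNIV. z $ k * hmoment \<beta> m (\<lambda>w. g w * cnj (w $ k)) z)" by auto
  moreover have "polyfun (\<lambda>z. \<Sum>k\<in>UNIV. z $ k * hmoment \<beta> m (\<lambda>w. g w * cnj (w $ k)) z)"
    by (intro polyfun_sum polyfun_mult polyfun_coord Suc.IH cg) auto
  ultimately show ?case by simp
qed

lemma hmoment_homogeneous: "hmoment \<beta> m g (c *s z) = c ^ m * hmoment \<beta> m g z"
proof -
  have "hdot (c *s z) w = c * hdot z w" for w
    by (simp add: hdot_def sum_distrib_left mult_ac)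
  then show ?thesis unfolding hmoment_def
    by (subst integral_mult_right_zero[symmetric]) (simp add: power_mult_distrib mult_ac)
qed

definition bkernel :: "real \<Rightarrow> nat \<Rightarrow> complex ^ 'n::finite \<Rightarrow> complex ^ 'n \<Rightarrow> complex" where
  "bkernel \<beta> N z w = (\<Sum>m<N. (of_real \<beta> * hdot z w) ^ m / fact m)"

text \<open>
This is \<open>gmass \<beta>\<close> times the part of degree less than \<open>N\<close> of the Bargmann projection of \<open>g\<close>; the normalization is postponed.
\<close>

definition bproj :: "real \<Rightarrow> nat \<Rightarrow> (complex ^ 'n::finite \<Rightarrow> complex) \<Rightarrow> complex ^ 'n \<Rightarrow> complex" where
  "bproj \<beta> N g z = (\<Sum>m<N. of_real (\<beta> ^ m / fact m) * hmoment \<beta> m g z)"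

lemma polyfun_bproj: "Cc g \<Longrightarrow> polyfun (bproj \<beta> N g)"
  unfolding bproj_def[abs_def] by (intro polyfun_sum polyfun_mult polyfun_const polyfun_hmoment) auto

lemma ckernel_bkernel: "ckernel (bkernel \<beta> N)"
  unfolding bkernel_def by (intro continuous_intros) auto

lemma bproj_eq:
  assumes "Cc g"
  shows "bproj \<beta> N g z = (LINT w|lborel. g w * of_real (gauss \<beta> w) * bkernel \<beta> N z w)"
proof -
  have "(LINT w|lborel. g w * of_real (gauss \<beta> w) * bkernel \<beta> N z w)
     = (LINT w|lborel. (\<Sum>m<N. of_real (\<beta> ^ m / fact m) * (g w * of_real (gauss \<beta> w) * hdot z w ^ m)))"
    unfolding bkernel_def sum_distrib_left
    by (intro Bochner_Integration.integral_cong sum.cong) (auto simp: power_mult_distrib)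
  also have "\<dots> = bproj \<beta> N g z"
    unfolding bproj_def hmoment_def
    by (subst Bochner_Integration.integral_sum) (auto intro!: integrable_mult_right hmoment_integrable[OF assms])
  finally show ?thesis ..
qed

definition weighted :: "real \<Rightarrow> (complex ^ 'n::finite \<Rightarrow> complex) \<Rightarrow> complex ^ 'n \<Rightarrow> complex" where
  "weighted \<beta> u z = u z * of_real (gauss \<beta> z)"

lemma Cc_weighted: "Cc u \<Longrightarrow> Cc (weighted \<beta> u)"
  unfolding weighted_def[abs_def] by (intro Cc_mult_right continuous_intros continuous_gauss)

lemma kform_gkernel_1:
  fixes u v :: "complex ^ 'n::finite \<Rightarrow> complex"
  shows "kform (gkernel \<beta> 1) u v = kform (\<lambda>z w. exp (of_real \<beta> * hdot z w)) (weighted \<beta> u) (weighted \<beta> v)"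
proof -
  have "gkernel \<beta> 1 z w = of_real (gauss \<beta> z) * of_real (gauss \<beta> w) * exp (of_real \<beta> * hdot z w)" for z w :: "complex ^ 'n"
    unfolding gkernel_def gauss_def hdot_self exp_of_real[symmetric] exp_add[symmetric]
    by (rule arg_cong[of _ _ exp]) (simp add: algebra_simps)
  then show ?thesis unfolding kform_def weighted_def
    by (intro Bochner_Integration.integral_cong refl) (simp add: mult_ac)
qed

lemma bargmann_kernel_decomposition:
  assumes "\<beta> > 0"
  shows "of_real \<beta> * hdot z w = (\<Sum>k\<in>UNIV. (of_real (sqrt \<beta>) * z $ k) * cnj (of_real (sqrt \<beta>) * w $ k))"
proof -
  have "complex_of_real (sqrt \<beta>) * complex_of_real (sqrt \<beta>) = of_real \<beta>"
    using assms by (simp flip: of_real_mult)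
  then have k: "(of_real (sqrt \<beta>) * z $ k) * cnj (of_real (sqrt \<beta>) * w $ k) = of_real \<beta> * (z $ k * cnj (w $ k))" for k
    by (metis (no_types, lifting) complex_cnj_complex_of_real complex_cnj_mult mult.assoc mult.left_commute)
  show ?thesis unfolding hdot_def sum_distrib_left k ..
qed

lemma bkernel_form_bounds:
  assumes "Cc u" "\<beta> > 0"
  shows "0 \<le> Re (kform (bkernel \<beta> N) (weighted \<beta> u) (weighted \<beta> u))"
    and "Re (kform (bkernel \<beta> N) (weighted \<beta> u) (weighted \<beta> u)) \<le> Re (kform (gkernel \<beta> 1) u u)"
proof -
  have c: "continuous_on UNIV (\<lambda>z::complex ^ 'a. of_real (sqrt \<beta>) * z $ k)" for k
    by (intro continuous_intros)
  note m = kform_exp_partial_sums_mono[where I="UNIV :: 'a set" and b="\<lambda>k z. of_real (sqrt \<beta>) * z $ k", OF finite c Cc_weighted[OF assms(1)],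
      unfolded bargmann_kernel_decomposition[OF assms(2), symmetric]]
  show "0 \<le> Re (kform (bkernel \<beta> N) (weighted \<beta> u) (weighted \<beta> u))"
    using m(1) unfolding bkernel_def[abs_def] .
  show "Re (kform (bkernel \<beta> N) (weighted \<beta> u) (weighted \<beta> u)) \<le> Re (kform (gkernel \<beta> 1) u u)"
    using m(2) unfolding bkernel_def[abs_def] kform_gkernel_1 .
qed

lemma kform_bkernel_eq:
  assumes "Cc u" "Cc g"
  shows "kform (bkernel \<beta> N) (weighted \<beta> u) (weighted \<beta> g) = (LINT z|lborel. cnj (u z) * bproj \<beta> N g z * of_real (gauss \<beta> z))"
proof -
  have "kform (bkernel \<beta> N) (weighted \<beta> u) (weighted \<beta> g) = (LINT z|lborel. LINT w|lborel. cnj (weighted \<beta> u z) * weighted \<beta> g w * bkernel \<beta> N z w)"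
    by (rule kform_iterated(1)[OF Cc_weighted Cc_weighted ckernel_bkernel]) (use assms in auto)
  also have "\<dots> = (LINT z|lborel. cnj (u z) * bproj \<beta> N g z * of_real (gauss \<beta> z))"
  proof (rule Bochner_Integration.integral_cong)
    fix z
    have "(LINT w|lborel. cnj (weighted \<beta> u z) * weighted \<beta> g w * bkernel \<beta> N z w) = cnj (weighted \<beta> u z) * (LINT w|lborel. weighted \<beta> g w * bkernel \<beta> N z w)"
      by (subst integral_mult_right_zero[symmetric]) (simp add: mult_ac)
    also have "\<dots> = cnj (u z) * bproj \<beta> N g z * of_real (gauss \<beta> z)"
      unfolding bproj_eq[OF assms(2)] by (simp add: weighted_def mult_ac)
    finally show "(LINT w|lborel. cnj (weighted \<beta> u z) * weighted \<beta> g w * bkernel \<beta> N z w) = cnj (u z) * bproj \<beta> N g z * of_real (gauss \<beta> z)" .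
  qed simp
  finally show ?thesis .
qed

lemma kform_hermitian:
  assumes "Cc u" "Cc v" "ckernel K" "\<And>z w. cnj (K z w) = K w z"
  shows "kform K v u = cnj (kform K u v)"
proof -
  have "cnj (kform K u v) = (LINT z|lborel. LINT w|lborel. cnj (cnj (u z) * v w * K z w))"
    unfolding kform_iterated(1)[OF assms(1-3)] by (simp only: Bochner_Integration.integral_cnj)
  also have "\<dots> = (LINT z|lborel. LINT w|lborel. cnj (v w) * u z * K w z)"
    by (simp add: assms(4) mult_ac)
  also have "\<dots> = kform K v u" by (rule kform_iterated(2)[OF assms(2,1,3), symmetric])
  finally show ?thesis ..
qed

lemma cnj_bkernel: "cnj (bkernel \<beta> N z w) = bkernel \<beta> N w z"
  by (simp add: bkernel_def cnj_hdot)

lemma C1_of_real: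
  assumes "times_cont_diff (Suc 0) f"
  shows "C1 (\<lambda>x. of_real (f x))" "ddir (\<lambda>x. of_real (f x)) v x = of_real (frechet_derivative f (at x) v)"
proof -
  have d: "((\<lambda>x. complex_of_real (f x)) has_derivative (\<lambda>v. of_real (frechet_derivative f (at x) v))) (at x)" for x
    by (rule has_derivative_of_real[OF times_cont_diff_has_derivative[OF assms]])
  show "C1 (\<lambda>x. of_real (f x))" by (rule C1I[OF d]) (use assms in \<open>auto intro!: continuous_intros\<close>)
  show "ddir (\<lambda>x. of_real (f x)) v x = of_real (frechet_derivative f (at x) v)" by (rule ddir_eqI[OF d])
qed

lemma bdd_supp_cutoff: "bdd_supp (\<lambda>x. complex_of_real (cutoff R x))"
  unfolding bdd_supp_def by (intro exI[of _ "real (Suc R)"] allI impI) (simp only: cutoff_eq_0[OF less_imp_le] of_real_0)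

lemma gmass_pos: assumes "\<beta> > 0" shows "gmass \<beta> TYPE('n::finite) > 0"
proof -
  have i: "integrable lborel (gauss \<beta> :: complex ^ 'n \<Rightarrow> real)"
    using integrable_gauss[OF assms] by (simp add: gauss_def[abs_def])
  have "gmass \<beta> TYPE('n) \<noteq> 0"
  proof
    assume "gmass \<beta> TYPE('n) = 0"
    then have "AE z in lborel. gauss \<beta> (z :: complex ^ 'n) = 0"
      unfolding gmass_def using integral_nonneg_eq_0_iff_AE[OF i] by (auto simp: gauss_def)
    then show False by (auto simp: gauss_def trivial_limit_def[symmetric] ae_filter_eq_bot_iff)
  qed
  moreover have "gmass \<beta> TYPE('n) \<ge> 0" unfolding gmass_def by (rule Bochner_Integration.integral_nonneg) (auto simp: gauss_def)
  ultimately show ?thesis by simp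
qed

text \<open>
  A projection \<open>P\<close> satisfies \<open>\<parallel>P g\<parallel>\<^sup>2 = \<langle>P g, g\<rangle>\<close>. Here an inequality follows from positivity of the
  form on \<open>g - h\<close>, where \<open>h\<close> is a cut-off of the normalized projection, and from contractivity on \<open>h\<close>; the cut-off is removed by dominated convergence.
\<close>

lemma bproj_norm_le:
  fixes g :: "complex ^ 'n::finite \<Rightarrow> complex"
  assumes "Cc g" "\<beta> > 0"
  shows "(LINT z|lborel. (cmod (bproj \<beta> N g z))\<^sup>2 * gauss \<beta> z)
    \<le> gmass \<beta> TYPE('n) * Re (kform (bkernel \<beta> N) (weighted \<beta> g) (weighted \<beta> g))"
proof -
  define G where "G = gmass \<beta> TYPE('n)"
  have G: "G > 0" unfolding G_def by (rule gmass_pos[OF assms(2)])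
  define P where "P = bproj \<beta> N g"
  have pP: "polyfun P" unfolding P_def by (rule polyfun_bproj[OF assms(1)])
  define Q where "Q = (\<lambda>u :: complex ^ 'n \<Rightarrow> complex. Re (kform (bkernel \<beta> N) (weighted \<beta> u) (weighted \<beta> u)))"
  have iP: "integrable lborel (\<lambda>z. (cmod (P z))\<^sup>2 * gauss \<beta> z)" by (rule polyfun_square_integrable[OF pP assms(2)])
  have mc: "cutoff R \<in> borel_measurable lborel" for R
    using borel_measurable_continuous_onI[OF times_cont_diff_continuous[OF times_cont_diff_cutoff]] by simp
  have ib: "integrable lborel (\<lambda>z. c (cutoff R z) * ((cmod (P z))\<^sup>2 * gauss \<beta> z))"
    if c: "c \<in> borel_measurable borel" and cb: "\<And>x. 0 \<le> x \<Longrightarrow> x \<le> 1 \<Longrightarrow> \<bar>c x\<bar> \<le> 2" for c :: "real \<Rightarrow> real" and R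
  proof (rule Bochner_Integration.integrable_bound[OF integrable_mult_right[OF iP, of 2]])
    show "(\<lambda>z. c (cutoff R z) * ((cmod (P z))\<^sup>2 * gauss \<beta> z)) \<in> borel_measurable lborel"
      using measurable_compose[OF mc c] borel_measurable_integrable[OF iP] by (rule borel_measurable_times)
    show "AE z in lborel. norm (c (cutoff R z) * ((cmod (P z))\<^sup>2 * gauss \<beta> z)) \<le> norm (2 * ((cmod (P z))\<^sup>2 * gauss \<beta> z))"
      unfolding norm_mult by (intro AE_I2 mult_right_mono) (auto intro!: cb cutoff_nonneg cutoff_le_1)
  qed
  have main: "(LINT z|lborel. (2 * cutoff R z - (cutoff R z)\<^sup>2) * ((cmod (P z))\<^sup>2 * gauss \<beta> z)) \<le> G * Q g" for R
  proof -
    \<comment> \<open>A compactly supported approximation of the normalized projection, to which the contraction estimate applies.\<close>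
    define h where "h = (\<lambda>z. of_real (cutoff R z) * (of_real (1 / G) * P z))"
    have C1h: "C1 h" unfolding h_def
      by (intro C1_mult C1_of_real(1) times_cont_diff_cutoff C1_const polyfun_C1 pP)
    have bh: "bdd_supp h" unfolding h_def by (rule bdd_supp_mult_left[OF bdd_supp_cutoff])
    note ch = C1_Cc[OF C1h bh]
    have i1: "integrable lborel (\<lambda>z. cutoff R z * ((cmod (P z))\<^sup>2 * gauss \<beta> z))"
      by (rule ib[of "\<lambda>x. x"]) auto
    have i2: "integrable lborel (\<lambda>z. (cutoff R z)\<^sup>2 * ((cmod (P z))\<^sup>2 * gauss \<beta> z))"
      by (rule ib[of "\<lambda>x. x\<^sup>2"]) (auto simp: power_le_one intro: order_trans[of _ 1])
    have "0 \<le> Q (\<lambda>z. g z - h z)"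
      unfolding Q_def by (rule bkernel_form_bounds(1)[OF Cc_diff[OF assms(1) ch] assms(2)])
    also have "weighted \<beta> (\<lambda>z. g z - h z) = (\<lambda>z. weighted \<beta> g z - weighted \<beta> h z)" by (simp add: weighted_def fun_eq_iff algebra_simps)
    then have "Q (\<lambda>z. g z - h z) = Q g - Re (kform (bkernel \<beta> N) (weighted \<beta> g) (weighted \<beta> h)) - Re (kform (bkernel \<beta> N) (weighted \<beta> h) (weighted \<beta> g)) + Q h"
      unfolding Q_def by (simp add: kform_diff[OF Cc_weighted[OF assms(1)] Cc_weighted[OF ch] ckernel_bkernel])
    also have "Re (kform (bkernel \<beta> N) (weighted \<beta> g) (weighted \<beta> h)) = Re (kform (bkernel \<beta> N) (weighted \<beta> h) (weighted \<beta> g))"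
      by (subst kform_hermitian[OF Cc_weighted[OF ch] Cc_weighted[OF assms(1)] ckernel_bkernel cnj_bkernel]) simp
    also have "Re (kform (bkernel \<beta> N) (weighted \<beta> h) (weighted \<beta> g)) = (1 / G) * (LINT z|lborel. cutoff R z * ((cmod (P z))\<^sup>2 * gauss \<beta> z))"
    proof -
      have "kform (bkernel \<beta> N) (weighted \<beta> h) (weighted \<beta> g) = (LINT z|lborel. complex_of_real ((1 / G) * (cutoff R z * ((cmod (P z))\<^sup>2 * gauss \<beta> z))))"
        unfolding kform_bkernel_eq[OF ch assms(1)] P_def[symmetric] unfolding h_def
        by (rule Bochner_Integration.integral_cong) (simp_all only: of_real_mult complex_norm_square complex_cnj_mult complex_cnj_complex_of_real mult_ac)
      then show ?thesis by (simp only: integral_complex_of_real Re_complex_of_real) simp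
    qed
    also have "Q h \<le> (1 / G) * (LINT z|lborel. (cutoff R z)\<^sup>2 * ((cmod (P z))\<^sup>2 * gauss \<beta> z))"
    proof -
      have "Q h \<le> Re (kform (gkernel \<beta> 1) h h)" unfolding Q_def by (rule bkernel_form_bounds(2)[OF ch assms(2)])
      also have "\<dots> = gform \<beta> h 1" by (simp add: gform_def)
      also have "\<dots> \<le> G * (LINT z|lborel. (cmod (h z))\<^sup>2 * gauss \<beta> z)"
        unfolding G_def by (rule gform_le[OF C1h bh assms(2)]) simp
      also have "(\<lambda>z. (cmod (h z))\<^sup>2 * gauss \<beta> z) = (\<lambda>z. (1 / G\<^sup>2) * ((cutoff R z)\<^sup>2 * ((cmod (P z))\<^sup>2 * gauss \<beta> z)))"
        unfolding h_def norm_mult norm_of_real power_mult_distrib power2_abs by (simp add: power_divide mult_ac)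
      finally show ?thesis using G by (simp add: power2_eq_square)
    qed
    finally have "0 \<le> Q g - 2 * ((1 / G) * (LINT z|lborel. cutoff R z * ((cmod (P z))\<^sup>2 * gauss \<beta> z)))
        + (1 / G) * (LINT z|lborel. (cutoff R z)\<^sup>2 * ((cmod (P z))\<^sup>2 * gauss \<beta> z))" by simp
    then have "2 * (LINT z|lborel. cutoff R z * ((cmod (P z))\<^sup>2 * gauss \<beta> z)) - (LINT z|lborel. (cutoff R z)\<^sup>2 * ((cmod (P z))\<^sup>2 * gauss \<beta> z)) \<le> G * Q g"
      using G by (simp add: field_simps)
    also have "2 * (LINT z|lborel. cutoff R z * ((cmod (P z))\<^sup>2 * gauss \<beta> z)) - (LINT z|lborel. (cutoff R z)\<^sup>2 * ((cmod (P z))\<^sup>2 * gauss \<beta> z))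
      = (LINT z|lborel. 2 * (cutoff R z * ((cmod (P z))\<^sup>2 * gauss \<beta> z)) - (cutoff R z)\<^sup>2 * ((cmod (P z))\<^sup>2 * gauss \<beta> z))"
      using i1 i2 by simp
    finally show ?thesis by (simp add: left_diff_distrib mult.assoc)
  qed
  have "(\<lambda>R. LINT z|lborel. (2 * cutoff R z - (cutoff R z)\<^sup>2) * ((cmod (P z))\<^sup>2 * gauss \<beta> z))
    \<longlonglongrightarrow> (LINT z|lborel. (cmod (P z))\<^sup>2 * gauss \<beta> z)"
  proof (rule integral_dominated_convergence[where w="\<lambda>z. 2 * ((cmod (P z))\<^sup>2 * gauss \<beta> z)"])
    have cb: "\<bar>2 * x - x\<^sup>2\<bar> \<le> 2" if "0 \<le> x" "x \<le> 1" for x :: real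
      unfolding power2_eq_square abs_le_iff using that mult_left_le[of x x] zero_le_square[of x] by linarith
    show "(\<lambda>z. (2 * cutoff R z - (cutoff R z)\<^sup>2) * ((cmod (P z))\<^sup>2 * gauss \<beta> z)) \<in> borel_measurable lborel" for R
      by (rule borel_measurable_integrable[OF ib[of "\<lambda>x. 2 * x - x\<^sup>2"]]) (use cb in auto)
    show "AE z in lborel. norm ((2 * cutoff R z - (cutoff R z)\<^sup>2) * ((cmod (P z))\<^sup>2 * gauss \<beta> z)) \<le> 2 * ((cmod (P z))\<^sup>2 * gauss \<beta> z)" for R
    proof (rule AE_I2)
      fix z
      have "\<bar>2 * cutoff R z - (cutoff R z)\<^sup>2\<bar> * ((cmod (P z))\<^sup>2 * gauss \<beta> z) \<le> 2 * ((cmod (P z))\<^sup>2 * gauss \<beta> z)"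
        by (intro mult_right_mono cb cutoff_nonneg cutoff_le_1) (auto simp: gauss_def)
      then show "norm ((2 * cutoff R z - (cutoff R z)\<^sup>2) * ((cmod (P z))\<^sup>2 * gauss \<beta> z)) \<le> 2 * ((cmod (P z))\<^sup>2 * gauss \<beta> z)"
        by (simp add: abs_mult gauss_def)
    qed
    show "AE z in lborel. (\<lambda>R. (2 * cutoff R z - (cutoff R z)\<^sup>2) * ((cmod (P z))\<^sup>2 * gauss \<beta> z)) \<longlonglongrightarrow> (cmod (P z))\<^sup>2 * gauss \<beta> z"
    proof (rule AE_I2)
      fix z
      have "(\<lambda>R. (2 * cutoff R z - (cutoff R z)\<^sup>2) * ((cmod (P z))\<^sup>2 * gauss \<beta> z)) \<longlonglongrightarrow> (2 * 1 - 1\<^sup>2) * ((cmod (P z))\<^sup>2 * gauss \<beta> z)"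
        by (intro tendsto_intros cutoff_tendsto_1)
      then show "(\<lambda>R. (2 * cutoff R z - (cutoff R z)\<^sup>2) * ((cmod (P z))\<^sup>2 * gauss \<beta> z)) \<longlonglongrightarrow> (cmod (P z))\<^sup>2 * gauss \<beta> z" by simp
    qed
    show "integrable lborel (\<lambda>z. 2 * ((cmod (P z))\<^sup>2 * gauss \<beta> z))" by (rule integrable_mult_right[OF iP])
  qed (use borel_measurable_integrable[OF iP] in auto)
  then have "(LINT z|lborel. (cmod (P z))\<^sup>2 * gauss \<beta> z) \<le> G * Q g"
    by (rule tendsto_upperbound) (use main in auto)
  then show ?thesis unfolding G_def P_def Q_def .
qed


section \<open>A Bessel inequality\<close>

lemma norm_scalar_vec: "norm (c *s z) = cmod c * norm (z :: complex ^ 'n::finite)"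
  unfolding norm_vec_def L2_set_def
  by (simp add: norm_mult power_mult_distrib sum_distrib_left[symmetric] real_sqrt_mult)

lemma orthogonal_transformation_rotation:
  assumes "cmod c = 1" shows "orthogonal_transformation (\<lambda>z::complex ^ 'n::finite. c *s z)"
  unfolding orthogonal_transformation
proof (intro conjI allI)
  show "linear (\<lambda>z::complex ^ 'n. c *s z)"
    by (rule linearI) (auto simp: vec_eq_iff algebra_simps)
qed (simp add: norm_scalar_vec assms)

text \<open>
The rotation by an angle of \<open>\<pi> / k\<close> preserves Lebesgue measure and changes the sign of \<open>F\<close>.
\<close>

lemma integral_rotation_eq_0:
  fixes F :: "complex ^ 'n::finite \<Rightarrow> complex"
  assumes F: "F \<in> borel_measurable borel" and k: "k > 0"
    and hom: "\<And>c z. cmod c = 1 \<Longrightarrow> F (c *s z) = c ^ k * F z"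
  shows "(LINT z|lborel. F z) = 0"
proof -
  \<comment> \<open>Chosen so that \<open>c ^ k = -1\<close>.\<close>
  define c where "c = cis (pi / real k)"
  have c: "cmod c = 1" "c ^ k = -1" using k by (auto simp: c_def Complex.DeMoivre)
  have "(LINT z|lborel. F z) = (LINT z|lborel. F (c *s z))"
    by (rule integral_orthogonal_transformation[OF orthogonal_transformation_rotation[OF c(1)] F, symmetric])
  also have "\<dots> = - (LINT z|lborel. F z)" by (simp add: hom[OF c(1)] c(2))
  finally show ?thesis by simp
qed

lemma gauss_rotation: "cmod c = 1 \<Longrightarrow> gauss \<beta> (c *s z) = gauss \<beta> z"
  by (simp add: gauss_def norm_scalar_vec)

text \<open>
In the application \<open>\<theta> = cnj V / V\<close>, so that \<open>u \<mapsto> cnj (u * \<theta>)\<close> fixes \<open>g\<close>. With \<open>P\<close> the truncated projection of \<open>g\<close>, the functions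
\<open>P\<close> and \<open>cnj (P * \<theta>)\<close> have the same inner product with \<open>g\<close> up to conjugation, and their mutual inner product vanishes since \<open>P * P * \<theta>\<close>
consists of terms that are homogeneous of positive degree under rotations. Expanding the square of \<open>g - P - cnj (P * \<theta>)\<close> gives the
factor 2.
\<close>

theorem bessel_with_conjugation:
  fixes g :: "complex ^ 'n::finite \<Rightarrow> complex"
  assumes g: "Cc g" and \<beta>: "\<beta> > 0"
    and \<theta> [measurable]: "\<theta> \<in> borel_measurable borel" and \<theta>1: "\<And>z. cmod (\<theta> z) \<le> 1"
    and real: "\<And>z. cnj (g z) = g z * \<theta> z"
    and low: "\<And>m z. m \<le> D \<Longrightarrow> hmoment \<beta> m g z = 0"
    and hom: "\<And>c z. cmod c = 1 \<Longrightarrow> c ^ (2 * D) * \<theta> (c *s z) = \<theta> z"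
  shows "2 * Re (kform (gkernel \<beta> 1) g g) \<le> gmass \<beta> TYPE('n) * (LINT z|lborel. (cmod (g z))\<^sup>2 * gauss \<beta> z)"
proof -
  define G where "G = gmass \<beta> TYPE('n)"
  have G: "G > 0" unfolding G_def by (rule gmass_pos[OF \<beta>])
  have ig: "integrable lborel (\<lambda>z. (cmod (g z))\<^sup>2 * gauss \<beta> z)"
  proof -
    have "integrable lborel (\<lambda>z. cmod (g z * (g z * of_real (gauss \<beta> z))))"
      using g by (intro integrable_norm Cc_integrable Cc_mult_right continuous_intros continuous_gauss) (auto simp: Cc_def)
    then show ?thesis by (simp add: norm_mult gauss_def power2_eq_square mult_ac)
  qed
  have bound: "2 * Re (kform (bkernel \<beta> N) (weighted \<beta> g) (weighted \<beta> g)) \<le> G * (LINT z|lborel. (cmod (g z))\<^sup>2 * gauss \<beta> z)" for N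
  proof -
    define Q where "Q = Re (kform (bkernel \<beta> N) (weighted \<beta> g) (weighted \<beta> g))"
    define P where "P = (\<lambda>z. of_real (1 / G) * bproj \<beta> N g z)"
    have pP: "polyfun P" unfolding P_def by (intro polyfun_mult polyfun_const polyfun_bproj[OF g])
    have [measurable]: "P \<in> borel_measurable borel" by (rule polyfun_measurable[OF pP])
    have iP: "integrable lborel (\<lambda>z. (cmod (P z))\<^sup>2 * gauss \<beta> z)" by (rule polyfun_square_integrable[OF pP \<beta>])
    have nP: "(LINT z|lborel. (cmod (P z))\<^sup>2 * gauss \<beta> z) \<le> Q / G"
    proof -
      have "(\<lambda>z. (cmod (P z))\<^sup>2 * gauss \<beta> z) = (\<lambda>z. (1 / G\<^sup>2) * ((cmod (bproj \<beta> N g z))\<^sup>2 * gauss \<beta> z))"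
        unfolding P_def norm_mult norm_of_real power_mult_distrib power2_abs by (simp add: power_divide)
      then have "(LINT z|lborel. (cmod (P z))\<^sup>2 * gauss \<beta> z) = (1 / G\<^sup>2) * (LINT z|lborel. (cmod (bproj \<beta> N g z))\<^sup>2 * gauss \<beta> z)" by simp
      also have "\<dots> \<le> (1 / G\<^sup>2) * (G * Q)"
        unfolding G_def Q_def by (intro mult_left_mono bproj_norm_le[OF g \<beta>]) simp
      finally show ?thesis using G by (simp add: power2_eq_square)
    qed
    have igP: "integrable lborel (\<lambda>z. cnj (g z) * P z * of_real (gauss \<beta> z))"
    proof -
      have "integrable lborel (\<lambda>z. cnj (g z * (cnj (P z) * of_real (gauss \<beta> z))))"
        by (intro integrable_cnj Cc_integrable Cc_mult_right g continuous_intros continuous_gauss C1_continuous polyfun_C1 pP)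
      then show ?thesis by (simp add: mult_ac)
    qed
    have gP: "(LINT z|lborel. cnj (g z) * P z * of_real (gauss \<beta> z)) = of_real (1 / G) * kform (bkernel \<beta> N) (weighted \<beta> g) (weighted \<beta> g)"
      unfolding kform_bkernel_eq[OF g g] P_def
      by (subst integral_mult_right_zero[symmetric]) (simp only: mult_ac)
    have PP: "integrable lborel (\<lambda>z. hmoment \<beta> m g z * hmoment \<beta> l g z * \<theta> z * of_real (gauss \<beta> z))"
      and PP0: "(LINT z|lborel. hmoment \<beta> m g z * hmoment \<beta> l g z * \<theta> z * of_real (gauss \<beta> z)) = 0" for m l
    proof -
      let ?F = "\<lambda>z. hmoment \<beta> m g z * hmoment \<beta> l g z * \<theta> z * of_real (gauss \<beta> z)"
      have pml: "polyfun (\<lambda>z. hmoment \<beta> m g z * hmoment \<beta> l g z)"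
        by (intro polyfun_mult polyfun_hmoment g)
      have mm [measurable]: "hmoment \<beta> m g \<in> borel_measurable borel" for m
        by (rule polyfun_measurable[OF polyfun_hmoment[OF g]])
      have mF: "?F \<in> borel_measurable borel" unfolding gauss_def by measurable
      show "integrable lborel ?F"
      proof (rule Bochner_Integration.integrable_bound[OF polyfun_integrable[OF pml \<beta>]])
        show "AE z in lborel. norm (?F z) \<le> norm (gauss \<beta> z *\<^sub>R (hmoment \<beta> m g z * hmoment \<beta> l g z))"
        proof (rule AE_I2)
          fix z
          have "cmod (hmoment \<beta> m g z * hmoment \<beta> l g z) * gauss \<beta> z * cmod (\<theta> z) \<le> cmod (hmoment \<beta> m g z * hmoment \<beta> l g z) * gauss \<beta> z * 1"
            by (intro mult_left_mono \<theta>1) (auto simp: gauss_def)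
          then show "norm (?F z) \<le> norm (gauss \<beta> z *\<^sub>R (hmoment \<beta> m g z * hmoment \<beta> l g z))"
            by (simp add: norm_mult gauss_def mult_ac)
        qed
      qed (use mF in simp)
      show "(LINT z|lborel. ?F z) = 0"
      proof (cases "m \<le> D \<or> l \<le> D")
        case True
        then show ?thesis using low by auto
      next
        case False
        show ?thesis
        proof (rule integral_rotation_eq_0[OF mF, of "m + l - 2 * D"])
          show "0 < m + l - 2 * D" using False by simp
          fix c :: complex and z :: "complex ^ 'n" assume c: "cmod c = 1"
          then have c0: "c ^ (2 * D) \<noteq> 0" by auto
          have "c ^ (m + l) = c ^ (m + l - 2 * D) * c ^ (2 * D)"
            using False by (simp flip: power_add)
          then have "c ^ (2 * D) * ?F (c *s z) = c ^ (2 * D) * (c ^ (m + l - 2 * D) * ?F z)"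
            unfolding hmoment_homogeneous gauss_rotation[OF c]
            using hom[OF c, of z, symmetric] by (simp add: power_add mult_ac)
          then show "?F (c *s z) = c ^ (m + l - 2 * D) * ?F z" by (rule mult_left_cancel[OF c0, THEN iffD1])
        qed
      qed
    qed
    have sq: "P z * P z * \<theta> z * of_real (gauss \<beta> z) = of_real (1 / G) * of_real (1 / G) * (\<Sum>m<N. \<Sum>l<N. of_real (\<beta> ^ m / fact m) * of_real (\<beta> ^ l / fact l) *
        (hmoment \<beta> m g z * hmoment \<beta> l g z * \<theta> z * of_real (gauss \<beta> z)))" for z
    proof -
      have "P z * P z * \<theta> z * of_real (gauss \<beta> z) = of_real (1 / G) * of_real (1 / G) * (bproj \<beta> N g z * bproj \<beta> N g z * \<theta> z * of_real (gauss \<beta> z))"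
        unfolding P_def by (simp only: mult_ac)
      also have "bproj \<beta> N g z * bproj \<beta> N g z * \<theta> z * of_real (gauss \<beta> z) = (\<Sum>m<N. \<Sum>l<N. of_real (\<beta> ^ m / fact m) * of_real (\<beta> ^ l / fact l) *
        (hmoment \<beta> m g z * hmoment \<beta> l g z * \<theta> z * of_real (gauss \<beta> z)))"
        unfolding bproj_def unfolding sum_product unfolding sum_distrib_right by (intro sum.cong refl) (simp only: mult_ac)
      finally show ?thesis .
    qed
    have iPP: "integrable lborel (\<lambda>z. P z * P z * \<theta> z * of_real (gauss \<beta> z))"
      unfolding sq by (intro Bochner_Integration.integrable_sum integrable_mult_right PP)
    have PP: "(LINT z|lborel. P z * P z * \<theta> z * of_real (gauss \<beta> z)) = 0"
      unfolding sq by (simp add: Bochner_Integration.integral_sum Bochner_Integration.integrable_sum PP PP0)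
    define E where "E = (\<lambda>z. (cmod (g z))\<^sup>2 * gauss \<beta> z + 2 * ((cmod (P z))\<^sup>2 * gauss \<beta> z)
        - 4 * Re (cnj (g z) * P z * of_real (gauss \<beta> z)) + 2 * Re (P z * P z * \<theta> z * of_real (gauss \<beta> z)))"
    have "E z \<ge> 0" for z
    proof -
      have ex: "(cmod (a - b - cnj e))\<^sup>2 = (cmod a)\<^sup>2 + (cmod b)\<^sup>2 + (cmod e)\<^sup>2 - 2 * Re (cnj a * b) - 2 * Re (a * e) + 2 * Re (b * e)" for a b e
        unfolding cmod_power2 by (simp add: algebra_simps power2_eq_square)
      have "0 \<le> (cmod (g z - P z - cnj (P z * \<theta> z)))\<^sup>2" by simp
      also have "\<dots> = (cmod (g z))\<^sup>2 + (cmod (P z))\<^sup>2 + (cmod (P z * \<theta> z))\<^sup>2 - 2 * Re (cnj (g z) * P z)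
          - 2 * Re (g z * (P z * \<theta> z)) + 2 * Re (P z * (P z * \<theta> z))" by (rule ex)
      also have "g z * (P z * \<theta> z) = cnj (g z) * P z" by (simp add: real mult_ac)
      also have "(cmod (P z * \<theta> z))\<^sup>2 \<le> (cmod (P z))\<^sup>2"
        unfolding norm_mult by (intro power_mono mult_left_le \<theta>1) auto
      finally have "0 \<le> (cmod (g z))\<^sup>2 + 2 * (cmod (P z))\<^sup>2 - 4 * Re (cnj (g z) * P z) + 2 * Re (P z * P z * \<theta> z)"
        by (simp add: mult_ac)
      then have "0 \<le> ((cmod (g z))\<^sup>2 + 2 * (cmod (P z))\<^sup>2 - 4 * Re (cnj (g z) * P z) + 2 * Re (P z * P z * \<theta> z)) * gauss \<beta> z"
        by (intro mult_nonneg_nonneg) (auto simp: gauss_def)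
      also have "\<dots> = E z" unfolding E_def by (simp add: algebra_simps)
      finally show ?thesis .
    qed
    then have "0 \<le> (LINT z|lborel. E z)" by (intro Bochner_Integration.integral_nonneg) auto
    also have "\<dots> = (LINT z|lborel. (cmod (g z))\<^sup>2 * gauss \<beta> z) + 2 * (LINT z|lborel. (cmod (P z))\<^sup>2 * gauss \<beta> z)
        - 4 * (LINT z|lborel. Re (cnj (g z) * P z * of_real (gauss \<beta> z))) + 2 * (LINT z|lborel. Re (P z * P z * \<theta> z * of_real (gauss \<beta> z)))"
      unfolding E_def
      by (subst Bochner_Integration.integral_add Bochner_Integration.integral_diff;
          (intro Bochner_Integration.integrable_add Bochner_Integration.integrable_diff integrable_mult_right integrable_Re ig iP igP iPP)?)+ simp
    also have "(LINT z|lborel. Re (cnj (g z) * P z * of_real (gauss \<beta> z))) = Q / G"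
      unfolding integral_Re[OF igP] gP Q_def
      by (simp only: times_complex.sel Re_complex_of_real Im_complex_of_real) simp
    also have "(LINT z|lborel. Re (P z * P z * \<theta> z * of_real (gauss \<beta> z))) = 0"
      using integral_Re[OF iPP] PP by simp
    finally have "0 \<le> (LINT z|lborel. (cmod (g z))\<^sup>2 * gauss \<beta> z) - 2 * (Q / G)"
      using nP by simp
    then show ?thesis unfolding Q_def[symmetric] using G by (simp add: field_simps)
  qed
  have "(\<lambda>N. 2 * Re (kform (bkernel \<beta> N) (weighted \<beta> g) (weighted \<beta> g))) \<longlonglongrightarrow> 2 * Re (kform (gkernel \<beta> 1) g g)"
    unfolding kform_gkernel_1 bkernel_def[abs_def]
    by (intro tendsto_intros kform_exp_partial_sums Cc_weighted g continuous_intros)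
  then show ?thesis unfolding G_def[symmetric]
    by (rule tendsto_upperbound) (use bound in auto)
qed

section \<open>The Vandermonde product\<close>

definition pairs :: "('n::{finite,linorder} \<times> 'n) set" where
  "pairs = {(j, k). j < k}"

definition vander :: "complex ^ 'n::{finite,linorder} \<Rightarrow> complex" where
  "vander z = (\<Prod>(j, k)\<in>pairs. z $ j - z $ k)"

definition perm_vec :: "('n \<Rightarrow> 'n) \<Rightarrow> complex ^ 'n::finite \<Rightarrow> (complex, 'n) vec" where
  "perm_vec \<sigma> z = (\<chi> k. z $ \<sigma> k)"

lemma perm_vec_compose: "perm_vec (\<sigma> \<circ> \<tau>) z = perm_vec \<tau> (perm_vec \<sigma> z)"
  by (simp add: perm_vec_def vec_eq_iff)

lemma perm_vec_id: "perm_vec id z = z"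
  by (simp add: perm_vec_def vec_eq_iff)

lemma norm_perm_vec: assumes "\<sigma> permutes (UNIV :: 'n::finite set)" shows "norm (perm_vec \<sigma> z) = norm (z :: (complex, 'n) vec)"
  unfolding norm_vec_def L2_set_def perm_vec_def
  by (simp, subst sum.permute[OF assms, of "\<lambda>k. (cmod (z $ k))\<^sup>2"]) (simp add: o_def)

lemma linear_perm_vec: "linear (perm_vec \<sigma>)"
  by (rule linearI) (auto simp: perm_vec_def vec_eq_iff)

lemma orthogonal_transformation_perm_vec: "\<sigma> permutes UNIV \<Longrightarrow> orthogonal_transformation (perm_vec \<sigma>)"
  unfolding orthogonal_transformation by (auto simp: linear_perm_vec norm_perm_vec)

lemma finite_pairs: "finite pairs" by (rule finite_subset[of _ UNIV]) auto

text \<open>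
  The product over the pairs other than \<open>(a,b)\<close> is invariant under the transposition of \<open>a\<close> and \<open>b\<close>
  up to a sign that does not depend on the point; at a point where only the coordinates \<open>a\<close> and \<open>b\<close>
  agree, the transposition changes nothing, so the sign is 1.
\<close>

lemma vander_transpose_less:
  fixes a b :: "'n::{finite,linorder}"
  assumes "a < b"
  shows "vander (perm_vec (Transposition.transpose a b) z) = - vander z"
proof -
  define \<tau> where "\<tau> = Transposition.transpose a b"
  have \<tau>\<tau>: "\<tau> (\<tau> k) = k" for k unfolding \<tau>_def by simp
  have inj: "\<tau> j = \<tau> k \<longleftrightarrow> j = k" for j k using \<tau>\<tau> by metis
  define S where "S = pairs - {(a, b)}"
  have fS: "finite S" unfolding S_def using finite_pairs by auto
  define \<phi> where "\<phi> = (\<lambda>(j, k). if \<tau> j < \<tau> k then (\<tau> j, \<tau> k) else (\<tau> k, \<tau> j))"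
  have \<phi>S: "\<phi> p \<in> S" if "p \<in> S" for p
  proof -
    obtain j k where p: "p = (j, k)" by force
    have jk: "j < k" "(j, k) \<noteq> (a, b)" using that p by (auto simp: S_def pairs_def)
    have ne: "\<tau> j \<noteq> \<tau> k" using jk inj by auto
    have "(\<tau> j, \<tau> k) \<noteq> (a, b)"
    proof
      assume "(\<tau> j, \<tau> k) = (a, b)"
      then have "\<tau> a = j" "\<tau> b = k" using \<tau>\<tau>[of j] \<tau>\<tau>[of k] by auto
      then have "j = b" "k = a" by (auto simp: \<tau>_def)
      then show False using jk assms by auto
    qed
    moreover have "(\<tau> k, \<tau> j) \<noteq> (a, b)"
    proof
      assume "(\<tau> k, \<tau> j) = (a, b)"
      then have "\<tau> a = k" "\<tau> b = j" using \<tau>\<tau>[of j] \<tau>\<tau>[of k] by auto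
      then have "k = b" "j = a" by (auto simp: \<tau>_def)
      then show False using jk by auto
    qed
    ultimately show ?thesis using ne by (auto simp: \<phi>_def p S_def pairs_def)
  qed
  have \<phi>\<phi>: "\<phi> (\<phi> p) = p" if "p \<in> S" for p
    using that by (auto simp: \<phi>_def S_def pairs_def \<tau>\<tau> split: prod.splits)
  define U where "U = (\<lambda>z :: (complex, 'n) vec. \<Prod>(j, k)\<in>S. z $ j - z $ k)"
  define e :: complex where "e = (\<Prod>(j, k)\<in>S. if \<tau> j < \<tau> k then 1 else - 1)"
  have U\<tau>: "U (perm_vec \<tau> z) = e * U z" for z
  proof -
    have "U (perm_vec \<tau> z) = (\<Prod>p\<in>S. (case p of (j, k) \<Rightarrow> if \<tau> j < \<tau> k then 1 else - 1) * (case \<phi> p of (j, k) \<Rightarrow> z $ j - z $ k))"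
      unfolding U_def perm_vec_def \<phi>_def by (intro prod.cong) auto
    also have "\<dots> = e * (\<Prod>p\<in>S. case \<phi> p of (j, k) \<Rightarrow> z $ j - z $ k)"
      unfolding e_def by (simp add: prod.distrib)
    also have "(\<Prod>p\<in>S. case \<phi> p of (j, k) \<Rightarrow> z $ j - z $ k) = U z"
      unfolding U_def by (rule prod.reindex_bij_witness[where i=\<phi> and j=\<phi>]) (auto simp: \<phi>S \<phi>\<phi>)
    finally show ?thesis .
  qed
  have "e = 1"
  proof -
    obtain f :: "'n \<Rightarrow> nat" where f: "inj f" using finite_imp_inj_to_nat_seg[of "UNIV :: 'n set"] by auto
    \<comment> \<open>Only the coordinates \<open>a\<close> and \<open>b\<close> agree at this point.\<close>
    define z0 :: "(complex, 'n) vec" where "z0 = (\<chi> k. of_nat (f (if k = b then a else k)))"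
    have "perm_vec \<tau> z0 = z0" by (auto simp: perm_vec_def z0_def vec_eq_iff \<tau>_def Transposition.transpose_def)
    moreover have "U z0 \<noteq> 0"
    proof -
      have "z0 $ j - z0 $ k \<noteq> 0" if "(j, k) \<in> S" for j k
        using that assms by (auto simp: z0_def S_def pairs_def inj_eq[OF f])
      then show ?thesis unfolding U_def using fS by (auto simp: prod_zero_iff)
    qed
    ultimately show ?thesis using U\<tau>[of z0] by simp
  qed
  moreover have v: "vander z = (z $ a - z $ b) * U z" for z
  proof -
    have "(a, b) \<in> pairs" using assms by (simp add: pairs_def)
    then show ?thesis unfolding vander_def U_def S_def by (subst prod.remove[OF finite_pairs]) auto
  qed
  ultimately have "vander (perm_vec \<tau> z) = (perm_vec \<tau> z $ a - perm_vec \<tau> z $ b) * U z" using U\<tau> by simp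
  then show ?thesis unfolding v \<tau>_def by (simp add: perm_vec_def algebra_simps)
qed

lemma vander_transpose:
  assumes "a \<noteq> b" shows "vander (perm_vec (Transposition.transpose a b) z) = - vander z"
  using assms vander_transpose_less[of a b z] vander_transpose_less[of b a z]
  by (cases "a < b") (auto simp: Transposition.transpose_commute)

lemma of_int_sign_square [simp]: "of_int (sign \<sigma>) * of_int (sign \<sigma>) = (1 :: complex)"
  by (metis of_int_1 of_int_mult sign_idempotent)

text \<open>
Permutations are products of transpositions, and both sides are multiplicative.
\<close>

lemma vander_perm_vec:
  fixes z :: "complex ^ 'n::{finite,linorder}"
  assumes "\<sigma> permutes UNIV"
  shows "vander (perm_vec \<sigma> z) = of_int (sign \<sigma>) * vander z"
proof -
  have "\<forall>z. vander (perm_vec \<sigma> z) = of_int (sign \<sigma>) * vander (z :: (complex, 'n) vec)"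
    using assms finite
  proof (induction \<sigma> rule: permutes_induct)
    case id then show ?case by (simp add: perm_vec_id[unfolded id_def] sign_id[unfolded id_def] id_def)
  next
    case (swap a b p)
    have "permutation p" using swap permutation_permutes by (metis finite)
    then have sg: "sign (Transposition.transpose a b \<circ> p) = - sign p"
      using sign_compose[OF permutation_swap_id, of p a b] swap(3) by (simp add: sign_swap_id)
    show ?case
    proof
      fix z :: "(complex, 'n) vec"
      have "vander (perm_vec (Transposition.transpose a b \<circ> p) z) = of_int (sign p) * vander (perm_vec (Transposition.transpose a b) z)"
        unfolding perm_vec_compose using swap by blast
      also have "\<dots> = of_int (- sign p) * vander z" by (simp add: vander_transpose[OF swap(3)])
      finally show "vander (perm_vec (Transposition.transpose a b \<circ> p) z) = of_int (sign (Transposition.transpose a b \<circ> p)) * vander z"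
        unfolding sg .
    qed
  qed
  then show ?thesis by blast
qed

lemma polyfun_vander: "polyfun vander"
proof -
  have "polyfun (\<lambda>z :: complex ^ 'n::{finite,linorder}. z $ j - z $ k)" for j k
    using polyfun_add[OF polyfun_coord polyfun_mult[OF polyfun_const[of "-1"] polyfun_coord], of j k] by simp
  then show ?thesis unfolding vander_def[abs_def] by (intro polyfun_prod finite_pairs) auto
qed

lemma vander_nonzero: "\<exists>z :: complex ^ 'n::{finite,linorder}. vander z \<noteq> 0"
proof -
  obtain f :: "'n \<Rightarrow> nat" where f: "inj f" using finite_imp_inj_to_nat_seg[of "UNIV :: 'n set"] by auto
  have "vander (\<chi> k. of_nat (f k)) \<noteq> 0"
    unfolding vander_def using finite_pairs by (auto simp: prod_zero_iff pairs_def inj_eq[OF f])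
  then show ?thesis by blast
qed

section \<open>Antisymmetric polynomials of low degree\<close>

definition monomial :: "('n::finite \<Rightarrow> nat) \<Rightarrow> (complex, 'n) vec \<Rightarrow> complex" where
  "monomial \<alpha> z = (\<Prod>k\<in>UNIV. z $ k ^ \<alpha> k)"

inductive hompoly :: "nat \<Rightarrow> (complex ^ 'n::finite \<Rightarrow> complex) \<Rightarrow> bool" where
  hompoly_monomial: "(\<Sum>k\<in>UNIV. \<alpha> k) = d \<Longrightarrow> hompoly d (monomial \<alpha>)"
| hompoly_add: "hompoly d u \<Longrightarrow> hompoly d v \<Longrightarrow> hompoly d (\<lambda>z. u z + v z)"
| hompoly_scale: "hompoly d u \<Longrightarrow> hompoly d (\<lambda>z. c * u z)"

lemma monomial_mult: "monomial \<alpha> z * monomial \<beta> z = monomial (\<lambda>k. \<alpha> k + \<beta> k) z"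
  unfolding monomial_def by (simp add: prod.distrib power_add)

lemma hompoly_mult:
  assumes "hompoly d u" "hompoly e v" shows "hompoly (d + e) (\<lambda>z. u z * v z)"
  using assms(1)
proof (induction rule: hompoly.induct)
  case (hompoly_monomial \<alpha> d)
  show ?case using assms(2) hompoly_monomial
  proof (induction rule: hompoly.induct)
    case (hompoly_monomial \<beta> e)
    then show ?case unfolding monomial_mult by (intro hompoly.intros) (simp add: sum.distrib)
  next
    case (hompoly_add e u v)
    then show ?case using hompoly.hompoly_add by (auto simp: distrib_left)
  next
    case (hompoly_scale e u c)
    have "hompoly (d + e) (\<lambda>z. c * (monomial \<alpha> z * u z))"
      using hompoly_scale by (intro hompoly.hompoly_scale) auto
    then show ?case by (simp add: mult_ac)
  qed
next
  case (hompoly_add d u w)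
  then show ?case using hompoly.hompoly_add[of "d + e" "\<lambda>z. u z * v z" "\<lambda>z. w z * v z"] by (simp add: distrib_right)
next
  case (hompoly_scale d u c)
  then show ?case using hompoly.hompoly_scale[of "d + e" "\<lambda>z. u z * v z" c] by (simp add: mult.assoc)
qed

lemma hompoly_one: "hompoly 0 (\<lambda>z. 1)"
  using hompoly_monomial[of "\<lambda>_. 0" 0] by (simp add: monomial_def[abs_def])

lemma hompoly_coord: "hompoly 1 (\<lambda>z. z $ k)"
proof -
  have "monomial (\<lambda>j. if j = k then 1 else 0) = (\<lambda>z. z $ k)"
    by (auto simp: monomial_def fun_eq_iff if_distrib[of "\<lambda>n. _ ^ n"] prod.delta cong: if_cong)
  then show ?thesis using hompoly_monomial[of "\<lambda>j. if j = k then 1 else 0" 1] by simp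
qed

lemma hompoly_zero: "hompoly d (\<lambda>z. 0)"
proof -
  have "hompoly d (monomial (\<lambda>j. if j = undefined then d else 0))" by (rule hompoly_monomial) simp
  from hompoly_scale[OF this, of 0] show ?thesis by simp
qed

lemma hompoly_sum: "finite I \<Longrightarrow> (\<And>i. i \<in> I \<Longrightarrow> hompoly d (u i)) \<Longrightarrow> hompoly d (\<lambda>z. \<Sum>i\<in>I. u i z)"
  by (induction I rule: finite_induct) (auto intro: hompoly_add hompoly_zero)

lemma hompoly_prod: "finite I \<Longrightarrow> (\<And>i. i \<in> I \<Longrightarrow> hompoly 1 (u i)) \<Longrightarrow> hompoly (card I) (\<lambda>z. \<Prod>i\<in>I. u i z)"
proof (induction I rule: finite_induct)
  case empty then show ?case by (simp add: hompoly_one)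
next
  case (insert i I)
  then have "hompoly (1 + card I) (\<lambda>z. u i z * (\<Prod>i\<in>I. u i z))" by (intro hompoly_mult) auto
  then show ?case using insert by simp
qed

lemma hompoly_power: "hompoly 1 u \<Longrightarrow> hompoly m (\<lambda>z. u z ^ m)"
proof (induction m)
  case 0 then show ?case by (simp add: hompoly_one)
next
  case (Suc m)
  then have "hompoly (1 + m) (\<lambda>z. u z * u z ^ m)" by (intro hompoly_mult) auto
  then show ?case by simp
qed

lemma hompoly_vander: "hompoly (card (pairs :: ('n::{finite,linorder} \<times> 'n) set)) (vander :: (complex, 'n) vec \<Rightarrow> complex)"
proof -
  have "hompoly 1 (\<lambda>z :: (complex, 'n) vec. z $ j - z $ k)" for j k
    using hompoly_add[OF hompoly_coord hompoly_scale[OF hompoly_coord, of "-1"], of j k] by simp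
  then show ?thesis unfolding vander_def[abs_def] by (intro hompoly_prod finite_pairs) auto
qed

lemma monomial_homogeneous: "monomial \<alpha> (c *s z) = c ^ (\<Sum>k\<in>UNIV. \<alpha> k) * monomial \<alpha> z"
  unfolding monomial_def by (simp add: power_mult_distrib prod.distrib power_sum)

lemma hompoly_homogeneous: "hompoly d u \<Longrightarrow> u (c *s z) = c ^ d * u z"
  by (induction rule: hompoly.induct) (auto simp: monomial_homogeneous algebra_simps)

lemma continuous_hompoly: "hompoly d u \<Longrightarrow> continuous_on UNIV u"
  by (induction rule: hompoly.induct) (auto intro!: continuous_intros simp: monomial_def[abs_def])

text \<open>
Induction on the cardinality, removing the largest element, which is at least the cardinality minus one.
\<close>

lemma sum_finite_nat_set_ge:
  fixes A :: "nat set"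
  assumes "finite A"
  shows "(\<Sum>i<card A. i) \<le> \<Sum>A" and "\<Sum>A = (\<Sum>i<card A. i) \<Longrightarrow> A = {..<card A}"
proof -
  have "(\<Sum>i<card A. i) \<le> \<Sum>A \<and> (\<Sum>A = (\<Sum>i<card A. i) \<longrightarrow> A = {..<card A})" using assms
  proof (induction "card A" arbitrary: A)
    case 0 then show ?case by auto
  next
    case (Suc n)
    have cA: "card A = Suc n" and fA: "finite A" using Suc(2,3) by auto
    have eq: "(\<Sum>i<Suc n. i) = (\<Sum>i<n. i) + n" by (rule sum.lessThan_Suc)
    define m where "m = Max A"
    have mA: "m \<in> A" unfolding m_def by (rule Max_in[OF fA]) (use cA in force)
    have sub: "A \<subseteq> {..m}" unfolding m_def using Max_ge[OF fA] by blast
    then have "card A \<le> card {..m}" by (intro card_mono) simp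
    then have mn: "n \<le> m" using cA by simp
    let ?B = "A - {m}"
    have cB: "card ?B = n" using card_Diff_singleton[OF mA] cA by simp
    have IH: "(\<Sum>i<n. i) \<le> \<Sum>?B" "\<Sum>?B = (\<Sum>i<n. i) \<longrightarrow> ?B = {..<n}"
      using Suc(1)[of ?B] fA unfolding cB by blast+
    have s: "\<Sum>A = m + \<Sum>?B" by (rule sum.remove[OF fA mA])
    have "A = {..<Suc n}" if "\<Sum>A = (\<Sum>i<Suc n. i)"
    proof -
      have mn': "m = n" using that s IH(1) mn unfolding eq by linarith
      have "\<Sum>?B = (\<Sum>i<n. i)" using that s mn' unfolding eq by linarith
      then have "?B = {..<n}" using IH(2) by blast
      then have "A = insert n {..<n}" using mA mn' by blast
      then show ?thesis by (simp only: lessThan_Suc)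
    qed
    moreover have "(\<Sum>i<Suc n. i) \<le> \<Sum>A" using s IH(1) mn unfolding eq by linarith
    ultimately show ?case unfolding cA by blast
  qed
  then show "(\<Sum>i<card A. i) \<le> \<Sum>A" "\<Sum>A = (\<Sum>i<card A. i) \<Longrightarrow> A = {..<card A}" by blast+
qed

text \<open>
The square of the index set splits into the pairs, their mirror images and the diagonal.
\<close>

lemma card_pairs: "card (pairs :: ('n::{finite,linorder} \<times> 'n) set) = (\<Sum>i<CARD('n). i)"
proof -
  let ?P = "pairs :: ('n \<times> 'n) set"
  let ?D = "range (\<lambda>k::'n. (k, k))"
  have u: "(UNIV :: ('n \<times> 'n) set) = ?P \<union> prod.swap ` ?P \<union> ?D"
  proof (rule set_eqI)
    fix p :: "'n \<times> 'n"
    obtain j k where p: "p = (j, k)" by force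
    consider "j < k" | "k < j" | "j = k" by (rule linorder_cases)
    then show "p \<in> UNIV \<longleftrightarrow> p \<in> ?P \<union> prod.swap ` ?P \<union> ?D"
      by cases (auto simp: p pairs_def image_iff)
  qed
  have cD: "card ?D = CARD('n)" by (rule card_image) (auto intro: injI)
  have cS: "card (prod.swap ` ?P) = card ?P" by (rule card_image) (auto intro: inj_onI)
  have d1: "?P \<inter> prod.swap ` ?P = {}" and d2: "(?P \<union> prod.swap ` ?P) \<inter> ?D = {}"
    by (auto simp: pairs_def)
  have f: "finite ?P" "finite (prod.swap ` ?P)" "finite ?D" by simp_all
  have "CARD('n \<times> 'n) = card (?P \<union> prod.swap ` ?P) + card ?D"
    unfolding u by (rule card_Un_disjoint[OF _ f(3) d2]) (use f in blast)
  also have "card (?P \<union> prod.swap ` ?P) = card ?P + card ?P"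
    using card_Un_disjoint[OF f(1,2) d1] cS by simp
  finally have "CARD('n) * CARD('n) = 2 * card ?P + CARD('n)" unfolding cD by simp
  moreover have "n * n = 2 * (\<Sum>i<n. i) + n" for n :: nat by (induction n) auto
  from this[of "CARD('n)"] have "CARD('n) * CARD('n) = 2 * (\<Sum>i<CARD('n). i) + CARD('n)" .
  ultimately show ?thesis by linarith
qed

lemma injective_degree:
  fixes \<alpha> :: "'n::{finite,linorder} \<Rightarrow> nat"
  assumes "inj \<alpha>" "(\<Sum>k\<in>UNIV. \<alpha> k) \<le> card (pairs :: ('n \<times> 'n) set)"
  shows "(\<Sum>k\<in>UNIV. \<alpha> k) = card (pairs :: ('n \<times> 'n) set)" "range \<alpha> = {..<CARD('n)}"
proof -
  have c: "card (range \<alpha>) = CARD('n)" using assms(1) by (simp add: card_image)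
  have s: "\<Sum>(range \<alpha>) = (\<Sum>k\<in>UNIV. \<alpha> k)" using assms(1) by (simp add: sum.reindex)
  show 1: "(\<Sum>k\<in>UNIV. \<alpha> k) = card (pairs :: ('n \<times> 'n) set)"
    using sum_finite_nat_set_ge(1)[of "range \<alpha>"] assms(2) unfolding c s card_pairs by simp
  show "range \<alpha> = {..<CARD('n)}"
    using sum_finite_nat_set_ge(2)[of "range \<alpha>"] 1 unfolding c s card_pairs by simp
qed

definition antisymm :: "(complex ^ 'n::finite \<Rightarrow> complex) \<Rightarrow> (complex, 'n) vec \<Rightarrow> complex" where
  "antisymm u z = (\<Sum>\<sigma> | \<sigma> permutes UNIV. of_int (sign \<sigma>) * u (perm_vec \<sigma> z))"

lemma antisymm_perm_vec:
  fixes z :: "complex ^ 'n::finite"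
  assumes "\<rho> permutes UNIV"
  shows "antisymm (\<lambda>z. u (perm_vec \<rho> z)) z = of_int (sign \<rho>) * antisymm u z"
proof -
  have "antisymm u z = (\<Sum>\<sigma> | \<sigma> permutes UNIV. of_int (sign (\<sigma> \<circ> \<rho>)) * u (perm_vec (\<sigma> \<circ> \<rho>) z))"
    unfolding antisymm_def by (rule sum_permutations_compose_right[OF assms])
  also have "\<dots> = (\<Sum>\<sigma> | \<sigma> permutes UNIV. of_int (sign \<rho>) * (of_int (sign \<sigma>) * u (perm_vec \<rho> (perm_vec \<sigma> z))))"
  proof (rule sum.cong)
    fix \<sigma> :: "'n \<Rightarrow> 'n" assume "\<sigma> \<in> {\<sigma>. \<sigma> permutes UNIV}"
    then have "sign (\<sigma> \<circ> \<rho>) = sign \<sigma> * sign \<rho>"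
      using assms by (intro sign_compose) (auto simp: permutation_permutes)
    then show "of_int (sign (\<sigma> \<circ> \<rho>)) * u (perm_vec (\<sigma> \<circ> \<rho>) z) = of_int (sign \<rho>) * (of_int (sign \<sigma>) * u (perm_vec \<rho> (perm_vec \<sigma> z)))"
      by (simp add: perm_vec_compose)
  qed simp
  also have "\<dots> = of_int (sign \<rho>) * antisymm (\<lambda>z. u (perm_vec \<rho> z)) z"
    unfolding antisymm_def by (simp add: sum_distrib_left)
  finally have "of_int (sign \<rho>) * antisymm u z = of_int (sign \<rho> * sign \<rho>) * antisymm (\<lambda>z. u (perm_vec \<rho> z)) z" by simp
  then show ?thesis by (simp add: sign_idempotent)
qed

lemma antisymm_noninjective:
  assumes "a \<noteq> b" "\<alpha> a = \<alpha> b" shows "antisymm (monomial \<alpha>) z = 0"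
proof -
  let ?\<tau> = "Transposition.transpose a b"
  have "monomial \<alpha> (perm_vec ?\<tau> z) = monomial \<alpha> z" for z
  proof -
    have "monomial \<alpha> z = (\<Prod>k\<in>UNIV. z $ ?\<tau> k ^ \<alpha> (?\<tau> k))"
      unfolding monomial_def using prod.permute[OF permutes_swap_id[of a UNIV b], of "\<lambda>k. z $ k ^ \<alpha> k"] by (simp add: o_def)
    also have "\<dots> = monomial \<alpha> (perm_vec ?\<tau> z)"
      unfolding monomial_def perm_vec_def using assms by (intro prod.cong) (auto simp: Transposition.transpose_def)
    finally show ?thesis ..
  qed
  then have "antisymm (monomial \<alpha>) z = of_int (sign ?\<tau>) * antisymm (monomial \<alpha>) z"
    using antisymm_perm_vec[OF permutes_swap_id[of a UNIV b], of "monomial \<alpha>" z] by simp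
  then show ?thesis using assms(1) by (simp add: sign_swap_id)
qed

text \<open>
Antisymmetrization kills monomials with a repeated exponent. In the degree of the Vandermonde product the other monomials have
the exponents \<open>0, \<dots>, n - 1\<close> in some order, so their antisymmetrizations agree up to sign, and the
antisymmetric polynomials of this degree form a line.
\<close>

lemma antisymm_hompoly:
  fixes \<alpha> :: "'n::{finite,linorder} \<Rightarrow> nat"
  assumes "inj \<alpha>" "(\<Sum>k\<in>UNIV. \<alpha> k) = card (pairs :: ('n \<times> 'n) set)" and "hompoly d u" "d = card (pairs :: ('n \<times> 'n) set)"
  shows "\<exists>c. \<forall>z. antisymm u z = c * antisymm (monomial \<alpha>) z"
  using assms(3,4)
proof (induction rule: hompoly.induct)
  case (hompoly_monomial \<beta> d)
  show ?case
  proof (cases "inj \<beta>")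
    case False
    then obtain a b where "a \<noteq> b" "\<beta> a = \<beta> b" unfolding inj_def by blast
    then show ?thesis using antisymm_noninjective by (intro exI[of _ 0]) auto
  next
    case True
    have r: "range \<beta> = range \<alpha>"
      using injective_degree(2)[OF True] injective_degree(2)[OF assms(1)] assms(2) hompoly_monomial by simp
    define \<sigma> where "\<sigma> = (\<lambda>k. inv \<beta> (\<alpha> k))"
    have \<beta>\<sigma>: "\<beta> (\<sigma> k) = \<alpha> k" for k unfolding \<sigma>_def using r by (simp add: f_inv_into_f)
    have "inj \<sigma>" by (rule injI) (metis \<beta>\<sigma> assms(1) injD)
    then have p: "\<sigma> permutes UNIV" by (intro bij_imp_permutes) (auto simp: bij_betw_def finite_UNIV_inj_surj)
    have "monomial \<beta> z = monomial \<alpha> (perm_vec \<sigma> z)" for z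
      unfolding monomial_def using prod.permute[OF p, of "\<lambda>k. z $ k ^ \<beta> k"] by (simp add: o_def \<beta>\<sigma> perm_vec_def)
    then have "monomial \<beta> = (\<lambda>z. monomial \<alpha> (perm_vec \<sigma> z))" by auto
    then show ?thesis using antisymm_perm_vec[OF p, of "monomial \<alpha>"] by auto
  qed
next
  case (hompoly_add d u v)
  then obtain c e where "\<forall>z. antisymm u z = c * antisymm (monomial \<alpha>) z" "\<forall>z. antisymm v z = e * antisymm (monomial \<alpha>) z" by blast
  moreover have "antisymm (\<lambda>z. u z + v z) z = antisymm u z + antisymm v z" for z
    unfolding antisymm_def by (simp add: distrib_left sum.distrib)
  ultimately show ?case by (intro exI[of _ "c + e"]) (simp add: distrib_right)
next
  case (hompoly_scale d u c)
  then obtain e where "\<forall>z. antisymm u z = e * antisymm (monomial \<alpha>) z" by blast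
  moreover have "antisymm (\<lambda>z. c * u z) z = c * antisymm u z" for z
    unfolding antisymm_def by (simp add: sum_distrib_left mult_ac)
  ultimately show ?case by (intro exI[of _ "c * e"]) simp
qed

lemma antisymm_vander: "antisymm vander z = of_nat (fact CARD('n)) * vander (z :: complex ^ 'n::{finite,linorder})"
proof -
  have "antisymm vander z = (\<Sum>\<sigma> | \<sigma> permutes (UNIV :: 'n set). vander z)"
    unfolding antisymm_def
  proof (rule sum.cong)
    fix \<sigma> :: "'n \<Rightarrow> 'n" assume "\<sigma> \<in> {\<sigma>. \<sigma> permutes UNIV}"
    then have "vander (perm_vec \<sigma> z) = of_int (sign \<sigma>) * vander z" by (intro vander_perm_vec) auto
    then have "of_int (sign \<sigma>) * vander (perm_vec \<sigma> z) = of_int (sign \<sigma> * sign \<sigma>) * vander z" by simp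
    then show "of_int (sign \<sigma>) * vander (perm_vec \<sigma> z) = vander z" by (simp add: sign_idempotent)
  qed simp
  also have "\<dots> = of_nat (card {\<sigma>. \<sigma> permutes (UNIV :: 'n set)}) * vander z" by simp
  also have "card {\<sigma>. \<sigma> permutes (UNIV :: 'n set)} = fact CARD('n)" by (rule card_permutations) auto
  finally show ?thesis by simp
qed

definition pairing :: "real \<Rightarrow> (complex ^ 'n::finite \<Rightarrow> complex) \<Rightarrow> ((complex, 'n) vec \<Rightarrow> complex) \<Rightarrow> complex" where
  "pairing \<beta> g u = (LINT z|lborel. g z * of_real (gauss \<beta> z) * cnj (u z))"

lemma pairing_integrable:
  "Cc g \<Longrightarrow> continuous_on UNIV u \<Longrightarrow> integrable lborel (\<lambda>z. g z * of_real (gauss \<beta> z) * cnj (u z))"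
  by (intro Cc_integrable Cc_mult_right continuous_intros continuous_gauss)

lemma pairing_perm_vec:
  assumes "Cc g" "continuous_on UNIV u" "\<sigma> permutes UNIV" "\<And>z. g (perm_vec \<sigma> z) = of_int (sign \<sigma>) * g z"
  shows "pairing \<beta> g (\<lambda>z. u (perm_vec \<sigma> z)) = of_int (sign \<sigma>) * pairing \<beta> g u"
proof -
  have "pairing \<beta> g u = (LINT z|lborel. g (perm_vec \<sigma> z) * of_real (gauss \<beta> (perm_vec \<sigma> z)) * cnj (u (perm_vec \<sigma> z)))"
    unfolding pairing_def
    by (rule integral_orthogonal_transformation[OF orthogonal_transformation_perm_vec[OF assms(3)], symmetric])
       (use pairing_integrable[OF assms(1,2)] in auto)
  also have "\<dots> = (LINT z|lborel. of_int (sign \<sigma>) * (g z * of_real (gauss \<beta> z) * cnj (u (perm_vec \<sigma> z))))"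
    by (simp add: assms(4) gauss_def norm_perm_vec[OF assms(3)] mult_ac)
  also have "\<dots> = of_int (sign \<sigma>) * pairing \<beta> g (\<lambda>z. u (perm_vec \<sigma> z))"
    unfolding pairing_def by (rule integral_mult_right_zero)
  finally have "of_int (sign \<sigma>) * pairing \<beta> g u = of_int (sign \<sigma> * sign \<sigma>) * pairing \<beta> g (\<lambda>z. u (perm_vec \<sigma> z))" by simp
  then show ?thesis by (simp add: sign_idempotent)
qed

lemma pairing_scale: "pairing \<beta> g (\<lambda>z. c * u z) = cnj c * pairing \<beta> g u"
  unfolding pairing_def by (subst integral_mult_right_zero[symmetric]) (simp add: mult_ac)

lemma pairing_add:
  assumes "Cc g" "continuous_on UNIV u" "continuous_on UNIV v"
  shows "pairing \<beta> g (\<lambda>z. u z + v z) = pairing \<beta> g u + pairing \<beta> g v"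
  unfolding pairing_def
  by (subst Bochner_Integration.integral_add[symmetric]) (auto intro!: pairing_integrable assms simp: distrib_left)

lemma pairing_antisymm:
  fixes g :: "complex ^ 'n::finite \<Rightarrow> complex"
  assumes "Cc g" "continuous_on UNIV u" and anti: "\<And>\<sigma> z. \<sigma> permutes UNIV \<Longrightarrow> g (perm_vec \<sigma> z) = of_int (sign \<sigma>) * g z"
  shows "pairing \<beta> g (antisymm u) = of_nat (fact CARD('n)) * pairing \<beta> g u"
proof -
  have cpm: "continuous_on UNIV (\<lambda>z. u (perm_vec \<sigma> z))" for \<sigma>
    by (rule continuous_on_compose2[OF assms(2)]) (auto intro!: linear_continuous_on linear_perm_vec simp: linear_conv_bounded_linear[symmetric])
  have "pairing \<beta> g (antisymm u) = (LINT z|lborel. (\<Sum>\<sigma> | \<sigma> permutes UNIV. of_int (sign \<sigma>) * (g z * of_real (gauss \<beta> z) * cnj (u (perm_vec \<sigma> z)))))"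
    unfolding pairing_def antisymm_def by (rule Bochner_Integration.integral_cong) (auto simp: sum_distrib_left mult_ac)
  also have "\<dots> = (\<Sum>\<sigma> | \<sigma> permutes UNIV. of_int (sign \<sigma>) * pairing \<beta> g (\<lambda>z. u (perm_vec \<sigma> z)))"
    unfolding pairing_def
    by (subst Bochner_Integration.integral_sum) (auto intro!: integrable_mult_right pairing_integrable assms cpm)
  also have "\<dots> = (\<Sum>\<sigma> | \<sigma> permutes (UNIV :: 'n set). pairing \<beta> g u)"
  proof (rule sum.cong)
    fix \<sigma> :: "'n \<Rightarrow> 'n" assume "\<sigma> \<in> {\<sigma>. \<sigma> permutes UNIV}"
    then have p: "\<sigma> permutes UNIV" by simp
    have "of_int (sign \<sigma>) * pairing \<beta> g (\<lambda>z. u (perm_vec \<sigma> z)) = of_int (sign \<sigma> * sign \<sigma>) * pairing \<beta> g u"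
      using pairing_perm_vec[OF assms(1,2) p anti[OF p]] by simp
    then show "of_int (sign \<sigma>) * pairing \<beta> g (\<lambda>z. u (perm_vec \<sigma> z)) = pairing \<beta> g u" by (simp add: sign_idempotent)
  qed simp
  also have "\<dots> = of_nat (card {\<sigma>. \<sigma> permutes (UNIV :: 'n set)}) * pairing \<beta> g u" by simp
  also have "card {\<sigma>. \<sigma> permutes (UNIV :: 'n set)} = fact CARD('n)" by (rule card_permutations) auto
  finally show ?thesis by simp
qed

text \<open>
  Pairing with an antisymmetric function only sees the antisymmetrization of a monomial. In degree at most that of the
  Vandermonde product this is zero or proportional to the Vandermonde product, to which \<open>g\<close> is orthogonal.
\<close>

lemma pairing_hompoly_eq_0:
  fixes g :: "complex ^ 'n::{finite,linorder} \<Rightarrow> complex"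
  assumes g: "Cc g" and anti: "\<And>\<sigma> z. \<sigma> permutes UNIV \<Longrightarrow> g (perm_vec \<sigma> z) = of_int (sign \<sigma>) * g z"
    and V: "pairing \<beta> g vander = 0" and "hompoly d u" "d \<le> card (pairs :: ('n \<times> 'n) set)"
  shows "pairing \<beta> g u = 0"
  using assms(4,5)
proof (induction rule: hompoly.induct)
  case (hompoly_monomial \<alpha> d)
  have cm: "continuous_on UNIV (monomial \<alpha>)" using continuous_hompoly[OF hompoly.hompoly_monomial[OF refl]] .
  have "pairing \<beta> g (antisymm (monomial \<alpha>)) = 0"
  proof (cases "inj \<alpha>")
    case False
    then obtain a b where "a \<noteq> b" "\<alpha> a = \<alpha> b" unfolding inj_def by blast
    then have "antisymm (monomial \<alpha>) = (\<lambda>z. 0)" using antisymm_noninjective by blast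
    then show ?thesis by (simp add: pairing_def)
  next
    case True
    have deg: "(\<Sum>k\<in>UNIV. \<alpha> k) = card (pairs :: ('n \<times> 'n) set)"
      using injective_degree(1)[OF True] hompoly_monomial by simp
    obtain c where c: "\<And>z. antisymm vander z = c * antisymm (monomial \<alpha>) (z :: (complex, 'n) vec)"
      using antisymm_hompoly[OF True deg hompoly_vander refl] by blast
    have "c \<noteq> 0" 
    proof
      assume "c = 0"
      obtain z :: "(complex, 'n) vec" where z: "vander z \<noteq> 0" using vander_nonzero by blast
      have "of_nat (fact CARD('n)) * vander z = 0" using c[of z] \<open>c = 0\<close> by (simp only: antisymm_vander mult_zero_left)
      then show False using z by simp
    qed
    have "pairing \<beta> g (antisymm vander) = cnj c * pairing \<beta> g (antisymm (monomial \<alpha>))"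
    proof -
      have "antisymm vander = (\<lambda>z. c * antisymm (monomial \<alpha>) z)" by (rule ext) (rule c)
      then show ?thesis by (simp only: pairing_scale)
    qed
    moreover have "pairing \<beta> g (antisymm vander) = 0"
      using pairing_antisymm[OF g continuous_hompoly[OF hompoly_vander] anti] V by simp
    ultimately show ?thesis using \<open>c \<noteq> 0\<close> by simp
  qed
  then show ?case using pairing_antisymm[OF g cm anti] by simp
next
  case (hompoly_add d u v)
  then show ?case by (simp add: pairing_add[OF g] continuous_hompoly)
next
  case (hompoly_scale d u c)
  then show ?case by (simp add: pairing_scale)
qed

text \<open>
As a function of \<open>w\<close>, the power \<open>hdot z w ^ m\<close> is the conjugate of a homogeneous polynomial of degree \<open>m\<close>.
\<close>

lemma hmoment_eq_0:
  fixes g :: "complex ^ 'n::{finite,linorder} \<Rightarrow> complex"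
  assumes g: "Cc g" and anti: "\<And>\<sigma> z. \<sigma> permutes UNIV \<Longrightarrow> g (perm_vec \<sigma> z) = of_int (sign \<sigma>) * g z"
    and V: "pairing \<beta> g vander = 0" and m: "m \<le> card (pairs :: ('n \<times> 'n) set)"
  shows "hmoment \<beta> m g z = 0"
proof -
  have "hompoly 1 (\<lambda>w. \<Sum>k\<in>UNIV. cnj (z $ k) * w $ k)"
    by (intro hompoly_sum hompoly_scale hompoly_coord) auto
  from hompoly_power[OF this, of m] have "pairing \<beta> g (\<lambda>w. (\<Sum>k\<in>UNIV. cnj (z $ k) * w $ k) ^ m) = 0"
    by (intro pairing_hompoly_eq_0[OF g _ V _ m]) (simp_all add: anti)
  then show ?thesis by (simp add: pairing_def hmoment_def hdot_def)
qed

section \<open>The inequality for symmetric test functions\<close>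

lemma gauss_measurable [measurable]: "gauss \<beta> \<in> borel_measurable borel"
  by (intro borel_measurable_continuous_onI continuous_gauss)

lemma vander_homogeneous: "vander (c *s z) = c ^ card (pairs :: ('n \<times> 'n) set) * vander (z :: complex ^ 'n::{finite,linorder})"
  by (rule hompoly_homogeneous[OF hompoly_vander])

lemma dbar_of_real_times_polyfun:
  assumes "times_cont_diff 1 \<psi>" "polyfun V"
  shows "dbar k (\<lambda>z. of_real (\<psi> z) * V z) z = 
    V z * (of_real (frechet_derivative \<psi> (at z) (axis k 1)) + \<i> * of_real (frechet_derivative \<psi> (at z) (axis k \<i>))) / 2"
proof -
  have t: "times_cont_diff (Suc 0) \<psi>" using assms(1) by simp
  have "dbar k (\<lambda>z. of_real (\<psi> z) * V z) z = dbar k (\<lambda>z. of_real (\<psi> z)) z * V z"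
    by (simp add: dbar_mult[OF C1_of_real(1)[OF t] polyfun_C1[OF assms(2)]] polyfun_dbar[OF assms(2)])
  then show ?thesis unfolding dbar_def C1_of_real(2)[OF t] by simp
qed

text \<open>
With \<open>g = \<psi> V\<close>, the spectral gap and the Bessel inequality together give \<open>\<parallel>g\<parallel>\<^sup>2 \<le> (2 / \<beta>) \<parallel>dbar g\<parallel>\<^sup>2\<close>. The Wirtinger
derivative of a real function is half of a real gradient component plus \<open>\<i>\<close> times the other one, which contributes the factor \<open>1/4\<close>.
\<close>

theorem poincare_symmetric_test:
  fixes \<psi> :: "complex ^ 'n::{finite,linorder} \<Rightarrow> real"
  assumes t2: "times_cont_diff 2 \<psi>" and bs: "bdd_supp \<psi>" and sym: "symmetric_fun \<psi>" and \<beta>: "\<beta> > 0"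
    and mean: "(LINT z|lborel. \<psi> z * ((cmod (vander z))\<^sup>2 * gauss \<beta> z)) = 0"
  shows "(LINT z|lborel. (\<psi> z)\<^sup>2 * ((cmod (vander z))\<^sup>2 * gauss \<beta> z))
    \<le> 1 / (2 * \<beta>) * (\<Sum>k\<in>UNIV. LINT z|lborel. ((frechet_derivative \<psi> (at z) (axis k 1))\<^sup>2 + (frechet_derivative \<psi> (at z) (axis k \<i>))\<^sup>2)
         * ((cmod (vander z))\<^sup>2 * gauss \<beta> z))"
proof -
  define G where "G = gmass \<beta> TYPE('n)"
  have G: "G > 0" unfolding G_def by (rule gmass_pos[OF \<beta>])
  let ?V = "vander :: complex ^ 'n::{finite,linorder} \<Rightarrow> complex"
  let ?D = "card (pairs :: ('n \<times> 'n) set)"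
  have t1: "times_cont_diff 1 \<psi>" using times_cont_diff_Suc[of 1 \<psi>] t2 by (simp add: numeral_2_eq_2)
  have t1': "times_cont_diff (Suc 0) \<psi>" using t1 by simp
  define g where "g = (\<lambda>z. of_real (\<psi> z) * ?V z)"
  have C1g: "C1 g" unfolding g_def by (intro C1_mult C1_of_real(1)[OF t1'] polyfun_C1 polyfun_vander)
  have bg: "bdd_supp g"
    using bs unfolding g_def bdd_supp_def by fastforce
  note cg = C1_Cc[OF C1g bg]
  have td: "times_cont_diff (Suc 0) (\<lambda>z. frechet_derivative \<psi> (at z) v)" for v
    using times_cont_diff_deriv[of "Suc 0" \<psi> v] t2 by (simp only: numeral_2_eq_2)
  have dg: "dbar k g = (\<lambda>z. ?V z * ((of_real (frechet_derivative \<psi> (at z) (axis k 1)) + \<i> * of_real (frechet_derivative \<psi> (at z) (axis k \<i>))) * (1/2)))" for k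
    unfolding g_def using dbar_of_real_times_polyfun[OF t1 polyfun_vander] by (simp add: fun_eq_iff)
  have C1d: "C1 (dbar k g)" for k
    unfolding dg by (intro C1_mult C1_add C1_const C1_of_real(1)[OF td] polyfun_C1 polyfun_vander)
  have gap: "G * (LINT z|lborel. (cmod (g z))\<^sup>2 * gauss \<beta> z) - Re (kform (gkernel \<beta> 1) g g)
    \<le> G / \<beta> * (\<Sum>k\<in>UNIV. LINT z|lborel. (cmod (dbar k g z))\<^sup>2 * gauss \<beta> z)"
    unfolding G_def by (rule landau_spectral_gap[OF C1g bg \<beta> C1d])
  have anti: "g (perm_vec \<sigma> z) = of_int (sign \<sigma>) * g z" if "\<sigma> permutes UNIV" for \<sigma> z
  proof -
    have "\<psi> (perm_vec \<sigma> z) = \<psi> z" using sym that unfolding symmetric_fun_def perm_vec_def by blast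
    then show ?thesis unfolding g_def by (simp add: vander_perm_vec[OF that])
  qed
  have orth: "pairing \<beta> g ?V = 0"
  proof -
    have "pairing \<beta> g ?V = (LINT z|lborel. complex_of_real (\<psi> z * ((cmod (?V z))\<^sup>2 * gauss \<beta> z)))"
      unfolding pairing_def g_def
      by (rule Bochner_Integration.integral_cong) (simp_all only: of_real_mult complex_norm_square mult_ac)
    then show ?thesis by (simp only: integral_complex_of_real mean of_real_0)
  qed
  define \<theta> where "\<theta> = (\<lambda>z. cnj (?V z) / ?V z)"
  have [measurable]: "?V \<in> borel_measurable borel" by (rule polyfun_measurable[OF polyfun_vander])
  have "2 * Re (kform (gkernel \<beta> 1) g g) \<le> G * (LINT z|lborel. (cmod (g z))\<^sup>2 * gauss \<beta> z)"
    unfolding G_def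
  proof (rule bessel_with_conjugation[OF cg \<beta>, where \<theta>=\<theta> and D="?D"])
    show "\<theta> \<in> borel_measurable borel"
    proof -
      have "(\<lambda>z. cnj (?V z)) \<in> borel_measurable borel"
        by (intro borel_measurable_continuous_onI continuous_intros C1_continuous polyfun_C1 polyfun_vander)
      then show ?thesis unfolding \<theta>_def by measurable
    qed
    show "cmod (\<theta> z) \<le> 1" for z unfolding \<theta>_def by (simp add: norm_divide)
    show "cnj (g z) = g z * \<theta> z" for z unfolding g_def \<theta>_def by simp
    show "hmoment \<beta> m g z = 0" if "m \<le> ?D" for m z
      by (rule hmoment_eq_0[OF cg anti orth that])
    fix c :: complex and z :: "complex ^ 'n::{finite,linorder}" assume c: "cmod c = 1"
    then have cc: "c * cnj c = 1" by (simp add: complex_norm_square[symmetric])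
    then have c0: "c \<noteq> 0" by auto
    have "c ^ (2 * ?D) * \<theta> (c *s z) = c ^ (2 * ?D) * (cnj c ^ ?D * cnj (?V z) / (c ^ ?D * ?V z))"
      unfolding \<theta>_def vander_homogeneous by simp
    also have "\<dots> = (c * cnj c) ^ ?D * (cnj (?V z) / ?V z)"
      using c0 by (simp add: power_mult_distrib mult_2 power_add)
    finally show "c ^ (2 * ?D) * \<theta> (c *s z) = \<theta> z" by (simp add: cc \<theta>_def)
  qed
  with gap have "G * (LINT z|lborel. (cmod (g z))\<^sup>2 * gauss \<beta> z)
    \<le> 2 * (G / \<beta> * (\<Sum>k\<in>UNIV. LINT z|lborel. (cmod (dbar k g z))\<^sup>2 * gauss \<beta> z))" by linarith
  also have "\<dots> = G * (2 / \<beta> * (\<Sum>k\<in>UNIV. LINT z|lborel. (cmod (dbar k g z))\<^sup>2 * gauss \<beta> z))" by simp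
  finally have "(LINT z|lborel. (cmod (g z))\<^sup>2 * gauss \<beta> z) \<le> 2 / \<beta> * (\<Sum>k\<in>UNIV. LINT z|lborel. (cmod (dbar k g z))\<^sup>2 * gauss \<beta> z)"
    using G by (simp only: mult_le_cancel_left_pos)
  also have "(\<Sum>k\<in>UNIV. LINT z|lborel. (cmod (dbar k g z))\<^sup>2 * gauss \<beta> z) = 
     (\<Sum>k\<in>UNIV. (1 / 4) * (LINT z|lborel. ((frechet_derivative \<psi> (at z) (axis k 1))\<^sup>2 + (frechet_derivative \<psi> (at z) (axis k \<i>))\<^sup>2)
         * ((cmod (vander z))\<^sup>2 * gauss \<beta> z)))"
  proof (intro sum.cong refl)
    fix k :: 'n
    have "(cmod (dbar k g z))\<^sup>2 * gauss \<beta> z = (1 / 4) * (((frechet_derivative \<psi> (at z) (axis k 1))\<^sup>2 + (frechet_derivative \<psi> (at z) (axis k \<i>))\<^sup>2)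
         * ((cmod (vander z))\<^sup>2 * gauss \<beta> z))" for z
    proof -
      have "(cmod ((of_real x + \<i> * of_real y) * (1/2)))\<^sup>2 = (1 / 4) * (x\<^sup>2 + y\<^sup>2)" for x y
        unfolding cmod_power2 by (simp add: power_divide field_simps)
      then show ?thesis unfolding dg norm_mult[of "?V z"] power_mult_distrib by (simp only: mult_ac)
    qed
    then show "(LINT z|lborel. (cmod (dbar k g z))\<^sup>2 * gauss \<beta> z) = (1 / 4) * (LINT z|lborel. ((frechet_derivative \<psi> (at z) (axis k 1))\<^sup>2 + (frechet_derivative \<psi> (at z) (axis k \<i>))\<^sup>2)
         * ((cmod (vander z))\<^sup>2 * gauss \<beta> z))"
      by (simp only: integral_mult_right_zero)
  qed
  also have "(\<lambda>z. (cmod (g z))\<^sup>2 * gauss \<beta> z) = (\<lambda>z. (\<psi> z)\<^sup>2 * ((cmod (vander z))\<^sup>2 * gauss \<beta> z))"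
    unfolding g_def norm_mult norm_of_real power_mult_distrib power2_abs by (simp only: mult_ac)
  finally have "(LINT z|lborel. (\<psi> z)\<^sup>2 * ((cmod (vander z))\<^sup>2 * gauss \<beta> z)) \<le> 2 / \<beta> * ((1 / 4) *
     (\<Sum>k\<in>UNIV. (LINT z|lborel. ((frechet_derivative \<psi> (at z) (axis k 1))\<^sup>2 + (frechet_derivative \<psi> (at z) (axis k \<i>))\<^sup>2)
         * ((cmod (vander z))\<^sup>2 * gauss \<beta> z))))"
    unfolding sum_distrib_left[symmetric] .
  moreover have "2 / \<beta> * ((1 / 4) * S) = 1 / (2 * \<beta>) * S" for S by simp
  ultimately show ?thesis by (simp only:)
qed

section \<open>Square-integrable functions\<close>

lemma L2_measurable: "f \<in> L2 M \<Longrightarrow> f \<in> borel_measurable M"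
  and L2_integrable: "f \<in> L2 M \<Longrightarrow> integrable M (\<lambda>x. (norm (f x))\<^sup>2)"
  by (auto simp: L2_def)

lemma L2_scaleR:
  assumes "f \<in> L2 M" shows "(\<lambda>x. c *\<^sub>R f x) \<in> L2 M"
  using assms by (auto simp: L2_def power_mult_distrib)

lemma norm_add_square_le: "(norm (a + b))\<^sup>2 \<le> 2 * (norm a)\<^sup>2 + 2 * (norm (b :: 'b::euclidean_space))\<^sup>2"
proof -
  have "2 * (norm a)\<^sup>2 + 2 * (norm b)\<^sup>2 - (norm (a + b))\<^sup>2 = (norm (a - b))\<^sup>2"
    unfolding power2_norm_eq_inner inner_add_left inner_add_right inner_diff_left inner_diff_right
    by (simp add: inner_commute)
  moreover have "0 \<le> (norm (a - b))\<^sup>2" by simp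
  ultimately show ?thesis by linarith
qed

lemma L2_add:
  assumes "f \<in> L2 M" "g \<in> L2 M" shows "(\<lambda>x. f x + g x) \<in> L2 M"
proof -
  have [measurable]: "f \<in> borel_measurable M" "g \<in> borel_measurable M" using assms by (auto simp: L2_def)
  have "integrable M (\<lambda>x. (norm (f x + g x))\<^sup>2)"
  proof (rule Bochner_Integration.integrable_bound)
    show "integrable M (\<lambda>x. 2 * (norm (f x))\<^sup>2 + 2 * (norm (g x))\<^sup>2)"
      by (intro Bochner_Integration.integrable_add integrable_mult_right L2_integrable assms)
    show "AE x in M. norm ((norm (f x + g x))\<^sup>2) \<le> norm (2 * (norm (f x))\<^sup>2 + 2 * (norm (g x))\<^sup>2)"
      using norm_add_square_le by (intro AE_I2) auto
  qed measurable
  then show ?thesis by (simp add: L2_def)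
qed

lemma L2_diff:
  assumes "f \<in> L2 M" "g \<in> L2 M" shows "(\<lambda>x. f x - g x) \<in> L2 M"
  using L2_add[OF assms(1) L2_scaleR[OF assms(2), of "-1"]] by simp

lemma L2_norm_nonneg: "L2_norm M f \<ge> 0"
  by (simp add: L2_norm_def)

lemma L2_norm_square: "(L2_norm M f)\<^sup>2 = (LINT x|M. (norm (f x))\<^sup>2)"
  by (simp add: L2_norm_def)

lemma L2_inner_integrable:
  assumes "u \<in> L2 M" "v \<in> L2 M"
  shows "integrable M (\<lambda>x. u x \<bullet> v x)"
proof (rule Bochner_Integration.integrable_bound)
  have [measurable]: "u \<in> borel_measurable M" "v \<in> borel_measurable M" using assms by (auto simp: L2_def)
  show "integrable M (\<lambda>x. (norm (u x))\<^sup>2 + (norm (v x))\<^sup>2)"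
    by (intro Bochner_Integration.integrable_add L2_integrable assms)
  show "(\<lambda>x. u x \<bullet> v x) \<in> borel_measurable M" by measurable
  show "AE x in M. norm (u x \<bullet> v x) \<le> norm ((norm (u x))\<^sup>2 + (norm (v x))\<^sup>2)"
  proof (rule AE_I2)
    fix x
    have "\<bar>u x \<bullet> v x\<bar> \<le> norm (u x) * norm (v x)" by (rule Cauchy_Schwarz_ineq2)
    also have "\<dots> \<le> (norm (u x))\<^sup>2 + (norm (v x))\<^sup>2"
      using sum_squares_bound[of "norm (u x)" "norm (v x)"] mult_nonneg_nonneg[OF norm_ge_zero[of "u x"] norm_ge_zero[of "v x"]] by linarith
    finally show "norm (u x \<bullet> v x) \<le> norm ((norm (u x))\<^sup>2 + (norm (v x))\<^sup>2)" by simp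
  qed
qed

lemma L2_cauchy_schwarz:
  assumes "u \<in> L2 M" "v \<in> L2 M"
  shows "\<bar>LINT x|M. u x \<bullet> v x\<bar> \<le> L2_norm M u * L2_norm M v"
proof -
  define A where "A = (LINT x|M. (norm (u x))\<^sup>2)"
  define B where "B = (LINT x|M. (norm (v x))\<^sup>2)"
  define X where "X = (LINT x|M. u x \<bullet> v x)"
  have A0: "A \<ge> 0" and B0: "B \<ge> 0" by (auto simp: A_def B_def)
  have q: "0 \<le> A - 2 * t * X + t\<^sup>2 * B" for t
  proof -
    have "0 \<le> (LINT x|M. (norm (u x - t *\<^sub>R v x))\<^sup>2)" by simp
    also have "(\<lambda>x. (norm (u x - t *\<^sub>R v x))\<^sup>2) = (\<lambda>x. (norm (u x))\<^sup>2 - (2 * t) * (u x \<bullet> v x) + t\<^sup>2 * (norm (v x))\<^sup>2)"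
      unfolding power2_norm_eq_inner
      by (simp add: fun_eq_iff inner_diff_left inner_diff_right inner_commute power2_eq_square algebra_simps)
    also have "(LINT x|M. (norm (u x))\<^sup>2 - (2 * t) * (u x \<bullet> v x) + t\<^sup>2 * (norm (v x))\<^sup>2) = A - 2 * t * X + t\<^sup>2 * B"
      unfolding A_def B_def X_def using L2_integrable[OF assms(1)] L2_integrable[OF assms(2)] L2_inner_integrable[OF assms]
      by simp
    finally show ?thesis .
  qed
  have "X\<^sup>2 \<le> A * B"
  proof (cases "B = 0")
    case True
    have "X = 0"
    proof (rule ccontr)
      assume "X \<noteq> 0"
      \<comment> \<open>This choice of \<open>t\<close> makes the affine function \<open>A - 2 t X\<close> equal to \<open>- 1\<close>.\<close>
      then have "A - 2 * ((A + 1) / (2 * X)) * X + ((A + 1) / (2 * X))\<^sup>2 * B = - 1" using True by (simp add: field_simps)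
      then show False using q[of "(A + 1) / (2 * X)"] by simp
    qed
    then show ?thesis using True by simp
  next
    case False
    then have "A - 2 * (X / B) * X + (X / B)\<^sup>2 * B = A - X\<^sup>2 / B" by (simp add: power2_eq_square)
    then have "X\<^sup>2 / B \<le> A" using q[of "X / B"] by simp
    then show ?thesis using False B0 by (simp add: divide_le_eq)
  qed
  then have "sqrt (X\<^sup>2) \<le> sqrt (A * B)" by (rule real_sqrt_le_mono)
  then show ?thesis by (simp add: L2_norm_def real_sqrt_mult A_def B_def X_def)
qed

lemma L2_norm_tendsto_0_iff:
  "(\<lambda>m. L2_norm M (d m)) \<longlonglongrightarrow> 0 \<longleftrightarrow> (\<lambda>m. LINT x|M. (norm (d m x))\<^sup>2) \<longlonglongrightarrow> 0"
proof
  assume "(\<lambda>m. L2_norm M (d m)) \<longlonglongrightarrow> 0"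
  from tendsto_power[OF this, of 2] show "(\<lambda>m. LINT x|M. (norm (d m x))\<^sup>2) \<longlonglongrightarrow> 0"
    by (simp add: L2_norm_square)
next
  assume "(\<lambda>m. LINT x|M. (norm (d m x))\<^sup>2) \<longlonglongrightarrow> 0"
  from tendsto_real_sqrt[OF this] show "(\<lambda>m. L2_norm M (d m)) \<longlonglongrightarrow> 0"
    by (simp add: L2_norm_def)
qed

lemma L2_tendsto_add:
  assumes "\<And>m. a m \<in> L2 M" "\<And>m. b m \<in> L2 M"
    "(\<lambda>m. L2_norm M (a m)) \<longlonglongrightarrow> 0" "(\<lambda>m. L2_norm M (b m)) \<longlonglongrightarrow> 0"
  shows "(\<lambda>m. L2_norm M (\<lambda>x. a m x + b m x)) \<longlonglongrightarrow> 0"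
  unfolding L2_norm_tendsto_0_iff
proof (rule tendsto_sandwich[OF always_eventually always_eventually tendsto_const])
  have "(\<lambda>m. 2 * (LINT x|M. (norm (a m x))\<^sup>2) + 2 * (LINT x|M. (norm (b m x))\<^sup>2)) \<longlonglongrightarrow> 2 * 0 + 2 * 0"
    using assms(3,4) unfolding L2_norm_tendsto_0_iff by (intro tendsto_intros)
  then show "(\<lambda>m. 2 * (LINT x|M. (norm (a m x))\<^sup>2) + 2 * (LINT x|M. (norm (b m x))\<^sup>2)) \<longlonglongrightarrow> 0" by simp
  show "\<forall>m. (LINT x|M. (norm (a m x + b m x))\<^sup>2) \<le> 2 * (LINT x|M. (norm (a m x))\<^sup>2) + 2 * (LINT x|M. (norm (b m x))\<^sup>2)"
  proof
    fix m
    have "(LINT x|M. (norm (a m x + b m x))\<^sup>2) \<le> (LINT x|M. 2 * (norm (a m x))\<^sup>2 + 2 * (norm (b m x))\<^sup>2)"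
      by (intro integral_mono norm_add_square_le Bochner_Integration.integrable_add integrable_mult_right
           L2_integrable[OF L2_add] L2_integrable assms)
    then show "(LINT x|M. (norm (a m x + b m x))\<^sup>2) \<le> 2 * (LINT x|M. (norm (a m x))\<^sup>2) + 2 * (LINT x|M. (norm (b m x))\<^sup>2)"
      using L2_integrable[OF assms(1)[of m]] L2_integrable[OF assms(2)[of m]] by simp
  qed
qed simp

lemma L2_norm_scaleR: "L2_norm M (\<lambda>x. c *\<^sub>R f x) = \<bar>c\<bar> * L2_norm M f"
  by (simp add: L2_norm_def power_mult_distrib real_sqrt_mult)

lemma L2_inner_tendsto:
  assumes "\<And>m. u m \<in> L2 M" "f \<in> L2 M" "v \<in> L2 M" "(\<lambda>m. L2_norm M (\<lambda>x. u m x - f x)) \<longlonglongrightarrow> 0"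
  shows "(\<lambda>m. LINT x|M. u m x \<bullet> v x) \<longlonglongrightarrow> (LINT x|M. f x \<bullet> v x)"
proof -
  have e: "(LINT x|M. (u m x - f x) \<bullet> v x) = (LINT x|M. u m x \<bullet> v x) - (LINT x|M. f x \<bullet> v x)" for m
    using L2_inner_integrable[OF assms(1,3)] L2_inner_integrable[OF assms(2,3)] by (simp add: inner_diff_left)
  have "(\<lambda>m. LINT x|M. (u m x - f x) \<bullet> v x) \<longlonglongrightarrow> 0"
  proof (rule tendsto_rabs_zero_cancel, rule tendsto_sandwich[OF always_eventually always_eventually tendsto_const])
    show "\<forall>m. \<bar>LINT x|M. (u m x - f x) \<bullet> v x\<bar> \<le> L2_norm M (\<lambda>x. u m x - f x) * L2_norm M v"
      using L2_cauchy_schwarz[OF L2_diff[OF assms(1,2)] assms(3)] by blast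
    show "(\<lambda>m. L2_norm M (\<lambda>x. u m x - f x) * L2_norm M v) \<longlonglongrightarrow> 0"
      using tendsto_mult_left_zero[OF assms(4)] .
  qed simp
  then show ?thesis unfolding e by (simp add: LIM_zero_iff)
qed

lemma L2_square_tendsto:
  assumes "\<And>m. u m \<in> L2 M" "f \<in> L2 M" "(\<lambda>m. L2_norm M (\<lambda>x. u m x - f x)) \<longlonglongrightarrow> 0"
  shows "(\<lambda>m. LINT x|M. (norm (u m x))\<^sup>2) \<longlonglongrightarrow> (LINT x|M. (norm (f x))\<^sup>2)"
proof -
  have "(LINT x|M. (norm (u m x))\<^sup>2) = (LINT x|M. (norm (u m x - f x))\<^sup>2) + 2 * (LINT x|M. u m x \<bullet> f x) - (LINT x|M. (norm (f x))\<^sup>2)" for m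
  proof -
    have "(\<lambda>x. (norm (u m x))\<^sup>2) = (\<lambda>x. (norm (u m x - f x))\<^sup>2 + 2 * (u m x \<bullet> f x) - (norm (f x))\<^sup>2)"
      unfolding power2_norm_eq_inner by (simp add: fun_eq_iff inner_diff_left inner_diff_right inner_commute)
    then have "(LINT x|M. (norm (u m x))\<^sup>2) = (LINT x|M. (norm (u m x - f x))\<^sup>2 + 2 * (u m x \<bullet> f x) - (norm (f x))\<^sup>2)" by simp
    also have "\<dots> = (LINT x|M. (norm (u m x - f x))\<^sup>2) + 2 * (LINT x|M. u m x \<bullet> f x) - (LINT x|M. (norm (f x))\<^sup>2)"
      using L2_integrable[OF L2_diff[OF assms(1,2), of m]] L2_inner_integrable[OF assms(1,2), of m] L2_integrable[OF assms(2)]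
      by simp
    finally show ?thesis .
  qed
  moreover have "(\<lambda>m. (LINT x|M. (norm (u m x - f x))\<^sup>2) + 2 * (LINT x|M. u m x \<bullet> f x) - (LINT x|M. (norm (f x))\<^sup>2))
     \<longlonglongrightarrow> 0 + 2 * (LINT x|M. f x \<bullet> f x) - (LINT x|M. (norm (f x))\<^sup>2)"
    by (intro tendsto_intros L2_inner_tendsto assms) (use assms(3) in \<open>simp add: L2_norm_tendsto_0_iff\<close>)
  ultimately show ?thesis by (simp add: power2_norm_eq_inner)
qed

section \<open>Gradients of test functions\<close>

lemma grad_eqI: "GDERIV f x :> D \<Longrightarrow> grad f x = D"
proof -
  assume D: "GDERIV f x :> D"
  have unique: "D' = D" if "GDERIV f x :> D'" for D'
  proof -
    have "(\<lambda>h. h \<bullet> D') = (\<lambda>h. h \<bullet> D)"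
      using that D unfolding gderiv_def by (rule has_derivative_unique)
    then have "\<forall>h. h \<bullet> D' = h \<bullet> D" by (rule fun_cong[THEN allI])
    then show ?thesis by (rule vector_eq_ldot[THEN iffD1])
  qed
  show ?thesis unfolding grad_def by (rule the_equality) (rule D, rule unique)
qed

lemma grad_gderiv:
  fixes f :: "'a::euclidean_space \<Rightarrow> real"
  assumes "f differentiable (at x)"
  shows "GDERIV f x :> grad f x" "frechet_derivative f (at x) v = grad f x \<bullet> v"
    "grad f x = (\<Sum>b\<in>Basis. frechet_derivative f (at x) b *\<^sub>R b)"
proof -
  let ?D = "\<Sum>b\<in>Basis. frechet_derivative f (at x) b *\<^sub>R b"
  have d: "(f has_derivative frechet_derivative f (at x)) (at x)" using assms frechet_derivative_works by blast
  then have lin: "linear (frechet_derivative f (at x))" by (rule has_derivative_linear)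
  have e: "frechet_derivative f (at x) h = h \<bullet> ?D" for h
  proof -
    have "frechet_derivative f (at x) h = frechet_derivative f (at x) (\<Sum>b\<in>Basis. (h \<bullet> b) *\<^sub>R b)" by (simp add: euclidean_representation)
    also have "\<dots> = (\<Sum>b\<in>Basis. (h \<bullet> b) * frechet_derivative f (at x) b)"
      by (simp add: linear_sum[OF lin] linear_scale[OF lin])
    finally show ?thesis by (simp add: inner_sum_right mult.commute)
  qed
  have fe: "frechet_derivative f (at x) = (\<lambda>h. h \<bullet> ?D)" by (rule ext) (rule e)
  have g: "GDERIV f x :> ?D" unfolding gderiv_def using d by (subst (asm) fe)
  show "grad f x = ?D" by (rule grad_eqI[OF g])
  then show "GDERIV f x :> grad f x" "frechet_derivative f (at x) v = grad f x \<bullet> v"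
    using g e[of v] by (simp_all only: inner_commute[of v])
qed

lemma test_functions_iff: "f \<in> test_functions \<longleftrightarrow> (\<forall>k. times_cont_diff k f) \<and> bdd_supp f"
proof -
  have "compact (closure {x. f x \<noteq> 0}) \<longleftrightarrow> bdd_supp f"
  proof -
    have "compact (closure {x. f x \<noteq> 0}) \<longleftrightarrow> bounded {x. f x \<noteq> 0}"
      unfolding compact_eq_bounded_closed using bounded_closure bounded_subset[OF _ closure_subset] closed_closure by blast
    also have "\<dots> \<longleftrightarrow> (\<exists>R. \<forall>x\<in>{x. f x \<noteq> 0}. norm x \<le> R)" by (rule bounded_iff)
    also have "\<dots> \<longleftrightarrow> bdd_supp f"
    proof -
      have "(\<forall>x\<in>{x. f x \<noteq> 0}. norm x \<le> R) \<longleftrightarrow> (\<forall>x. norm x > R \<longrightarrow> f x = 0)" for R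
        unfolding not_le[symmetric] by blast
      then show ?thesis unfolding bdd_supp_def by (simp only:)
    qed
    finally show ?thesis .
  qed
  then show ?thesis by (simp add: test_functions_def)
qed

lemma test_differentiable: "f \<in> test_functions \<Longrightarrow> f differentiable (at x)"
  unfolding test_functions_iff by (elim conjE allE[of _ "Suc 0"]) (simp only: times_cont_diff.simps)

lemma bdd_supp_add: "bdd_supp f \<Longrightarrow> bdd_supp g \<Longrightarrow> bdd_supp (\<lambda>x. f x + g x :: 'b::real_normed_vector)"
proof -
  assume "bdd_supp f" "bdd_supp g"
  then obtain R S where "\<And>x. norm x > R \<Longrightarrow> f x = 0" "\<And>x. norm x > S \<Longrightarrow> g x = 0" unfolding bdd_supp_def by blast
  then have "\<And>x. norm x > max R S \<Longrightarrow> f x + g x = 0" by simp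
  then show ?thesis unfolding bdd_supp_def by blast
qed

lemma test_add: "f \<in> test_functions \<Longrightarrow> g \<in> test_functions \<Longrightarrow> (\<lambda>x. f x + g x) \<in> test_functions"
  unfolding test_functions_iff by (auto intro: times_cont_diff_add bdd_supp_add)

lemma test_scale: "f \<in> test_functions \<Longrightarrow> (\<lambda>x. c * f x) \<in> test_functions"
  unfolding test_functions_iff by (auto intro: times_cont_diff_mult times_cont_diff_const simp: bdd_supp_def)

lemma test_cutoff_mult: "(\<And>k. times_cont_diff k f) \<Longrightarrow> (\<lambda>x. cutoff R x * f x) \<in> test_functions"
  unfolding test_functions_iff
  using cutoff_test_function[of R] by (auto intro!: times_cont_diff_mult simp: test_functions_iff bdd_supp_def)

lemma grad_add:
  assumes "f differentiable (at x)" "g differentiable (at x)" shows "grad (\<lambda>x. f x + g x) x = grad f x + grad g (x::'a::euclidean_space)"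
  by (rule grad_eqI[OF GDERIV_add[OF grad_gderiv(1) grad_gderiv(1)]]) (use assms in auto)

lemma grad_scale:
  assumes "f differentiable (at x)" shows "grad (\<lambda>x. c * f x) x = c *\<^sub>R grad f (x::'a::euclidean_space)"
proof (rule grad_eqI)
  show "GDERIV (\<lambda>x. c * f x) x :> c *\<^sub>R grad f x"
    using grad_gderiv(1)[OF assms] unfolding gderiv_def inner_scaleR_right by (rule has_derivative_mult_right)
qed

lemma grad_mult:
  assumes "f differentiable (at x)" "g differentiable (at x)"
  shows "grad (\<lambda>x. f x * g x) x = f x *\<^sub>R grad g x + g x *\<^sub>R grad f (x::'a::euclidean_space)"
proof (rule grad_eqI)
  show "GDERIV (\<lambda>x. f x * g x) x :> f x *\<^sub>R grad g x + g x *\<^sub>R grad f x"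
    unfolding gderiv_def
    by (rule has_derivative_eq_rhs[OF has_derivative_mult[OF grad_gderiv(1)[unfolded gderiv_def, OF assms(1)] grad_gderiv(1)[unfolded gderiv_def, OF assms(2)]]])
       (simp add: fun_eq_iff inner_add_right)
qed

lemma grad_const: "grad (\<lambda>x. c) x = 0"
  by (rule grad_eqI[OF GDERIV_const])

lemma continuous_grad:
  assumes "times_cont_diff (Suc 0) f" shows "continuous_on UNIV (grad f)"
proof -
  have "grad f = (\<lambda>x. \<Sum>b\<in>Basis. frechet_derivative f (at x) b *\<^sub>R b)"
    using assms by (intro ext grad_gderiv(3)) simp
  then show ?thesis using assms by (auto intro!: continuous_intros)
qed

lemma bdd_supp_grad: assumes "bdd_supp f" shows "bdd_supp (grad f :: 'a::euclidean_space \<Rightarrow> 'a)"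
proof -
  obtain R where R: "\<And>x. norm x > R \<Longrightarrow> f x = 0" using assms unfolding bdd_supp_def by blast
  have "grad f x = 0" if "norm x > R" for x
  proof (rule grad_eqI)
    have op: "open {x::'a. norm x > R}" by (intro open_Collect_less continuous_intros)
    have "(f has_derivative (\<lambda>_. 0)) (at x)"
      by (rule has_derivative_transform_within_open[OF has_derivative_const[of 0] op]) (use R that in auto)
    then show "GDERIV f x :> 0" by (simp add: gderiv_def)
  qed
  then show ?thesis unfolding bdd_supp_def by blast
qed

section \<open>The Sobolev space of a finite Borel measure\<close>

context
  fixes M :: "'a::euclidean_space measure"
  assumes fin: "finite_measure M" and sets: "sets M = sets borel"
begin

lemma continuous_measurable_M: "continuous_on UNIV u \<Longrightarrow> u \<in> borel_measurable M"
  using borel_measurable_continuous_onI measurable_cong_sets[OF sets refl] by blast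

lemma bdd_supp_L2:
  fixes u :: "'a \<Rightarrow> 'b::euclidean_space"
  assumes "continuous_on UNIV u" "bdd_supp u"
  shows "u \<in> L2 M"
proof -
  obtain B where B: "B \<ge> 0" "\<And>x. norm (u x) \<le> B" using bounded_bdd_supp[OF assms] by blast
  have m [measurable]: "u \<in> borel_measurable M" by (rule continuous_measurable_M[OF assms(1)])
  have "integrable M (\<lambda>x. (norm (u x))\<^sup>2)"
    by (rule finite_measure.integrable_const_bound[OF fin, of _ "B\<^sup>2"]) (use B in \<open>auto intro!: power_mono\<close>)
  then show ?thesis by (simp add: L2_def)
qed

lemma test_L2: "f \<in> test_functions \<Longrightarrow> f \<in> L2 M"
  and test_grad_L2: "f \<in> test_functions \<Longrightarrow> grad f \<in> L2 M"
  unfolding test_functions_iff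
  by (auto intro!: bdd_supp_L2 times_cont_diff_continuous continuous_grad bdd_supp_grad simp del: times_cont_diff.simps)

lemma grad_closure_add:
  assumes "grad_closure M f g" "grad_closure M f' g'"
  shows "grad_closure M (\<lambda>x. f x + f' x) (\<lambda>x. g x + g' x)"
proof -
  obtain \<phi> where \<phi>: "\<And>m. \<phi> m \<in> test_functions" "(\<lambda>m. L2_norm M (\<lambda>x. \<phi> m x - f x)) \<longlonglongrightarrow> 0" "(\<lambda>m. L2_norm M (\<lambda>x. grad (\<phi> m) x - g x)) \<longlonglongrightarrow> 0"
    using assms(1) unfolding grad_closure_def by blast
  obtain \<phi>' where \<phi>': "\<And>m. \<phi>' m \<in> test_functions" "(\<lambda>m. L2_norm M (\<lambda>x. \<phi>' m x - f' x)) \<longlonglongrightarrow> 0" "(\<lambda>m. L2_norm M (\<lambda>x. grad (\<phi>' m) x - g' x)) \<longlonglongrightarrow> 0"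
    using assms(2) unfolding grad_closure_def by blast
  have L: "f \<in> L2 M" "g \<in> L2 M" "f' \<in> L2 M" "g' \<in> L2 M" using assms unfolding grad_closure_def by auto
  let ?p = "\<lambda>m x. \<phi> m x + \<phi>' m x"
  have "(\<lambda>m. L2_norm M (\<lambda>x. (\<phi> m x - f x) + (\<phi>' m x - f' x))) \<longlonglongrightarrow> 0"
    by (intro L2_tendsto_add L2_diff test_L2 \<phi> \<phi>' L)
  moreover have "(\<lambda>m. L2_norm M (\<lambda>x. (grad (\<phi> m) x - g x) + (grad (\<phi>' m) x - g' x))) \<longlonglongrightarrow> 0"
    by (intro L2_tendsto_add L2_diff test_grad_L2 \<phi> \<phi>' L)
  moreover have "grad (?p m) x = grad (\<phi> m) x + grad (\<phi>' m) x" for m x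
    by (intro grad_add test_differentiable \<phi> \<phi>')
  moreover have "?p m \<in> test_functions" for m by (intro test_add \<phi> \<phi>')
  ultimately show ?thesis unfolding grad_closure_def
    using L2_add[OF L(1,3)] L2_add[OF L(2,4)] by (intro conjI exI[of _ ?p]) (simp_all add: algebra_simps)
qed

lemma grad_closure_scale:
  assumes "grad_closure M f g"
  shows "grad_closure M (\<lambda>x. c * f x) (\<lambda>x. c *\<^sub>R g x)"
proof -
  obtain \<phi> where \<phi>: "\<And>m. \<phi> m \<in> test_functions" "(\<lambda>m. L2_norm M (\<lambda>x. \<phi> m x - f x)) \<longlonglongrightarrow> 0" "(\<lambda>m. L2_norm M (\<lambda>x. grad (\<phi> m) x - g x)) \<longlonglongrightarrow> 0"
    using assms(1) unfolding grad_closure_def by blast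
  have L: "f \<in> L2 M" "g \<in> L2 M" using assms unfolding grad_closure_def by auto
  let ?p = "\<lambda>m x. c * \<phi> m x"
  have "(\<lambda>m. L2_norm M (\<lambda>x. c *\<^sub>R (\<phi> m x - f x))) \<longlonglongrightarrow> 0"
    unfolding L2_norm_scaleR by (intro tendsto_mult_right_zero \<phi>)
  moreover have "(\<lambda>m. L2_norm M (\<lambda>x. c *\<^sub>R (grad (\<phi> m) x - g x))) \<longlonglongrightarrow> 0"
    unfolding L2_norm_scaleR by (intro tendsto_mult_right_zero \<phi>)
  moreover have "grad (?p m) x = c *\<^sub>R grad (\<phi> m) x" for m x
    by (intro grad_scale test_differentiable \<phi>)
  moreover have "?p m \<in> test_functions" for m by (intro test_scale \<phi>)
  ultimately show ?thesis unfolding grad_closure_def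
    using L2_scaleR[OF L(1), of c] L2_scaleR[OF L(2), of c]
    by (intro conjI exI[of _ ?p]) (simp_all add: right_diff_distrib scaleR_right_diff_distrib)
qed

text \<open>
  Multiplication by \<open>cutoff m\<close> adds to the gradient an error \<open>f x *\<^sub>R grad (cutoff m) x\<close>, whose norm is of order \<open>1/m\<close> relative to \<open>f\<close>.
\<close>

lemma grad_closure_smooth:
  assumes f: "\<And>k. times_cont_diff k f" and fL: "f \<in> L2 M" and gL: "grad f \<in> L2 M"
  shows "grad_closure M f (grad f)"
proof -
  define p where "p = (\<lambda>m x. cutoff m x * f x)"
  have p: "p m \<in> test_functions" for m unfolding p_def by (rule test_cutoff_mult[OF f])
  have df: "f differentiable (at x)" for x using f[of 1] by simp
  have dc: "cutoff m differentiable (at (x::'a))" for m x by (rule test_differentiable[OF cutoff_test_function])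
  obtain C where C: "C \<ge> 0" "\<And>R (x::'a) v. \<bar>frechet_derivative (cutoff R) (at x) v\<bar> \<le> C * norm v / real (Suc R)"
    using cutoff_derivative_bound by blast
  have gc: "norm (grad (cutoff m) (x::'a)) \<le> C * inverse (real (Suc m))" for m x
  proof -
    let ?g = "grad (cutoff m) x"
    have "norm ?g * norm ?g = \<bar>frechet_derivative (cutoff m) (at x) ?g\<bar>"
      unfolding grad_gderiv(2)[OF dc] by (simp add: power2_norm_eq_inner[symmetric] power2_eq_square)
    also have "\<dots> \<le> (C * inverse (real (Suc m))) * norm ?g" using C(2)[of m x ?g] by (simp add: divide_inverse mult_ac)
    finally show ?thesis using C(1) by (cases "norm ?g = 0") (auto simp del: of_nat_Suc)
  qed
  have mc: "cutoff m \<in> borel_measurable M" for m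
    by (intro continuous_measurable_M times_cont_diff_continuous[OF times_cont_diff_cutoff])
  have conv: "(\<lambda>m. L2_norm M (\<lambda>x. (cutoff m x - 1) *\<^sub>R h x)) \<longlonglongrightarrow> 0" if h: "h \<in> L2 M" for h :: "'a \<Rightarrow> 'b::euclidean_space"
    unfolding L2_norm_tendsto_0_iff
  proof -
    have [measurable]: "h \<in> borel_measurable M" by (rule L2_measurable[OF h])
    note [measurable] = mc
    have "(\<lambda>m. LINT x|M. (norm ((cutoff m x - 1) *\<^sub>R h x))\<^sup>2) \<longlonglongrightarrow> (LINT x|M. 0)"
    proof (rule integral_dominated_convergence[OF _ _ L2_integrable[OF h]])
      show "AE x in M. (\<lambda>m. (norm ((cutoff m x - 1) *\<^sub>R h x))\<^sup>2) \<longlonglongrightarrow> 0"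
      proof (rule AE_I2)
        fix x :: 'a
        have "(\<lambda>m. (norm ((cutoff m x - 1) *\<^sub>R h x))\<^sup>2) \<longlonglongrightarrow> (norm ((1 - 1) *\<^sub>R h x))\<^sup>2"
          by (intro tendsto_intros cutoff_tendsto_1)
        then show "(\<lambda>m. (norm ((cutoff m x - 1) *\<^sub>R h x))\<^sup>2) \<longlonglongrightarrow> 0" by simp
      qed
      show "AE x in M. norm ((norm ((cutoff m x - 1) *\<^sub>R h x))\<^sup>2) \<le> (norm (h x))\<^sup>2" for m
      proof (rule AE_I2)
        fix x :: 'a
        have "\<bar>cutoff m x - 1\<bar> \<le> 1" using cutoff_nonneg[of m x] cutoff_le_1[of m x] by simp
        then have "norm ((cutoff m x - 1) *\<^sub>R h x) \<le> norm (h x)" by (simp add: mult_left_le_one_le)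
        then show "norm ((norm ((cutoff m x - 1) *\<^sub>R h x))\<^sup>2) \<le> (norm (h x))\<^sup>2" by (simp add: power_mono)
      qed
    qed measurable
    then show "(\<lambda>m. LINT x|M. (norm ((cutoff m x - 1) *\<^sub>R h x))\<^sup>2) \<longlonglongrightarrow> 0" by simp
  qed
  have L2c: "(\<lambda>x. (cutoff m x - 1) *\<^sub>R h x) \<in> L2 M" if h: "h \<in> L2 M" for h :: "'a \<Rightarrow> 'b::euclidean_space" and m
  proof -
    have [measurable]: "h \<in> borel_measurable M" by (rule L2_measurable[OF h])
    note [measurable] = mc
    have "integrable M (\<lambda>x. (norm ((cutoff m x - 1) *\<^sub>R h x))\<^sup>2)"
    proof (rule Bochner_Integration.integrable_bound[OF L2_integrable[OF h]])
      show "AE x in M. norm ((norm ((cutoff m x - 1) *\<^sub>R h x))\<^sup>2) \<le> norm ((norm (h x))\<^sup>2)"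
      proof (rule AE_I2)
        fix x :: 'a
        have "\<bar>cutoff m x - 1\<bar> \<le> 1" using cutoff_nonneg[of m x] cutoff_le_1[of m x] by simp
        then have "norm ((cutoff m x - 1) *\<^sub>R h x) \<le> norm (h x)" by (simp add: mult_left_le_one_le)
        then show "norm ((norm ((cutoff m x - 1) *\<^sub>R h x))\<^sup>2) \<le> norm ((norm (h x))\<^sup>2)" by (simp add: power_mono)
      qed
    qed measurable
    then show ?thesis by (simp add: L2_def)
  qed
  have fg: "(\<lambda>x. f x *\<^sub>R grad (cutoff m) x) \<in> L2 M" and fgn: "L2_norm M (\<lambda>x. f x *\<^sub>R grad (cutoff m) x) \<le> C * inverse (real (Suc m)) * L2_norm M f" for m
  proof -
    let ?c = "C * inverse (real (Suc m))"
    have c0: "0 \<le> ?c" by (rule mult_nonneg_nonneg[OF C(1)]) (simp del: of_nat_Suc)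
    have [measurable]: "f \<in> borel_measurable M" by (rule L2_measurable[OF fL])
    have [measurable]: "grad (cutoff m) \<in> borel_measurable M" by (rule L2_measurable[OF test_grad_L2[OF cutoff_test_function]])
    have le: "(norm (f x *\<^sub>R grad (cutoff m) x))\<^sup>2 \<le> ?c\<^sup>2 * (norm (f x))\<^sup>2" for x
      using mult_mono[OF gc[of m x] order_refl[of "norm (f x)"]] C(1)
      unfolding power_mult_distrib[symmetric] by (intro power_mono) (simp_all add: mult.commute)
    have i: "integrable M (\<lambda>x. ?c\<^sup>2 * (norm (f x))\<^sup>2)" by (intro integrable_mult_right L2_integrable fL)
    have i2: "integrable M (\<lambda>x. (norm (f x *\<^sub>R grad (cutoff m) x))\<^sup>2)"
    proof (rule Bochner_Integration.integrable_bound[OF i])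
      show "AE x in M. norm ((norm (f x *\<^sub>R grad (cutoff m) x))\<^sup>2) \<le> norm (?c\<^sup>2 * (norm (f x))\<^sup>2)"
      proof (rule AE_I2)
        fix x
        show "norm ((norm (f x *\<^sub>R grad (cutoff m) x))\<^sup>2) \<le> norm (?c\<^sup>2 * (norm (f x))\<^sup>2)"
          unfolding real_norm_def abs_power2 by (rule order_trans[OF le[unfolded real_norm_def] abs_ge_self])
      qed
    qed measurable
    then show "(\<lambda>x. f x *\<^sub>R grad (cutoff m) x) \<in> L2 M" by (simp add: L2_def)
    have "(L2_norm M (\<lambda>x. f x *\<^sub>R grad (cutoff m) x))\<^sup>2 \<le> (?c * L2_norm M f)\<^sup>2"
      using integral_mono[OF i2 i le]
      by (simp only: power_mult_distrib[of ?c "L2_norm M f"] L2_norm_square integral_mult_right_zero)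
    then show "L2_norm M (\<lambda>x. f x *\<^sub>R grad (cutoff m) x) \<le> ?c * L2_norm M f"
      by (rule power2_le_imp_le) (rule mult_nonneg_nonneg[OF c0 L2_norm_nonneg])
  qed
  have "(\<lambda>m. L2_norm M (\<lambda>x. f x *\<^sub>R grad (cutoff m) x)) \<longlonglongrightarrow> 0"
  proof (rule tendsto_sandwich[OF always_eventually always_eventually tendsto_const])
    show "(\<lambda>m. C * inverse (real (Suc m)) * L2_norm M f) \<longlonglongrightarrow> 0"
      using tendsto_mult_left_zero[OF tendsto_mult_right_zero[OF LIMSEQ_inverse_real_of_nat]] .
  qed (use fgn L2_norm_nonneg in auto)
  then have "(\<lambda>m. L2_norm M (\<lambda>x. (cutoff m x - 1) *\<^sub>R grad f x + f x *\<^sub>R grad (cutoff m) x)) \<longlonglongrightarrow> 0"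
    by (intro L2_tendsto_add L2c fg conv gL)
  moreover have "grad (p m) x = cutoff m x *\<^sub>R grad f x + f x *\<^sub>R grad (cutoff m) x" for m x
    unfolding p_def by (rule grad_mult[OF dc df])
  ultimately have A: "(\<lambda>m. L2_norm M (\<lambda>x. grad (p m) x - grad f x)) \<longlonglongrightarrow> 0"
    by (simp add: scaleR_left_diff_distrib algebra_simps)
  have B: "(\<lambda>m. L2_norm M (\<lambda>x. p m x - f x)) \<longlonglongrightarrow> 0"
    using conv[OF fL] by (simp add: p_def left_diff_distrib)
  show ?thesis unfolding grad_closure_def by (intro conjI exI[of _ p] allI fL gL p A B)
qed

end

section \<open>The complex Ginibre measure\<close>

lemma norm_vec_square: "(norm (z :: complex ^ 'n::finite))\<^sup>2 = (\<Sum>k\<in>UNIV. (cmod (z $ k))\<^sup>2)"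
  by (simp add: norm_vec_def L2_set_def sum_nonneg)

lemma ginibre_weight_eq:
  fixes z :: "complex ^ 'n::{finite,linorder}"
  shows "ginibre_weight z = (cmod (vander z))\<^sup>2 * gauss (real CARD('n)) z"
proof -
  have "(\<Prod>(j, k)\<in>{(j, k). j < k}. (cmod (z $ j - z $ k))\<^sup>2) = (cmod (vander z))\<^sup>2"
    unfolding vander_def pairs_def prod_norm[symmetric] prod_power_distrib by (intro prod.cong) auto
  then show ?thesis by (simp add: ginibre_weight_def gauss_def norm_vec_square)
qed

lemma ginibre_weight_nonneg: "ginibre_weight z \<ge> 0"
  by (simp add: ginibre_weight_eq gauss_def)

lemma continuous_vander: "continuous_on A vander"
  using C1_continuous[OF polyfun_C1[OF polyfun_vander]] continuous_on_subset by blast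

lemma continuous_ginibre_weight: "continuous_on UNIV ginibre_weight"
proof -
  have "continuous_on UNIV (\<lambda>z::complex ^ 'n::{finite,linorder}. (cmod (vander z))\<^sup>2 * gauss (real CARD('n)) z)"
    by (intro continuous_intros continuous_vander continuous_gauss)
  then show ?thesis unfolding ginibre_weight_eq[symmetric] .
qed

lemma ginibre_weight_measurable [measurable]: "ginibre_weight \<in> borel_measurable borel"
  by (intro borel_measurable_continuous_onI continuous_ginibre_weight)

lemma polyfun_weight_integrable:
  fixes p :: "complex ^ 'n::{finite,linorder} \<Rightarrow> complex"
  assumes "polyfun p" shows "integrable lborel (\<lambda>z. (cmod (p z))\<^sup>2 * ginibre_weight z)"
proof -
  have "integrable lborel (\<lambda>z. (cmod (p z * vander z))\<^sup>2 * gauss (real CARD('n)) z)"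
    by (intro polyfun_square_integrable polyfun_mult polyfun_vander assms) simp
  then show ?thesis by (simp add: ginibre_weight_eq norm_mult power_mult_distrib mult.assoc)
qed

lemma ginibre_weight_integrable: "integrable lborel ginibre_weight"
  using polyfun_weight_integrable[OF polyfun_const[of 1]] by simp

text \<open>
A continuous function that is not identically zero is nonzero on a nonempty open set, which is not negligible.
\<close>

lemma integral_pos_of_continuous:
  fixes F :: "'a::euclidean_space \<Rightarrow> real"
  assumes F: "continuous_on UNIV F" "integrable lborel F" "\<And>z. F z \<ge> 0" and z: "F z0 \<noteq> 0"
  shows "(LINT z|lborel. F z) > 0"
proof -
  let ?S = "{z. F z \<noteq> 0}"
  have "(LINT z|lborel. F z) \<noteq> 0"
  proof
    assume "(LINT z|lborel. F z) = 0"
    then have "AE z in lborel. F z = 0" using integral_nonneg_eq_0_iff_AE[OF F(2)] F(3) by simp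
    moreover have op: "open ?S" using open_Collect_neq[OF F(1) continuous_on_const[of UNIV 0]] .
    ultimately have "?S \<in> null_sets lborel" by (subst AE_iff_null_sets) auto
    then have "negligible ?S" unfolding negligible_iff_null_sets by (rule null_sets_completionI)
    then show False using open_not_negligible[OF op] z by blast
  qed
  moreover have "(LINT z|lborel. F z) \<ge> 0" using F(3) by (rule Bochner_Integration.integral_nonneg)
  ultimately show ?thesis by simp
qed

lemma ginibre_const_pos: "ginibre_const TYPE('n::{finite,linorder}) > 0"
proof -
  obtain z :: "(complex, 'n) vec" where "vander z \<noteq> 0" using vander_nonzero by blast
  then have "ginibre_weight z \<noteq> 0" by (simp add: ginibre_weight_eq gauss_def)
  then show ?thesis unfolding ginibre_const_def
    by (rule integral_pos_of_continuous[OF continuous_ginibre_weight ginibre_weight_integrable ginibre_weight_nonneg])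
qed

lemma sets_ginibre: "sets ginibre = sets borel"
  by (simp add: ginibre_def)

lemma measurable_ginibre: "(f \<in> borel_measurable ginibre) = (f \<in> borel_measurable borel)"
  using measurable_cong_sets[OF sets_ginibre refl] by blast

lemma integral_ginibre:
  fixes f :: "complex ^ 'n::{finite,linorder} \<Rightarrow> real"
  assumes "f \<in> borel_measurable borel"
  shows "(LINT z|ginibre. f z) = (LINT z|lborel. f z * ginibre_weight z) / ginibre_const TYPE('n)"
    and "integrable ginibre f \<longleftrightarrow> integrable lborel (\<lambda>z. f z * ginibre_weight z)"
proof -
  let ?c = "ginibre_const TYPE('n)"
  have c: "?c > 0" by (rule ginibre_const_pos)
  have m: "(\<lambda>z::complex ^ 'n::{finite,linorder}. ginibre_weight z / ?c) \<in> borel_measurable lborel" by measurable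
  have nn: "AE z in lborel. 0 \<le> ginibre_weight (z::complex ^ 'n::{finite,linorder}) / ?c"
    by (intro AE_I2 divide_nonneg_pos ginibre_weight_nonneg c)
  have f: "f \<in> borel_measurable lborel" using assms by simp
  have e: "(\<lambda>z. (ginibre_weight z / ?c) *\<^sub>R f z) = (\<lambda>z. f z * ginibre_weight z / ?c)"
    by (simp add: mult.commute)
  show "(LINT z|ginibre. f z) = (LINT z|lborel. f z * ginibre_weight z) / ?c"
    unfolding ginibre_def integral_density[OF f m nn] e by (rule integral_divide_zero)
  have "integrable ginibre f \<longleftrightarrow> integrable lborel (\<lambda>z. f z * ginibre_weight z / ?c)"
    unfolding ginibre_def integrable_density[OF f m nn] e ..
  also have "\<dots> \<longleftrightarrow> integrable lborel (\<lambda>z. f z * ginibre_weight z)"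
  proof
    assume "integrable lborel (\<lambda>z. f z * ginibre_weight z / ?c)"
    from integrable_mult_right[OF this, of ?c] show "integrable lborel (\<lambda>z. f z * ginibre_weight z)" using c by simp
  qed simp
  finally show "integrable ginibre f \<longleftrightarrow> integrable lborel (\<lambda>z. f z * ginibre_weight z)" .
qed

lemma prob_space_ginibre: "prob_space (ginibre :: (complex ^ 'n::{finite,linorder}) measure)"
proof
  let ?M = "ginibre :: (complex ^ 'n::{finite,linorder}) measure"
  let ?c = "ginibre_const TYPE('n)"
  have "emeasure ?M (space ?M) = (\<integral>\<^sup>+z. ennreal (ginibre_weight (z :: complex ^ 'n::{finite,linorder}) / ?c) \<partial>lborel)"
    unfolding ginibre_def by (subst emeasure_density) (auto simp: ginibre_weight_measurable)
  also have "\<dots> = ennreal (LINT z|lborel. ginibre_weight (z :: complex ^ 'n::{finite,linorder}) / ?c)"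
    using ginibre_const_pos[where 'n='n] ginibre_weight_integrable
    by (intro nn_integral_eq_integral) (auto simp: ginibre_weight_nonneg)
  also have "(LINT z|lborel. ginibre_weight (z :: complex ^ 'n::{finite,linorder}) / ?c) = 1"
    using ginibre_const_pos[where 'n='n] by (simp add: ginibre_const_def)
  finally show "emeasure ?M (space ?M) = 1" by simp
qed

lemma finite_measure_ginibre: "finite_measure (ginibre :: (complex ^ 'n::{finite,linorder}) measure)"
  using prob_space_ginibre prob_space_def by blast

lemmas ginibre_test_L2 = test_L2[OF finite_measure_ginibre sets_ginibre]
  and ginibre_test_grad_L2 = test_grad_L2[OF finite_measure_ginibre sets_ginibre]
  and ginibre_closure_add = grad_closure_add[OF finite_measure_ginibre sets_ginibre]
  and ginibre_closure_scale = grad_closure_scale[OF finite_measure_ginibre sets_ginibre]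
  and ginibre_closure_smooth = grad_closure_smooth[OF finite_measure_ginibre sets_ginibre]

lemma const_L2: "(\<lambda>z. c) \<in> L2 (ginibre :: (complex ^ 'n::{finite,linorder}) measure)"
proof -
  interpret prob_space "ginibre :: (complex ^ 'n::{finite,linorder}) measure" by (rule prob_space_ginibre)
  show ?thesis by (simp add: L2_def)
qed

lemma L2_ginibre_integrable:
  fixes f :: "complex ^ 'n::{finite,linorder} \<Rightarrow> real"
  assumes "f \<in> L2 ginibre" shows "integrable ginibre f" "integrable ginibre (\<lambda>z. (f z)\<^sup>2)"
  using L2_inner_integrable[OF assms const_L2[of 1]] L2_integrable[OF assms] by simp_all

lemma integral_const_ginibre: "(LINT z|(ginibre :: (complex ^ 'n::{finite,linorder}) measure). (c::real)) = c"
proof -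
  interpret prob_space "ginibre :: (complex ^ 'n::{finite,linorder}) measure" by (rule prob_space_ginibre)
  show ?thesis by (simp add: prob_space)
qed

lemma distr_ginibre:
  fixes T :: "complex ^ 'n::{finite,linorder} \<Rightarrow> (complex, 'n) vec"
  assumes T: "orthogonal_transformation T" and w: "\<And>z. ginibre_weight (T z) = ginibre_weight z"
  shows "distr ginibre ginibre T = ginibre"
proof -
  have "continuous_on UNIV T"
    using T by (simp add: orthogonal_transformation_def linear_continuous_on linear_conv_bounded_linear)
  then have [measurable]: "T \<in> borel_measurable borel" by (rule borel_measurable_continuous_onI)
  let ?w = "\<lambda>z. ennreal (ginibre_weight z / ginibre_const TYPE('n))"
  have "ginibre = density (distr lborel borel T) ?w"
    unfolding lborel_distr_orthogonal_transformation[OF T] ginibre_def ..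
  also have "\<dots> = distr (density lborel (\<lambda>z. ?w (T z))) borel T"
    by (rule density_distr) measurable
  also have "\<dots> = distr ginibre borel T" by (simp add: w ginibre_def)
  also have "\<dots> = distr ginibre ginibre T" by (rule distr_cong) (simp_all add: sets_ginibre)
  finally show ?thesis ..
qed

lemma
  fixes T :: "complex ^ 'n::{finite,linorder} \<Rightarrow> (complex, 'n) vec" and f :: "(complex, 'n) vec \<Rightarrow> 'b::euclidean_space"
  assumes T: "orthogonal_transformation T" and w: "\<And>z. ginibre_weight (T z) = ginibre_weight z"
    and f: "f \<in> borel_measurable ginibre"
  shows integral_ginibre_compose: "(LINT z|ginibre. f (T z)) = (LINT z|ginibre. f z)"
    and integrable_ginibre_compose: "integrable ginibre f \<Longrightarrow> integrable ginibre (\<lambda>z. f (T z))"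
    and measurable_ginibre_compose: "(\<lambda>z. f (T z)) \<in> borel_measurable ginibre"
proof -
  have "continuous_on UNIV T"
    using T by (simp add: orthogonal_transformation_def linear_continuous_on linear_conv_bounded_linear)
  then have "T \<in> borel_measurable borel" by (rule borel_measurable_continuous_onI)
  then have m: "T \<in> measurable ginibre ginibre" using measurable_cong_sets[OF sets_ginibre sets_ginibre] by blast
  show "(LINT z|ginibre. f (T z)) = (LINT z|ginibre. f z)"
    using integral_distr[OF m f] unfolding distr_ginibre[OF T w] by simp
  show "integrable ginibre f \<Longrightarrow> integrable ginibre (\<lambda>z. f (T z))"
    using integrable_distr_eq[OF m f] unfolding distr_ginibre[OF T w] by simp
  show "(\<lambda>z. f (T z)) \<in> borel_measurable ginibre" by (rule measurable_compose[OF m f])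
qed

lemma ginibre_weight_perm_vec:
  fixes z :: "complex ^ 'n::{finite,linorder}"
  assumes "\<sigma> permutes UNIV" shows "ginibre_weight (perm_vec \<sigma> z) = ginibre_weight z"
proof -
  have "cmod (of_int (sign \<sigma>)) = 1" by (simp add: sign_def)
  then show ?thesis by (simp add: ginibre_weight_eq vander_perm_vec[OF assms] norm_mult gauss_def norm_perm_vec[OF assms])
qed

lemmas perm_vec_invariance = integral_ginibre_compose[OF orthogonal_transformation_perm_vec ginibre_weight_perm_vec]
  integrable_ginibre_compose[OF orthogonal_transformation_perm_vec ginibre_weight_perm_vec]
  measurable_ginibre_compose[OF orthogonal_transformation_perm_vec ginibre_weight_perm_vec]

section \<open>The inequality\<close>

lemma norm_grad_square:
  fixes f :: "complex ^ 'n::finite \<Rightarrow> real"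
  assumes "f differentiable (at z)"
  shows "(norm (grad f z))\<^sup>2 = (\<Sum>k\<in>UNIV. (frechet_derivative f (at z) (axis k 1))\<^sup>2 + (frechet_derivative f (at z) (axis k \<i>))\<^sup>2)"
  unfolding grad_gderiv(2)[OF assms] norm_vec_square cmod_power2
  by (simp add: inner_axis inner_complex_def)

lemma poincare_ginibre_test:
  fixes \<psi> :: "complex ^ 'n::{finite,linorder} \<Rightarrow> real"
  assumes \<psi>: "\<psi> \<in> test_functions" and sym: "symmetric_fun \<psi>" and mean: "(LINT z|ginibre. \<psi> z) = 0"
  shows "(LINT z|ginibre. (\<psi> z)\<^sup>2) \<le> 1 / (2 * real CARD('n)) * (LINT z|ginibre. (norm (grad \<psi> z))\<^sup>2)"
proof -
  let ?c = "ginibre_const TYPE('n)" and ?b = "real CARD('n)"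
  have c: "?c > 0" by (rule ginibre_const_pos)
  have tc: "times_cont_diff k \<psi>" and bs: "bdd_supp \<psi>" for k using \<psi> by (auto simp: test_functions_iff)
  have d\<psi>: "\<psi> differentiable (at z)" for z by (rule test_differentiable[OF \<psi>])
  have m\<psi>: "\<psi> \<in> borel_measurable borel" by (intro borel_measurable_continuous_onI times_cont_diff_continuous[OF tc])
  have cg: "continuous_on UNIV (grad \<psi>)" by (rule continuous_grad[OF tc])
  have "(LINT z|lborel. \<psi> z * ginibre_weight z) = 0"
    using mean c unfolding integral_ginibre(1)[OF m\<psi>] by simp
  then have mean': "(LINT z|lborel. \<psi> z * ((cmod (vander z))\<^sup>2 * gauss ?b z)) = 0" by (simp add: ginibre_weight_eq)
  let ?F = "\<lambda>k z. (frechet_derivative \<psi> (at z) (axis k 1))\<^sup>2 + (frechet_derivative \<psi> (at z) (axis k \<i>))\<^sup>2"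
  have iF: "integrable lborel (\<lambda>z. ?F k z * ginibre_weight z)" for k
  proof (rule integrable_bdd_supp)
    have "continuous_on UNIV (\<lambda>z. frechet_derivative \<psi> (at z) v)" for v
      using times_cont_diff_continuous[OF times_cont_diff_deriv[OF tc]] .
    then show "continuous_on UNIV (\<lambda>z. ?F k z * ginibre_weight z)"
      by (intro continuous_intros continuous_ginibre_weight)
    obtain R where R: "\<And>z. norm z > R \<Longrightarrow> grad \<psi> z = 0" using bdd_supp_grad[OF bs] unfolding bdd_supp_def by blast
    have "?F k z * ginibre_weight z = 0" if "norm z > R" for z
      using R[OF that] unfolding grad_gderiv(2)[OF d\<psi>] by simp
    then show "bdd_supp (\<lambda>z. ?F k z * ginibre_weight z)" unfolding bdd_supp_def by blast
  qed
  have "(LINT z|lborel. (\<psi> z)\<^sup>2 * ginibre_weight z) \<le> 1 / (2 * ?b) * (\<Sum>k\<in>UNIV. LINT z|lborel. ?F k z * ginibre_weight z)"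
    unfolding ginibre_weight_eq by (rule poincare_symmetric_test[OF tc bs sym _ mean']) simp
  also have "(\<Sum>k\<in>UNIV. LINT z|lborel. ?F k z * ginibre_weight z) = (LINT z|lborel. (norm (grad \<psi> z))\<^sup>2 * ginibre_weight z)"
    unfolding norm_grad_square[OF d\<psi>] sum_distrib_right by (rule Bochner_Integration.integral_sum[symmetric]) (rule iF)
  finally have "(LINT z|lborel. (\<psi> z)\<^sup>2 * ginibre_weight z) / ?c \<le> (1 / (2 * ?b) * (LINT z|lborel. (norm (grad \<psi> z))\<^sup>2 * ginibre_weight z)) / ?c"
    using c by (intro divide_right_mono) auto
  then show ?thesis
    using m\<psi> borel_measurable_continuous_onI[OF cg] by (subst (1 2) integral_ginibre(1)) auto
qed

lemma norm_average_square_le: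
  fixes v :: "'i \<Rightarrow> 'b::euclidean_space"
  assumes "finite I" "I \<noteq> {}"
  shows "(norm ((1 / real (card I)) *\<^sub>R (\<Sum>i\<in>I. v i)))\<^sup>2 \<le> (1 / real (card I)) * (\<Sum>i\<in>I. (norm (v i))\<^sup>2)"
proof -
  have n: "real (card I) > 0" using assms by (simp add: card_gt_0_iff)
  have "(norm (\<Sum>i\<in>I. v i))\<^sup>2 \<le> (\<Sum>i\<in>I. norm (v i))\<^sup>2" by (intro power_mono norm_sum) auto
  also have "\<dots> \<le> (\<Sum>i\<in>I. (norm (v i))\<^sup>2) * real (card I)" by (rule sum_squared_le_sum_of_squares)
  finally have "(1 / real (card I))\<^sup>2 * (norm (\<Sum>i\<in>I. v i))\<^sup>2 \<le> (1 / real (card I))\<^sup>2 * ((\<Sum>i\<in>I. (norm (v i))\<^sup>2) * real (card I))"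
    by (rule mult_left_mono) simp
  also have "(1 / N)\<^sup>2 * (Q * N) = (1 / N) * Q" if "N > 0" for N Q :: real
    using that by (simp add: power2_eq_square)
  note this[OF n]
  finally show ?thesis unfolding norm_scaleR power_mult_distrib power2_abs .
qed

definition symmetrize :: "(complex ^ 'n::finite \<Rightarrow> real) \<Rightarrow> (complex, 'n) vec \<Rightarrow> real" where
  "symmetrize p z = (1 / real (card {\<sigma>. \<sigma> permutes (UNIV :: 'n set)})) * (\<Sum>\<sigma> | \<sigma> permutes UNIV. p (perm_vec \<sigma> z))"

lemma perms_finite_nonempty: "finite {\<sigma>. \<sigma> permutes (UNIV :: 'n::finite set)}" "{\<sigma>. \<sigma> permutes (UNIV :: 'n::finite set)} \<noteq> {}"
proof -
  show "finite {\<sigma>. \<sigma> permutes (UNIV :: 'n set)}" by (rule finite_permutations) simp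
  show "{\<sigma>. \<sigma> permutes (UNIV :: 'n set)} \<noteq> {}" using permutes_id by blast
qed

lemma average_const:
  assumes "finite I" "I \<noteq> {}" shows "(1 / real (card I)) * (\<Sum>i\<in>I. x) = (x :: real)"
proof -
  have "(1 / N) * (N * x) = x" if "N > 0" for N using that by simp
  moreover have "real (card I) > 0" using assms by (simp add: card_gt_0_iff)
  ultimately show ?thesis unfolding sum_constant by blast
qed

lemma symmetric_symmetrize:
  fixes p :: "complex ^ 'n::finite \<Rightarrow> real"
  shows "symmetric_fun (symmetrize p)"
  unfolding symmetric_fun_def
proof (intro allI impI)
  fix \<tau> :: "'n \<Rightarrow> 'n" and z :: "(complex, 'n) vec" assume \<tau>: "\<tau> permutes UNIV"
  have "(\<Sum>\<sigma> | \<sigma> permutes UNIV. p (perm_vec \<sigma> z)) = (\<Sum>\<sigma> | \<sigma> permutes UNIV. p (perm_vec (\<tau> \<circ> \<sigma>) z))"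
    by (rule setum_permutations_compose_left[OF \<tau>])
  then show "symmetrize p (\<chi> k. z $ \<tau> k) = symmetrize p z"
    unfolding symmetrize_def perm_vec_compose perm_vec_def[of \<tau> z, symmetric] by simp
qed

lemma test_symmetrize: 
  fixes p :: "complex ^ 'n::finite \<Rightarrow> real"
  assumes "p \<in> test_functions" shows "symmetrize p \<in> test_functions"
proof -
  have t: "(\<lambda>z. p (perm_vec \<sigma> z)) \<in> test_functions" if "\<sigma> permutes UNIV" for \<sigma>
  proof -
    have bl: "bounded_linear (perm_vec \<sigma>)" using linear_perm_vec linear_conv_bounded_linear by blast
    obtain R where R: "\<And>z. norm z > R \<Longrightarrow> p z = 0" using assms unfolding test_functions_iff bdd_supp_def by blast
    have "bdd_supp (\<lambda>z. p (perm_vec \<sigma> z))"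
      unfolding bdd_supp_def using R by (intro exI[of _ R] allI impI) (simp only: norm_perm_vec[OF that])
    moreover have "times_cont_diff k (\<lambda>z. p (perm_vec \<sigma> z))" for k
      using assms unfolding test_functions_iff by (intro times_cont_diff_compose_linear[OF bl]) blast
    ultimately show ?thesis unfolding test_functions_iff by blast
  qed
  have sums: "(\<lambda>z. \<Sum>\<sigma>\<in>I. p (perm_vec \<sigma> z)) \<in> test_functions" if "finite I" "\<And>\<sigma>. \<sigma> \<in> I \<Longrightarrow> \<sigma> permutes UNIV" for I
    using that
  proof (induction I rule: finite_induct)
    case empty
    show ?case unfolding test_functions_iff by (auto simp: times_cont_diff_const bdd_supp_def)
  next
    case (insert \<sigma> I)
    then show ?case using test_add[OF t[of \<sigma>]] by simp
  qed
  show ?thesis unfolding symmetrize_def[abs_def] by (intro test_scale sums perms_finite_nonempty(1)) simp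
qed

text \<open>
Permuting the coordinates is an isometry and does not change the length of the gradient; the rest is Jensen's inequality for the average.
\<close>

lemma norm_grad_symmetrize_le:
  fixes p :: "complex ^ 'n::finite \<Rightarrow> real"
  assumes "p \<in> test_functions"
  shows "(norm (grad (symmetrize p) z))\<^sup>2 \<le> (1 / real (card {\<sigma>. \<sigma> permutes (UNIV :: 'n set)})) * (\<Sum>\<sigma> | \<sigma> permutes UNIV. (norm (grad p (perm_vec \<sigma> z)))\<^sup>2)"
proof -
  let ?P = "{\<sigma>. \<sigma> permutes (UNIV :: 'n set)}"
  have dp: "p differentiable (at x)" for x by (rule test_differentiable[OF assms])
  have dc: "((\<lambda>z. p (perm_vec \<sigma> z)) has_derivative (\<lambda>v. grad p (perm_vec \<sigma> z) \<bullet> perm_vec \<sigma> v)) (at z)" for \<sigma> z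
  proof -
    have "(p has_derivative (\<lambda>v. grad p (perm_vec \<sigma> z) \<bullet> v)) (at (perm_vec \<sigma> z))"
      using grad_gderiv(1)[OF dp] unfolding gderiv_def by (simp add: inner_commute)
    moreover have "(perm_vec \<sigma> has_derivative perm_vec \<sigma>) (at z)"
      by (rule bounded_linear_imp_has_derivative) (simp add: linear_perm_vec linear_conv_bounded_linear[symmetric])
    ultimately show ?thesis using has_derivative_compose by blast
  qed
  have dd: "(\<lambda>z. p (perm_vec \<sigma> z)) differentiable (at z)" for \<sigma> z using dc by (rule differentiableI)
  have ng: "norm (grad (\<lambda>z. p (perm_vec \<sigma> z)) z) \<le> norm (grad p (perm_vec \<sigma> z))" if "\<sigma> permutes UNIV" for \<sigma>
  proof -
    let ?g = "grad (\<lambda>z. p (perm_vec \<sigma> z)) z"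
    have "norm ?g * norm ?g = frechet_derivative (\<lambda>z. p (perm_vec \<sigma> z)) (at z) ?g"
      unfolding grad_gderiv(2)[OF dd] by (simp add: power2_norm_eq_inner[symmetric] power2_eq_square)
    also have "\<dots> = grad p (perm_vec \<sigma> z) \<bullet> perm_vec \<sigma> ?g" using frechet_derivative_at[OF dc] by metis
    also have "\<dots> \<le> norm (grad p (perm_vec \<sigma> z)) * norm (perm_vec \<sigma> ?g)" by (rule norm_cauchy_schwarz)
    finally show ?thesis unfolding norm_perm_vec[OF that] by (cases "norm ?g = 0") auto
  qed
  have sumg: "grad (\<lambda>z. \<Sum>\<sigma>\<in>I. p (perm_vec \<sigma> z)) z = (\<Sum>\<sigma>\<in>I. grad (\<lambda>z. p (perm_vec \<sigma> z)) z)" 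
    and sumd: "(\<lambda>z. \<Sum>\<sigma>\<in>I. p (perm_vec \<sigma> z)) differentiable (at z)" if "finite I" for I
    using that by (induction I rule: finite_induct) (simp_all add: grad_const grad_add dd)
  have "grad (symmetrize p) z = (1 / real (card ?P)) *\<^sub>R (\<Sum>\<sigma>\<in>?P. grad (\<lambda>z. p (perm_vec \<sigma> z)) z)"
    unfolding symmetrize_def[abs_def] grad_scale[OF sumd[OF perms_finite_nonempty(1)]] sumg[OF perms_finite_nonempty(1)] ..
  then have "(norm (grad (symmetrize p) z))\<^sup>2 \<le> (1 / real (card ?P)) * (\<Sum>\<sigma>\<in>?P. (norm (grad (\<lambda>z. p (perm_vec \<sigma> z)) z))\<^sup>2)"
    using norm_average_square_le[OF perms_finite_nonempty] by simp
  also have "\<dots> \<le> (1 / real (card ?P)) * (\<Sum>\<sigma>\<in>?P. (norm (grad p (perm_vec \<sigma> z)))\<^sup>2)"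
    by (intro mult_left_mono sum_mono power_mono ng) auto
  finally show ?thesis .
qed

text \<open>
  Permutations of the coordinates preserve the measure, so each term of the average has the integral of \<open>h\<close>.
\<close>

lemma integral_le_of_permutation_average:
  fixes F h :: "complex ^ 'n::{finite,linorder} \<Rightarrow> real"
  assumes h: "integrable ginibre h" and F: "integrable ginibre F"
    and le: "\<And>z. F z \<le> (1 / real (card {\<sigma>. \<sigma> permutes (UNIV :: 'n set)})) * (\<Sum>\<sigma> | \<sigma> permutes UNIV. h (perm_vec \<sigma> z))"
  shows "(LINT z|ginibre. F z) \<le> (LINT z|ginibre. h z)"
proof -
  let ?P = "{\<sigma>. \<sigma> permutes (UNIV :: 'n set)}"
  have n: "real (card ?P) > 0" using perms_finite_nonempty[where 'n='n] by (simp add: card_gt_0_iff)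
  have hm: "h \<in> borel_measurable ginibre" using h by auto
  have i: "integrable ginibre (\<lambda>z. h (perm_vec \<sigma> z))" if "\<sigma> \<in> ?P" for \<sigma>
    using perm_vec_invariance(2)[OF _ _ hm h] that by simp
  have "(LINT z|ginibre. F z) \<le> (LINT z|ginibre. (1 / real (card ?P)) * (\<Sum>\<sigma>\<in>?P. h (perm_vec \<sigma> z)))"
    using i by (intro integral_mono F integrable_mult_right Bochner_Integration.integrable_sum le)
  also have "\<dots> = (1 / real (card ?P)) * (\<Sum>\<sigma>\<in>?P. LINT z|ginibre. h (perm_vec \<sigma> z))"
    using i by (simp add: Bochner_Integration.integral_sum)
  also have "(\<Sum>\<sigma>\<in>?P. LINT z|ginibre. h (perm_vec \<sigma> z)) = (\<Sum>\<sigma>\<in>?P. LINT z|ginibre. h z)"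
    using perm_vec_invariance(1)[OF _ _ hm] by (intro sum.cong) auto
  also have "(1 / real (card ?P)) * (\<Sum>\<sigma>\<in>?P. LINT z|ginibre. h z) = (LINT z|ginibre. h z)" by (rule average_const[OF perms_finite_nonempty])
  finally show ?thesis .
qed

lemma integral_symmetrize:
  fixes p :: "complex ^ 'n::{finite,linorder} \<Rightarrow> real"
  assumes p: "integrable ginibre p"
  shows "(LINT z|ginibre. symmetrize p z) = (LINT z|ginibre. p z)"
proof -
  let ?P = "{\<sigma>. \<sigma> permutes (UNIV :: 'n set)}"
  have n: "real (card ?P) > 0" using perms_finite_nonempty[where 'n='n] by (simp add: card_gt_0_iff)
  have m: "p \<in> borel_measurable ginibre" using p by auto
  have i: "integrable ginibre (\<lambda>z. p (perm_vec \<sigma> z))" if "\<sigma> \<in> ?P" for \<sigma>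
    using perm_vec_invariance(2)[OF _ _ m p] that by simp
  have "(LINT z|ginibre. symmetrize p z) = (1 / real (card ?P)) * (\<Sum>\<sigma>\<in>?P. LINT z|ginibre. p (perm_vec \<sigma> z))"
    unfolding symmetrize_def using i by (simp add: Bochner_Integration.integral_sum)
  also have "(\<Sum>\<sigma>\<in>?P. LINT z|ginibre. p (perm_vec \<sigma> z)) = (\<Sum>\<sigma>\<in>?P. LINT z|ginibre. p z)"
    using perm_vec_invariance(1)[OF _ _ m] by (intro sum.cong) auto
  finally show ?thesis unfolding average_const[OF perms_finite_nonempty] .
qed

lemma Var_eq:
  fixes f :: "complex ^ 'n::{finite,linorder} \<Rightarrow> real"
  assumes "f \<in> L2 ginibre"
  shows "Var ginibre f = (LINT z|ginibre. (f z - (LINT z|ginibre. f z))\<^sup>2)"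
proof -
  interpret prob_space "ginibre :: (complex ^ 'n::{finite,linorder}) measure" by (rule prob_space_ginibre)
  let ?a = "LINT z|ginibre. f z"
  have "(LINT z|ginibre. (f z - ?a)\<^sup>2) = (LINT z|ginibre. (f z)\<^sup>2 - (2 * ?a) * f z + ?a\<^sup>2)"
    by (rule Bochner_Integration.integral_cong) (auto simp: power2_eq_square algebra_simps)
  also have "\<dots> = (LINT z|ginibre. (f z)\<^sup>2) - 2 * ?a * ?a + (LINT z|(ginibre :: (complex ^ 'n::{finite,linorder}) measure). ?a\<^sup>2)"
    using L2_ginibre_integrable[OF assms] by simp
  also have "\<dots> = Var ginibre f" unfolding integral_const_ginibre Var_def by (simp add: power2_eq_square)
  finally show ?thesis ..
qed

text \<open>
Subtract the mean of \<open>f\<close>, approximate by test functions, correct their means by small multiples of a fixed bump and symmetrize.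
Symmetrization moves the approximants closer to the symmetric function \<open>f\<close> and does not increase their energy, so the inequality for
symmetric test functions passes to the limit.
\<close>

theorem poincare_ginibre:
  fixes f :: "complex ^ 'n::{finite,linorder} \<Rightarrow> real"
  assumes fg: "grad_closure ginibre f g" and sym: "symmetric_fun f"
  shows "Var ginibre f \<le> 1 / (2 * real CARD('n)) * (LINT z|ginibre. (norm (g z))\<^sup>2)"
proof -
  let ?M = "ginibre :: (complex ^ 'n::{finite,linorder}) measure"
  have fL: "f \<in> L2 ?M" and gL: "g \<in> L2 ?M" using fg by (auto simp: grad_closure_def)
  define a where "a = (LINT z|?M. f z)"
  define f0 where "f0 = (\<lambda>z. f z + (- a) * 1)"
  have one: "grad_closure ?M (\<lambda>z. 1) (grad (\<lambda>z. 1))"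
    by (rule ginibre_closure_smooth) (auto intro: times_cont_diff_const const_L2 simp: grad_const[abs_def])
  have fg0: "grad_closure ?M f0 g"
    using ginibre_closure_add[OF fg ginibre_closure_scale[OF one, of "- a"]] unfolding f0_def by (simp add: grad_const)
  then have f0L: "f0 \<in> L2 ?M" by (simp add: grad_closure_def)
  obtain \<phi> where \<phi>: "\<And>m. \<phi> m \<in> test_functions" "(\<lambda>m. L2_norm ?M (\<lambda>z. \<phi> m z - f0 z)) \<longlonglongrightarrow> 0" "(\<lambda>m. L2_norm ?M (\<lambda>z. grad (\<phi> m) z - g z)) \<longlonglongrightarrow> 0"
    using fg0 unfolding grad_closure_def by blast
  interpret prob_space ?M by (rule prob_space_ginibre)
  have mean0: "(LINT z|?M. f0 z) = 0"
    unfolding f0_def using L2_ginibre_integrable(1)[OF fL] by (simp add: a_def[symmetric] prob_space)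
  define e where "e = (\<lambda>m. LINT z|?M. \<phi> m z)"
  have e0: "e \<longlonglongrightarrow> 0"
    using L2_inner_tendsto[OF ginibre_test_L2[OF \<phi>(1)] f0L const_L2[of "1::real"] \<phi>(2)] mean0 unfolding e_def by simp
  \<comment> \<open>A fixed bump with positive mean, used to remove the mean of the approximants.\<close>
  let ?\<eta> = "cutoff 0 :: complex ^ 'n::{finite,linorder} \<Rightarrow> real"
  have \<eta>: "?\<eta> \<in> test_functions" by (rule cutoff_test_function)
  define I where "I = (LINT z|?M. ?\<eta> z)"
  have I0: "I \<noteq> 0"
  proof -
    have c: "ginibre_const TYPE('n) > 0" by (rule ginibre_const_pos)
    have c\<eta>: "continuous_on UNIV ?\<eta>" by (rule times_cont_diff_continuous[OF times_cont_diff_cutoff])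
    obtain z :: "(complex, 'n) vec" where z: "vander z \<noteq> 0" using vander_nonzero by blast
    define r where "r = 1 / (2 * (1 + norm z))"
    have r: "r > 0" unfolding r_def by (intro divide_pos_pos mult_pos_pos add_pos_nonneg) auto
    have nz: "norm (of_real r *s z) < 1"
    proof -
      have "norm (of_real r *s z) = r * norm z" using r by (simp add: norm_scalar_vec)
      also have "\<dots> = norm z / (2 * (1 + norm z))" by (simp add: r_def)
      also have "\<dots> < 1"
      proof -
        have "x / (2 * (1 + x)) < 1" if "0 \<le> x" for x :: real
          using that by (simp add: divide_less_eq)
        then show ?thesis by (simp only: norm_ge_zero)
      qed
      finally show ?thesis .
    qed
    have "?\<eta> (of_real r *s z) \<noteq> 0"
    proof -
      have "(norm (of_real r *s z))\<^sup>2 < 1" using nz by (simp add: power_less_one_iff abs_square_less_1)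
      then show ?thesis by (simp add: cutoff_def flat_def)
    qed
    moreover have "ginibre_weight (of_real r *s z) \<noteq> 0" using z r by (simp add: ginibre_weight_eq gauss_def vander_homogeneous)
    ultimately have "?\<eta> (of_real r *s z) * ginibre_weight (of_real r *s z) \<noteq> 0" by simp
    then have "(LINT z|lborel. ?\<eta> z * ginibre_weight z) > 0"
    proof (rule integral_pos_of_continuous[rotated 3])
      show "continuous_on UNIV (\<lambda>z. ?\<eta> z * ginibre_weight z)" by (intro continuous_intros c\<eta> continuous_ginibre_weight)
      show "integrable lborel (\<lambda>z. ?\<eta> z * ginibre_weight z)"
        using L2_ginibre_integrable(1)[OF ginibre_test_L2[OF \<eta>]] integral_ginibre(2)[OF borel_measurable_continuous_onI[OF c\<eta>]] by simp
      show "?\<eta> z * ginibre_weight z \<ge> 0" for z by (intro mult_nonneg_nonneg cutoff_nonneg ginibre_weight_nonneg)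
    qed
    then show ?thesis unfolding I_def integral_ginibre(1)[OF borel_measurable_continuous_onI[OF c\<eta>]] using c by simp
  qed
  define s where "s = (\<lambda>m. - (e m / I))"
  have s0: "s \<longlonglongrightarrow> 0" unfolding s_def using tendsto_minus[OF tendsto_divide[OF e0 tendsto_const I0]] by simp
  define p where "p = (\<lambda>m z. \<phi> m z + s m * ?\<eta> z)"
  have pt: "p m \<in> test_functions" for m unfolding p_def by (intro test_add test_scale \<phi> \<eta>)
  have pmean: "(LINT z|?M. p m z) = 0" for m
    unfolding p_def s_def using L2_ginibre_integrable(1)[OF ginibre_test_L2[OF \<phi>(1)[of m]]] L2_ginibre_integrable(1)[OF ginibre_test_L2[OF \<eta>]] I0
    by (simp add: e_def I_def[symmetric])
  have p1: "(\<lambda>m. L2_norm ?M (\<lambda>z. p m z - f0 z)) \<longlonglongrightarrow> 0"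
  proof -
    have "(\<lambda>m. L2_norm ?M (\<lambda>z. s m *\<^sub>R ?\<eta> z)) \<longlonglongrightarrow> 0"
      unfolding L2_norm_scaleR using tendsto_mult_left_zero[OF tendsto_rabs_zero[OF s0]] .
    then have "(\<lambda>m. L2_norm ?M (\<lambda>z. (\<phi> m z - f0 z) + s m *\<^sub>R ?\<eta> z)) \<longlonglongrightarrow> 0"
      by (intro L2_tendsto_add L2_diff L2_scaleR ginibre_test_L2 \<phi> f0L \<eta>)
    then show ?thesis by (simp add: p_def algebra_simps)
  qed
  have p2: "(\<lambda>m. L2_norm ?M (\<lambda>z. grad (p m) z - g z)) \<longlonglongrightarrow> 0"
  proof -
    have "(\<lambda>m. L2_norm ?M (\<lambda>z. s m *\<^sub>R grad ?\<eta> z)) \<longlonglongrightarrow> 0"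
      unfolding L2_norm_scaleR using tendsto_mult_left_zero[OF tendsto_rabs_zero[OF s0]] .
    then have "(\<lambda>m. L2_norm ?M (\<lambda>z. (grad (\<phi> m) z - g z) + s m *\<^sub>R grad ?\<eta> z)) \<longlonglongrightarrow> 0"
      by (intro L2_tendsto_add L2_diff L2_scaleR ginibre_test_grad_L2 \<phi> gL \<eta>)
    moreover have "grad (p m) z = grad (\<phi> m) z + s m *\<^sub>R grad ?\<eta> z" for m z
      unfolding p_def using test_differentiable[OF \<phi>(1)] test_differentiable[OF \<eta>] test_differentiable[OF test_scale[OF \<eta>]]
      by (simp add: grad_add grad_scale)
    ultimately show ?thesis by (simp add: algebra_simps)
  qed
  define \<psi> where "\<psi> = (\<lambda>m. symmetrize (p m))"
  have \<psi>t: "\<psi> m \<in> test_functions" for m unfolding \<psi>_def by (rule test_symmetrize[OF pt])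
  have key: "(LINT z|?M. (norm (\<psi> m z))\<^sup>2) \<le> 1 / (2 * real CARD('n)) * (LINT z|?M. (norm (grad (p m) z))\<^sup>2)" for m
  proof -
    have "(LINT z|?M. \<psi> m z) = 0"
      unfolding \<psi>_def using integral_symmetrize[OF L2_ginibre_integrable(1)[OF ginibre_test_L2[OF pt]]] pmean by simp
    then have "(LINT z|?M. (\<psi> m z)\<^sup>2) \<le> 1 / (2 * real CARD('n)) * (LINT z|?M. (norm (grad (\<psi> m) z))\<^sup>2)"
      using \<psi>t by (intro poincare_ginibre_test) (auto simp: \<psi>_def symmetric_symmetrize)
    moreover have "(LINT z|?M. (norm (grad (\<psi> m) z))\<^sup>2) \<le> (LINT z|?M. (norm (grad (p m) z))\<^sup>2)"
      unfolding \<psi>_def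
      by (intro integral_le_of_permutation_average L2_integrable ginibre_test_grad_L2 pt test_symmetrize norm_grad_symmetrize_le)
    then have "1 / (2 * real CARD('n)) * (LINT z|?M. (norm (grad (\<psi> m) z))\<^sup>2) \<le> 1 / (2 * real CARD('n)) * (LINT z|?M. (norm (grad (p m) z))\<^sup>2)"
      by (rule mult_left_mono) simp
    ultimately show ?thesis unfolding real_norm_def power2_abs by (rule order_trans)
  qed
  have "(\<lambda>m. L2_norm ?M (\<lambda>z. \<psi> m z - f0 z)) \<longlonglongrightarrow> 0"
    unfolding L2_norm_tendsto_0_iff
  proof (rule tendsto_sandwich[OF always_eventually always_eventually tendsto_const p1[unfolded L2_norm_tendsto_0_iff]])
    show "\<forall>m. (LINT z|?M. (norm (\<psi> m z - f0 z))\<^sup>2) \<le> (LINT z|?M. (norm (p m z - f0 z))\<^sup>2)"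
    proof
      fix m
      let ?P = "{\<sigma>. \<sigma> permutes (UNIV :: 'n set)}"
      have n: "real (card ?P) > 0" using perms_finite_nonempty[where 'n='n] by (simp add: card_gt_0_iff)
      show "(LINT z|?M. (norm (\<psi> m z - f0 z))\<^sup>2) \<le> (LINT z|?M. (norm (p m z - f0 z))\<^sup>2)"
      proof (rule integral_le_of_permutation_average)
        show "integrable ?M (\<lambda>z. (norm (p m z - f0 z))\<^sup>2)" "integrable ?M (\<lambda>z. (norm (\<psi> m z - f0 z))\<^sup>2)"
          by (intro L2_integrable L2_diff ginibre_test_L2 pt \<psi>t f0L)+
        fix z
        have f0s: "f0 (perm_vec \<sigma> z) = f0 z" if "\<sigma> \<in> ?P" for \<sigma>
          using sym that unfolding f0_def symmetric_fun_def perm_vec_def by simp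
        have "\<psi> m z - f0 z = (1 / real (card ?P)) *\<^sub>R (\<Sum>\<sigma>\<in>?P. p m (perm_vec \<sigma> z) - f0 (perm_vec \<sigma> z))"
        proof -
          have "(\<Sum>\<sigma>\<in>?P. f0 (perm_vec \<sigma> z)) = (\<Sum>\<sigma>\<in>?P. f0 z)" by (rule sum.cong[OF refl f0s])
          then show ?thesis
            unfolding real_scaleR_def sum_subtractf right_diff_distrib average_const[OF perms_finite_nonempty] \<psi>_def symmetrize_def
            by (simp only: average_const[OF perms_finite_nonempty])
        qed
        then show "(norm (\<psi> m z - f0 z))\<^sup>2 \<le> (1 / real (card ?P)) * (\<Sum>\<sigma>\<in>?P. (norm (p m (perm_vec \<sigma> z) - f0 (perm_vec \<sigma> z)))\<^sup>2)"
          using norm_average_square_le[OF perms_finite_nonempty, of "\<lambda>\<sigma>. p m (perm_vec \<sigma> z) - f0 (perm_vec \<sigma> z)"] by simp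
      qed
    qed
  qed simp
  then have l1: "(\<lambda>m. LINT z|?M. (norm (\<psi> m z))\<^sup>2) \<longlonglongrightarrow> (LINT z|?M. (norm (f0 z))\<^sup>2)"
    by (intro L2_square_tendsto ginibre_test_L2 \<psi>t f0L)
  have "(\<lambda>m. LINT z|?M. (norm (grad (p m) z))\<^sup>2) \<longlonglongrightarrow> (LINT z|?M. (norm (g z))\<^sup>2)"
    by (intro L2_square_tendsto ginibre_test_grad_L2 pt gL p2)
  then have l2: "(\<lambda>m. 1 / (2 * real CARD('n)) * (LINT z|?M. (norm (grad (p m) z))\<^sup>2)) \<longlonglongrightarrow> 1 / (2 * real CARD('n)) * (LINT z|?M. (norm (g z))\<^sup>2)"
    by (intro tendsto_intros)
  have "(LINT z|?M. (norm (f0 z))\<^sup>2) \<le> 1 / (2 * real CARD('n)) * (LINT z|?M. (norm (g z))\<^sup>2)"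
    by (rule LIMSEQ_le[OF l1 l2]) (use key in blast)
  then show ?thesis unfolding Var_eq[OF fL] by (simp add: f0_def a_def[symmetric])
qed

section \<open>Closability of the gradient\<close>

lemma gauss_has_derivative:
  "(gauss \<beta> has_derivative (\<lambda>v. - (2 * \<beta>) * (z \<bullet> v) * gauss \<beta> z)) (at (z :: complex ^ 'n::finite))"
proof -
  have "((\<lambda>z::complex ^ 'n. - \<beta> * (z \<bullet> z)) has_derivative (\<lambda>v. - \<beta> * (2 * (z \<bullet> v)))) (at z)"
    by (auto intro!: derivative_eq_intros simp: inner_commute algebra_simps)
  from has_derivative_compose[OF this DERIV_exp[unfolded has_field_derivative_def]]
  show ?thesis unfolding gauss_def[abs_def] power2_norm_eq_inner by (simp add: mult_ac)
qed

definition weight_deriv :: "complex ^ 'n::{finite,linorder} \<Rightarrow> complex ^ 'n::{finite,linorder} \<Rightarrow> real" where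
  "weight_deriv v z = 2 * Re (cnj (vander z) * ddir vander v z) * gauss (real CARD('n)) z
     - 2 * real CARD('n) * (z \<bullet> v) * ginibre_weight z"

lemma ginibre_weight_has_derivative:
  fixes z :: "complex ^ 'n::{finite,linorder}"
  shows "(ginibre_weight has_derivative (\<lambda>v. weight_deriv v z)) (at z)"
proof -
  have V: "(vander has_derivative (\<lambda>v. ddir vander v z)) (at z)"
    by (rule C1_has_derivative[OF polyfun_C1[OF polyfun_vander]])
  have VV: "((\<lambda>z. Re (cnj (vander z) * vander z)) has_derivative (\<lambda>v. Re (cnj (vander z) * ddir vander v z + cnj (ddir vander v z) * vander z))) (at z)"
    by (intro has_derivative_Re has_derivative_mult has_derivative_cnj V)
  have e: "ginibre_weight = (\<lambda>z::(complex, 'n) vec. Re (cnj (vander z) * vander z) * gauss (real CARD('n)) z)"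
    by (rule ext, unfold ginibre_weight_eq cmod_power2) (simp add: power2_eq_square)
  show ?thesis
    unfolding e
    by (rule has_derivative_eq_rhs[OF has_derivative_mult[OF VV gauss_has_derivative]])
       (rule ext, unfold weight_deriv_def ginibre_weight_eq cmod_power2, simp add: power2_eq_square algebra_simps)
qed

lemma continuous_weight_deriv: "continuous_on UNIV (weight_deriv v)"
proof -
  have "continuous_on UNIV (ddir vander v)" by (rule C1_continuous_ddir[OF polyfun_C1[OF polyfun_vander]])
  then show ?thesis unfolding weight_deriv_def[abs_def]
    by (intro continuous_intros continuous_vander continuous_gauss continuous_ginibre_weight)
qed

lemma C1_ginibre_weight: "C1 (\<lambda>z. of_real (ginibre_weight z))"
  and ddir_ginibre_weight: "ddir (\<lambda>z. of_real (ginibre_weight z)) v z = of_real (weight_deriv v z)"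
proof -
  have d: "((\<lambda>z. complex_of_real (ginibre_weight z)) has_derivative (\<lambda>v. of_real (weight_deriv v z))) (at z)" for z :: "complex ^ 'n::{finite,linorder}"
    by (rule has_derivative_of_real[OF ginibre_weight_has_derivative])
  show "C1 (\<lambda>z::complex ^ 'n::{finite,linorder}. of_real (ginibre_weight z))"
    by (rule C1I[OF d]) (intro continuous_intros continuous_weight_deriv)
  show "ddir (\<lambda>z. of_real (ginibre_weight z)) v z = of_real (weight_deriv v z)"
    by (rule ddir_eqI[OF d])
qed

lemma bdd_supp_of_zeros:
  assumes "bdd_supp u" "\<And>x. u x = 0 \<Longrightarrow> w x = 0" shows "bdd_supp w"
  using assms unfolding bdd_supp_def by metis

lemma ginibre_by_parts:
  fixes u w :: "complex ^ 'n::{finite,linorder} \<Rightarrow> real"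
  assumes u: "times_cont_diff (Suc 0) u" "bdd_supp u" and w: "times_cont_diff (Suc 0) w"
  shows "(LINT z|lborel. frechet_derivative u (at z) v * w z * ginibre_weight z)
    = - (LINT z|lborel. u z * (frechet_derivative w (at z) v * ginibre_weight z + w z * weight_deriv v z))"
proof -
  have bu: "bdd_supp (\<lambda>z. complex_of_real (u z))" using u(2) by (simp add: bdd_supp_def)
  note C1w = C1_mult[OF C1_of_real(1)[OF w] C1_ginibre_weight]
  have "complex_of_real (LINT z|lborel. frechet_derivative u (at z) v * w z * ginibre_weight z)
    = (LINT z|lborel. ddir (\<lambda>z. of_real (u z)) v z * (of_real (w z) * of_real (ginibre_weight z)))"
    unfolding C1_of_real(2)[OF u(1)] integral_complex_of_real[symmetric]
    by (rule Bochner_Integration.integral_cong) (auto simp: mult.assoc)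
  also have "\<dots> = - (LINT z|lborel. of_real (u z) * ddir (\<lambda>z. of_real (w z) * of_real (ginibre_weight z)) v z)"
    by (rule integral_by_parts[OF C1_of_real(1)[OF u(1)] bu C1w])
  also have "(LINT z|lborel. of_real (u z) * ddir (\<lambda>z. of_real (w z) * of_real (ginibre_weight z)) v z)
    = complex_of_real (LINT z|lborel. u z * (frechet_derivative w (at z) v * ginibre_weight z + w z * weight_deriv v z))"
    unfolding ddir_mult[OF C1_of_real(1)[OF w] C1_ginibre_weight] ddir_ginibre_weight C1_of_real(2)[OF w] integral_complex_of_real[symmetric]
    by (rule Bochner_Integration.integral_cong) (auto simp: algebra_simps)
  finally show ?thesis by (simp only: of_real_minus[symmetric] of_real_eq_iff)
qed

text \<open>
  The weight is the square of the Lipschitz function \<open>cmod (vander z) * gauss (n/2) z\<close>, so its derivative is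
  controlled by its square root.
\<close>

lemma dirichlet_form_bound:
  fixes \<theta> :: "complex ^ 'n::{finite,linorder} \<Rightarrow> real"
  assumes \<theta>: "\<theta> \<in> test_functions"
  obtains C where "\<And>\<phi>. \<phi> \<in> test_functions \<Longrightarrow> \<bar>LINT z|ginibre. grad \<phi> z \<bullet> grad \<theta> z\<bar> \<le> L2_norm ginibre \<phi> * C"
proof -
  let ?c = "ginibre_const TYPE('n)" and ?n = "real CARD('n)"
  have c: "?c > 0" by (rule ginibre_const_pos)
  define q where "q = (\<lambda>z::(complex, 'n) vec. cmod (vander z) * gauss (?n / 2) z)"
  have q2: "q z * q z = ginibre_weight z" for z
  proof -
    have "gauss (?n / 2) z * gauss (?n / 2) z = gauss ?n z" unfolding gauss_def exp_add[symmetric] by simp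
    moreover have "q z * q z = (cmod (vander z))\<^sup>2 * (gauss (?n / 2) z * gauss (?n / 2) z)"
      unfolding q_def power2_eq_square by (simp only: mult_ac)
    ultimately show ?thesis by (simp only: ginibre_weight_eq)
  qed
  have q0: "q z \<ge> 0" for z unfolding q_def gauss_def by simp
  have cq: "continuous_on UNIV q" unfolding q_def by (intro continuous_intros continuous_vander continuous_gauss)
  have t\<theta>: "times_cont_diff k \<theta>" and b\<theta>: "bdd_supp \<theta>" for k using \<theta> by (auto simp: test_functions_iff)
  define d where "d = (\<lambda>v z. frechet_derivative \<theta> (at z) v)"
  have td: "times_cont_diff k (d v)" for k v unfolding d_def using times_cont_diff_deriv[OF t\<theta>] .
  define s where "s = (\<lambda>v z. \<bar>frechet_derivative (d v) (at z) v\<bar> * q z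
       + \<bar>d v z\<bar> * ((2 * cmod (ddir vander v z) + 2 * ?n * \<bar>z \<bullet> v\<bar> * cmod (vander z)) * gauss (?n / 2) z))"
  have cs: "continuous_on UNIV (s v)" for v
  proof -
    have "continuous_on UNIV (\<lambda>z. frechet_derivative (d v) (at z) v)" by (rule times_cont_diff_continuous[OF times_cont_diff_deriv[OF td]])
    moreover have "continuous_on UNIV (d v)" by (rule times_cont_diff_continuous[OF td])
    moreover have "continuous_on UNIV (ddir vander v)" by (rule C1_continuous_ddir[OF polyfun_C1[OF polyfun_vander]])
    ultimately show ?thesis unfolding s_def by (intro continuous_intros cq continuous_vander continuous_gauss)
  qed
  obtain R where R: "\<And>z. norm z > R \<Longrightarrow> grad \<theta> z = 0" using bdd_supp_grad[OF b\<theta>] unfolding bdd_supp_def by blast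
  have d\<theta>: "\<theta> differentiable (at z)" for z by (rule test_differentiable[OF \<theta>])
  have d0: "d v z = 0" if "norm z > R" for v z unfolding d_def grad_gderiv(2)[OF d\<theta>] using R[OF that] by simp
  have dd: "d v differentiable (at z)" for v z using td[of 1 v] by simp
  have dd0: "frechet_derivative (d v) (at z) v = 0" if "norm z > R" for v z
  proof -
    have "bdd_supp (d v)" unfolding bdd_supp_def using d0 by blast
    have op: "open {z::(complex, 'n) vec. norm z > R}" by (intro open_Collect_less continuous_intros)
    have "(d v has_derivative (\<lambda>_. 0)) (at z)"
      by (rule has_derivative_transform_within_open[OF has_derivative_const[of 0] op]) (use d0 that in auto)
    then show ?thesis using frechet_derivative_at by metis
  qed
  have bs: "bdd_supp (s v)" for v unfolding bdd_supp_def s_def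
    by (intro exI[of _ R] allI impI) (simp only: d0 dd0 abs_zero mult_zero_left add_0)
  have sL: "s v \<in> L2 lborel" for v
  proof -
    have "integrable lborel (\<lambda>z. (norm (s v z))\<^sup>2)"
    proof (rule integrable_bdd_supp)
      show "continuous_on UNIV (\<lambda>z. (norm (s v z))\<^sup>2)" using cs by (intro continuous_intros)
      show "bdd_supp (\<lambda>z. (norm (s v z))\<^sup>2)" by (rule bdd_supp_of_zeros[OF bs]) simp
    qed
    moreover have "s v \<in> borel_measurable lborel" using borel_measurable_continuous_onI[OF cs] by simp
    ultimately show ?thesis by (simp add: L2_def)
  qed
  have main: "\<bar>LINT z|lborel. frechet_derivative \<phi> (at z) v * d v z * ginibre_weight z\<bar> \<le> (sqrt ?c * L2_norm ginibre \<phi>) * L2_norm lborel (s v)"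
    if \<phi>: "\<phi> \<in> test_functions" for \<phi> v
  proof -
    have t\<phi>: "times_cont_diff k \<phi>" and b\<phi>: "bdd_supp \<phi>" for k using \<phi> by (auto simp: test_functions_iff)
    have c\<phi>: "continuous_on UNIV \<phi>" by (rule times_cont_diff_continuous[OF t\<phi>])
    let ?u = "\<lambda>z. \<bar>\<phi> z\<bar> * q z"
    have iu: "integrable lborel (\<lambda>z. (norm (?u z))\<^sup>2)"
    proof (rule integrable_bdd_supp)
      show "continuous_on UNIV (\<lambda>z. (norm (?u z))\<^sup>2)" by (intro continuous_intros c\<phi> cq)
      show "bdd_supp (\<lambda>z. (norm (?u z))\<^sup>2)" by (rule bdd_supp_of_zeros[OF b\<phi>]) simp
    qed
    have mu: "?u \<in> borel_measurable lborel" 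
      by (simp, intro borel_measurable_continuous_onI continuous_intros c\<phi> cq)
    have uL: "?u \<in> L2 lborel" using iu mu by (simp add: L2_def)
    have un: "L2_norm lborel ?u = sqrt ?c * L2_norm ginibre \<phi>"
    proof -
      have "(\<lambda>z. (norm (?u z))\<^sup>2) = (\<lambda>z. (\<phi> z)\<^sup>2 * ginibre_weight z)"
        by (simp add: fun_eq_iff q2[symmetric] power2_eq_square abs_mult mult_ac)
      moreover have "(\<lambda>z. (\<phi> z)\<^sup>2) \<in> borel_measurable borel" by (intro borel_measurable_continuous_onI continuous_intros c\<phi>)
      ultimately have f1: "L2_norm lborel ?u = sqrt (LINT z|lborel. (\<phi> z)\<^sup>2 * ginibre_weight z)"
        and f2: "L2_norm ginibre \<phi> = sqrt ((LINT z|lborel. (\<phi> z)\<^sup>2 * ginibre_weight z) / ?c)"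
        by (simp_all only: L2_norm_def integral_ginibre(1) real_norm_def power2_abs)
      have r: "sqrt X = sqrt ?c * sqrt (X / ?c)" for X
        using c by (simp flip: real_sqrt_mult)
      show ?thesis unfolding f1 f2 by (rule r)
    qed
    have bound: "\<bar>\<phi> z * (frechet_derivative (d v) (at z) v * ginibre_weight z + d v z * weight_deriv v z)\<bar> \<le> ?u z * s v z" for z
    proof -
      have g0: "gauss (?n / 2) z \<ge> 0" by (simp add: gauss_def)
      have gg: "gauss (?n / 2) z * gauss (?n / 2) z = gauss ?n z" unfolding gauss_def exp_add[symmetric] by simp
      have "\<bar>weight_deriv v z\<bar> \<le> 2 * (cmod (vander z) * cmod (ddir vander v z)) * gauss ?n z + 2 * ?n * \<bar>z \<bullet> v\<bar> * ginibre_weight z"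
      proof -
        have "\<bar>weight_deriv v z\<bar> \<le> \<bar>2 * Re (cnj (vander z) * ddir vander v z) * gauss ?n z\<bar> + \<bar>2 * ?n * (z \<bullet> v) * ginibre_weight z\<bar>"
          unfolding weight_deriv_def by (rule abs_triangle_ineq4)
        moreover have "\<bar>2 * Re (cnj (vander z) * ddir vander v z) * gauss ?n z\<bar> \<le> 2 * (cmod (vander z) * cmod (ddir vander v z)) * gauss ?n z"
        proof -
          have "\<bar>Re (cnj (vander z) * ddir vander v z)\<bar> \<le> cmod (vander z) * cmod (ddir vander v z)"
            using abs_Re_le_cmod[of "cnj (vander z) * ddir vander v z"] by (simp add: norm_mult)
          then show ?thesis by (simp add: abs_mult gauss_def)
        qed
        moreover have "\<bar>2 * ?n * (z \<bullet> v) * ginibre_weight z\<bar> = 2 * ?n * \<bar>z \<bullet> v\<bar> * ginibre_weight z"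
          using ginibre_weight_nonneg[of z] by (simp add: abs_mult)
        ultimately show ?thesis by linarith
      qed
      also have "\<dots> = q z * ((2 * cmod (ddir vander v z) + 2 * ?n * \<bar>z \<bullet> v\<bar> * cmod (vander z)) * gauss (?n / 2) z)"
        unfolding q2[symmetric] q_def gg[symmetric] by (simp add: algebra_simps)
      finally have dw: "\<bar>weight_deriv v z\<bar> \<le> q z * ((2 * cmod (ddir vander v z) + 2 * ?n * \<bar>z \<bullet> v\<bar> * cmod (vander z)) * gauss (?n / 2) z)" .
      have "\<bar>frechet_derivative (d v) (at z) v * ginibre_weight z + d v z * weight_deriv v z\<bar>
        \<le> \<bar>frechet_derivative (d v) (at z) v\<bar> * ginibre_weight z + \<bar>d v z\<bar> * \<bar>weight_deriv v z\<bar>"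
        using abs_triangle_ineq[of "frechet_derivative (d v) (at z) v * ginibre_weight z" "d v z * weight_deriv v z"]
        by (simp add: abs_mult ginibre_weight_nonneg)
      also have "\<dots> \<le> \<bar>frechet_derivative (d v) (at z) v\<bar> * (q z * q z) + \<bar>d v z\<bar> * (q z * ((2 * cmod (ddir vander v z) + 2 * ?n * \<bar>z \<bullet> v\<bar> * cmod (vander z)) * gauss (?n / 2) z))"
        unfolding q2 by (intro add_left_mono mult_left_mono dw) simp
      also have "\<dots> = q z * s v z" unfolding s_def by (simp add: algebra_simps)
      finally have "\<bar>\<phi> z\<bar> * \<bar>frechet_derivative (d v) (at z) v * ginibre_weight z + d v z * weight_deriv v z\<bar> \<le> \<bar>\<phi> z\<bar> * (q z * s v z)"
        by (intro mult_left_mono) auto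
      then show ?thesis by (simp add: abs_mult mult.assoc)
    qed
    have ius: "integrable lborel (\<lambda>z. ?u z * s v z)" using L2_inner_integrable[OF uL sL[of v]] by simp
    have "\<bar>LINT z|lborel. frechet_derivative \<phi> (at z) v * d v z * ginibre_weight z\<bar>
      = \<bar>LINT z|lborel. \<phi> z * (frechet_derivative (d v) (at z) v * ginibre_weight z + d v z * weight_deriv v z)\<bar>"
      by (subst ginibre_by_parts[OF t\<phi> b\<phi> td]) simp
    also have "\<dots> \<le> (LINT z|lborel. \<bar>\<phi> z * (frechet_derivative (d v) (at z) v * ginibre_weight z + d v z * weight_deriv v z)\<bar>)"
      by (rule integral_abs_bound)
    also have "\<dots> \<le> (LINT z|lborel. ?u z * s v z)"
    proof (rule integral_mono)
      have "continuous_on UNIV (\<lambda>z. frechet_derivative (d v) (at z) v)" by (rule times_cont_diff_continuous[OF times_cont_diff_deriv[OF td]])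
      moreover have "continuous_on UNIV (d v)" by (rule times_cont_diff_continuous[OF td])
      ultimately show "integrable lborel (\<lambda>z. \<bar>\<phi> z * (frechet_derivative (d v) (at z) v * ginibre_weight z + d v z * weight_deriv v z)\<bar>)"
        by (intro integrable_bdd_supp bdd_supp_of_zeros[OF b\<phi>] continuous_intros c\<phi> continuous_ginibre_weight continuous_weight_deriv) simp_all
      show "integrable lborel (\<lambda>z. ?u z * s v z)" by (rule ius)
    qed (rule bound)
    also have "\<dots> \<le> L2_norm lborel ?u * L2_norm lborel (s v)"
      using L2_cauchy_schwarz[OF uL sL[of v]] by simp
    finally show ?thesis unfolding un .
  qed
  define C where "C = (\<Sum>v\<in>Basis. sqrt ?c * L2_norm lborel (s v)) / ?c"
  show ?thesis
  proof (rule that[of C])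
    fix \<phi> :: "(complex, 'n) vec \<Rightarrow> real" assume \<phi>: "\<phi> \<in> test_functions"
    have t\<phi>: "times_cont_diff k \<phi>" and b\<phi>: "bdd_supp \<phi>" for k using \<phi> by (auto simp: test_functions_iff)
    have d\<phi>: "\<phi> differentiable (at z)" for z by (rule test_differentiable[OF \<phi>])
    have cg: "continuous_on UNIV (grad \<phi>)" "continuous_on UNIV (grad \<theta>)" 
      by (rule continuous_grad[OF t\<phi>], rule continuous_grad[OF t\<theta>])
    have i: "integrable lborel (\<lambda>z. frechet_derivative \<phi> (at z) v * d v z * ginibre_weight z)" for v
    proof (rule integrable_bdd_supp)
      show "continuous_on UNIV (\<lambda>z. frechet_derivative \<phi> (at z) v * d v z * ginibre_weight z)"
        by (intro continuous_intros continuous_ginibre_weight times_cont_diff_continuous[OF times_cont_diff_deriv[OF t\<phi>]] times_cont_diff_continuous[OF td])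
      show "bdd_supp (\<lambda>z. frechet_derivative \<phi> (at z) v * d v z * ginibre_weight z)"
        unfolding bdd_supp_def by (intro exI[of _ R] allI impI) (simp only: d0 mult_zero_right mult_zero_left)
    qed
    have pt: "grad \<phi> z \<bullet> grad \<theta> z = (\<Sum>v\<in>Basis. frechet_derivative \<phi> (at z) v * d v z)" for z
      by (subst euclidean_inner) (simp only: d_def grad_gderiv(2)[OF d\<phi>] grad_gderiv(2)[OF d\<theta>])
    have "(LINT z|ginibre. grad \<phi> z \<bullet> grad \<theta> z) = (LINT z|lborel. (grad \<phi> z \<bullet> grad \<theta> z) * ginibre_weight z) / ?c"
      by (rule integral_ginibre(1)) (intro borel_measurable_continuous_onI continuous_intros cg)
    also have "(\<lambda>z. (grad \<phi> z \<bullet> grad \<theta> z) * ginibre_weight z) = (\<lambda>z. \<Sum>v\<in>Basis. frechet_derivative \<phi> (at z) v * d v z * ginibre_weight z)"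
      unfolding pt sum_distrib_right ..
    also have "(LINT z|lborel. (\<Sum>v\<in>Basis. frechet_derivative \<phi> (at z) v * d v z * ginibre_weight z)) = (\<Sum>v\<in>Basis. LINT z|lborel. frechet_derivative \<phi> (at z) v * d v z * ginibre_weight z)"
      by (rule Bochner_Integration.integral_sum) (rule i)
    finally have e: "(LINT z|ginibre. grad \<phi> z \<bullet> grad \<theta> z) = (\<Sum>v\<in>Basis. LINT z|lborel. frechet_derivative \<phi> (at z) v * d v z * ginibre_weight z) / ?c" .
    have "\<bar>\<Sum>v\<in>Basis. LINT z|lborel. frechet_derivative \<phi> (at z) v * d v z * ginibre_weight z\<bar> \<le> (\<Sum>v\<in>Basis. (sqrt ?c * L2_norm ginibre \<phi>) * L2_norm lborel (s v))"
      by (intro order_trans[OF sum_abs] sum_mono main[OF \<phi>])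
    also have "\<dots> = L2_norm ginibre \<phi> * (\<Sum>v\<in>Basis. sqrt ?c * L2_norm lborel (s v))" by (simp add: sum_distrib_left mult_ac)
    finally have "\<bar>\<Sum>v\<in>Basis. LINT z|lborel. frechet_derivative \<phi> (at z) v * d v z * ginibre_weight z\<bar> / ?c \<le> L2_norm ginibre \<phi> * (\<Sum>v\<in>Basis. sqrt ?c * L2_norm lborel (s v)) / ?c"
      using c by (intro divide_right_mono) auto
    then show "\<bar>LINT z|ginibre. grad \<phi> z \<bullet> grad \<theta> z\<bar> \<le> L2_norm ginibre \<phi> * C"
      unfolding e C_def abs_divide using c by simp
  qed
qed

text \<open>
The difference \<open>d\<close> of two gradients of \<open>f\<close> is a limit of gradients of test functions \<open>\<phi> m\<close> that tend to 0. By
\<open>dirichlet_form_bound\<close> it is orthogonal to each of these gradients, hence to their limit, which is \<open>d\<close> itself.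
\<close>

theorem ginibre_gradient_closable:
  fixes f :: "complex ^ 'n::{finite,linorder} \<Rightarrow> real"
  assumes "grad_closure ginibre f g" "grad_closure ginibre f g'"
  shows "L2_norm ginibre (\<lambda>z. g z - g' z) = 0"
proof -
  let ?M = "ginibre :: (complex ^ 'n::{finite,linorder}) measure"
  define d where "d = (\<lambda>z. g z + (- 1) *\<^sub>R g' z)"
  have "grad_closure ?M (\<lambda>z. f z + (- 1) * f z) d"
    unfolding d_def by (rule ginibre_closure_add[OF assms(1) ginibre_closure_scale[OF assms(2)]])
  then have "grad_closure ?M (\<lambda>z. 0) d" by simp
  then obtain \<phi> where \<phi>: "\<And>m. \<phi> m \<in> test_functions" "(\<lambda>m. L2_norm ?M (\<lambda>z. \<phi> m z - 0)) \<longlonglongrightarrow> 0" "(\<lambda>m. L2_norm ?M (\<lambda>z. grad (\<phi> m) z - d z)) \<longlonglongrightarrow> 0"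
    and dL: "d \<in> L2 ?M"
    unfolding grad_closure_def by blast
  have \<phi>2: "(\<lambda>m. L2_norm ?M (\<phi> m)) \<longlonglongrightarrow> 0" using \<phi>(2) by simp
  have orth: "(LINT z|?M. d z \<bullet> grad (\<phi> k) z) = 0" for k
  proof -
    obtain C where C: "\<And>u. u \<in> test_functions \<Longrightarrow> \<bar>LINT z|?M. grad u z \<bullet> grad (\<phi> k) z\<bar> \<le> L2_norm ?M u * C"
      by (rule dirichlet_form_bound[OF \<phi>(1)[of k]]) (rule that)
    have "(\<lambda>m. LINT z|?M. grad (\<phi> m) z \<bullet> grad (\<phi> k) z) \<longlonglongrightarrow> 0"
    proof (rule tendsto_rabs_zero_cancel, rule tendsto_sandwich[OF always_eventually always_eventually tendsto_const])
      show "\<forall>m. \<bar>LINT z|?M. grad (\<phi> m) z \<bullet> grad (\<phi> k) z\<bar> \<le> L2_norm ?M (\<phi> m) * C" using C \<phi>(1) by blast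
      show "(\<lambda>m. L2_norm ?M (\<phi> m) * C) \<longlonglongrightarrow> 0" by (rule tendsto_mult_left_zero[OF \<phi>2])
    qed simp
    moreover have "(\<lambda>m. LINT z|?M. grad (\<phi> m) z \<bullet> grad (\<phi> k) z) \<longlonglongrightarrow> (LINT z|?M. d z \<bullet> grad (\<phi> k) z)"
      by (rule L2_inner_tendsto[OF ginibre_test_grad_L2[OF \<phi>(1)] dL ginibre_test_grad_L2[OF \<phi>(1)] \<phi>(3)])
    ultimately show ?thesis using LIMSEQ_unique by blast
  qed
  have "(\<lambda>k. LINT z|?M. grad (\<phi> k) z \<bullet> d z) \<longlonglongrightarrow> (LINT z|?M. d z \<bullet> d z)"
    by (rule L2_inner_tendsto[OF ginibre_test_grad_L2[OF \<phi>(1)] dL dL \<phi>(3)])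
  moreover have "(LINT z|?M. grad (\<phi> k) z \<bullet> d z) = 0" for k
    using orth[of k] by (subst inner_commute)
  ultimately have "(LINT z|?M. d z \<bullet> d z) = 0" by (simp only: LIMSEQ_const_iff)
  then show ?thesis by (simp add: L2_norm_def d_def power2_norm_eq_inner)
qed

section \<open>Linear functions\<close>

lemma vander_translate: "vander (z + r *\<^sub>R (\<chi> k. c)) = vander z"
  unfolding vander_def by (rule prod.cong[OF refl]) (simp add: case_prod_beta)

lemma ddir_vander_invariant:
  fixes z T :: "complex ^ 'n::{finite,linorder}"
  assumes "\<And>r. vander (z + r *\<^sub>R T) = vander z"
  shows "ddir vander T z = 0"
proof -
  have line: "((\<lambda>r. z + r *\<^sub>R T) has_derivative (\<lambda>h. h *\<^sub>R T)) (at (0::real))"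
    by (auto intro!: derivative_eq_intros)
  have "((\<lambda>r. vander (z + r *\<^sub>R T)) has_derivative (\<lambda>h. ddir vander (h *\<^sub>R T) (z + 0 *\<^sub>R T))) (at (0::real))"
    by (rule has_derivative_compose[OF line C1_has_derivative[OF polyfun_C1[OF polyfun_vander]]])
  from has_derivative_unique[OF this[unfolded assms] has_derivative_const]
  have "(\<lambda>h::real. ddir vander (h *\<^sub>R T) (z + 0 *\<^sub>R T)) = (\<lambda>h. 0)" .
  from fun_cong[OF this, of 1] show ?thesis by simp
qed

lemma ddir_vander_constant: "ddir vander (\<chi> k. c) z = 0"
  by (rule ddir_vander_invariant) (rule vander_translate)

context
  fixes \<tau> :: complex and T :: "complex ^ 'n::{finite,linorder}" and f :: "complex ^ 'n::{finite,linorder} \<Rightarrow> real"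
  defines "T \<equiv> (\<chi> k. \<tau>)" and "f \<equiv> (\<lambda>z. z \<bullet> T)"
begin

lemma linear_weight_integrable: "integrable lborel (\<lambda>z. (f z)\<^sup>2 * ginibre_weight z)"
proof -
  define p where "p = (\<lambda>z::(complex, 'n) vec. \<Sum>k\<in>UNIV. cnj \<tau> * z $ k)"
  have p: "polyfun p" unfolding p_def by (intro polyfun_sum polyfun_mult polyfun_const polyfun_coord) simp
  have fp: "f z = Re (p z)" for z
    unfolding f_def T_def p_def inner_vec_def inner_complex_def Re_sum by (intro sum.cong) (auto simp: algebra_simps)
  have cf: "continuous_on UNIV f" unfolding f_def by (intro continuous_intros)
  show ?thesis
  proof (rule Bochner_Integration.integrable_bound[OF polyfun_weight_integrable[OF p]])
    show "(\<lambda>z. (f z)\<^sup>2 * ginibre_weight z) \<in> borel_measurable lborel"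
      by (simp, intro borel_measurable_continuous_onI continuous_intros cf continuous_ginibre_weight)
    show "AE z in lborel. norm ((f z)\<^sup>2 * ginibre_weight z) \<le> norm ((cmod (p z))\<^sup>2 * ginibre_weight z)"
    proof (rule AE_I2)
      fix z
      have "\<bar>f z\<bar> \<le> cmod (p z)" unfolding fp by (rule abs_Re_le_cmod)
      then have "\<bar>f z\<bar>\<^sup>2 \<le> (cmod (p z))\<^sup>2" by (rule power_mono) (rule abs_ge_zero)
      then have le: "(f z)\<^sup>2 \<le> (cmod (p z))\<^sup>2" by (simp only: power2_abs)
      show "norm ((f z)\<^sup>2 * ginibre_weight z) \<le> norm ((cmod (p z))\<^sup>2 * ginibre_weight z)"
        unfolding real_norm_def abs_mult abs_power2 by (rule mult_right_mono[OF le abs_ge_zero])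
    qed
  qed
qed

lemma linear_measurable: "f \<in> borel_measurable borel"
  unfolding f_def by measurable

lemma linear_L2: "f \<in> L2 ginibre"
proof -
  have "(\<lambda>z. (f z)\<^sup>2) \<in> borel_measurable borel" using linear_measurable by measurable
  then have "integrable ginibre (\<lambda>z. (f z)\<^sup>2)" using linear_weight_integrable by (simp add: integral_ginibre(2))
  then show ?thesis using linear_measurable by (simp add: L2_def measurable_ginibre)
qed

lemma linear_smooth: "times_cont_diff k f"
  unfolding f_def by (intro times_cont_diff_linear bounded_linear_inner_left)

lemma linear_grad: "grad f = (\<lambda>z. T)"
proof
  fix z
  have "(f has_derivative f) (at z)"
    unfolding f_def by (rule bounded_linear_imp_has_derivative) (rule bounded_linear_inner_left)
  then have "GDERIV f z :> T" unfolding gderiv_def f_def .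
  then show "grad f z = T" by (rule grad_eqI)
qed

lemma linear_frechet: "frechet_derivative f (at z) v = v \<bullet> T"
proof -
  have "(f has_derivative f) (at z)"
    unfolding f_def by (rule bounded_linear_imp_has_derivative) (rule bounded_linear_inner_left)
  then show ?thesis using frechet_derivative_at f_def by metis
qed

lemma linear_grad_closure: "grad_closure ginibre f (\<lambda>z. T)"
  using ginibre_closure_smooth[OF linear_smooth linear_L2] const_L2[of T] by (simp add: linear_grad)

lemma linear_mean: "(LINT z|ginibre. f z) = 0"
proof -
  have o: "orthogonal_transformation (\<lambda>z :: (complex, 'n) vec. (-1) *s z)"
    by (rule orthogonal_transformation_rotation) simp
  have w: "ginibre_weight ((-1) *s z) = ginibre_weight z" for z :: "(complex, 'n) vec"
    unfolding ginibre_weight_eq vander_homogeneous gauss_rotation[of "-1", simplified norm_minus_cancel norm_one, OF refl]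
    by (simp only: norm_mult norm_power norm_minus_cancel norm_one power_one mult_1)
  have "f ((-1) *s z) = - f z" for z
  proof -
    have "(-1) *s z = - z" by (simp add: vec_eq_iff)
    then show ?thesis by (simp add: f_def)
  qed
  then have "(LINT z|ginibre. f z) = (LINT z|ginibre. - f z)"
    using integral_ginibre_compose[OF o w, of f] linear_measurable by (simp add: measurable_ginibre)
  then show ?thesis by simp
qed

text \<open>
  The Vandermonde product does not change along \<open>T\<close>, so that the logarithmic derivative of the weight in this direction is \<open>- 2 n f\<close>.
  Integrating by parts the derivative of \<open>f\<close> along \<open>T\<close>, with a cutoff that is removed at the end, gives the second moment.
\<close>

lemma linear_second_moment: "2 * real CARD('n) * (LINT z|ginibre. (f z)\<^sup>2) = (norm T)\<^sup>2"
proof -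
  let ?c = "ginibre_const TYPE('n)" and ?n = "real CARD('n)"
  have c: "?c > 0" by (rule ginibre_const_pos)
  have dw: "weight_deriv T z = - (2 * ?n * f z * ginibre_weight z)" for z
    using ddir_vander_constant[where c=\<tau> and z=z] unfolding weight_deriv_def T_def[symmetric] f_def by simp
  obtain C where C: "C \<ge> 0" "\<And>R (x::(complex, 'n) vec) v. \<bar>frechet_derivative (cutoff R) (at x) v\<bar> \<le> C * norm v / real (Suc R)"
    using cutoff_derivative_bound by blast
  have mf2: "(\<lambda>z. (f z)\<^sup>2) \<in> borel_measurable borel" using linear_measurable by measurable
  have if1: "integrable lborel (\<lambda>z. \<bar>f z\<bar> * ginibre_weight z)"
  proof -
    have "integrable ginibre (\<lambda>z. \<bar>f z\<bar>)" using L2_ginibre_integrable(1)[OF linear_L2] by (rule integrable_abs)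
    then show ?thesis using linear_measurable by (subst (asm) integral_ginibre(2)) measurable
  qed
  have mcut: "cutoff R \<in> borel_measurable borel" for R
    by (intro borel_measurable_continuous_onI times_cont_diff_continuous[OF times_cont_diff_cutoff])
  have ibp: "(LINT z|lborel. frechet_derivative (cutoff R) (at z) T * f z * ginibre_weight z)
      = - (LINT z|lborel. cutoff R z * (((norm T)\<^sup>2 - 2 * ?n * (f z)\<^sup>2) * ginibre_weight z))" for R
  proof -
    have b: "bdd_supp (cutoff R :: (complex, 'n) vec \<Rightarrow> real)" 
      by (rule conjunct2[OF test_functions_iff[THEN iffD1, OF cutoff_test_function]])
    have "(LINT z|lborel. frechet_derivative (cutoff R) (at z) T * f z * ginibre_weight z)
      = - (LINT z|lborel. cutoff R z * (frechet_derivative f (at z) T * ginibre_weight z + f z * weight_deriv T z))"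
      by (rule ginibre_by_parts[OF times_cont_diff_cutoff b linear_smooth])
    also have "(\<lambda>z. cutoff R z * (frechet_derivative f (at z) T * ginibre_weight z + f z * weight_deriv T z))
       = (\<lambda>z. cutoff R z * (((norm T)\<^sup>2 - 2 * ?n * (f z)\<^sup>2) * ginibre_weight z))"
      unfolding linear_frechet dw power2_norm_eq_inner[symmetric] by (simp add: fun_eq_iff power2_eq_square algebra_simps)
    finally show ?thesis .
  qed
  let ?h = "\<lambda>z. ((norm T)\<^sup>2 - 2 * ?n * (f z)\<^sup>2) * ginibre_weight z"
  have ih: "integrable lborel ?h"
  proof -
    have "integrable lborel (\<lambda>z. (norm T)\<^sup>2 * ginibre_weight z - (2 * ?n) * ((f z)\<^sup>2 * ginibre_weight z))"
      by (intro Bochner_Integration.integrable_diff integrable_mult_right ginibre_weight_integrable linear_weight_integrable)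
    then show ?thesis by (simp add: algebra_simps)
  qed
  have "(\<lambda>R. LINT z|lborel. cutoff R z * ?h z) \<longlonglongrightarrow> (LINT z|lborel. ?h z)"
  proof (rule integral_dominated_convergence[OF _ _ integrable_norm[OF ih]])
    show hm: "?h \<in> borel_measurable lborel" using ih by (rule borel_measurable_integrable)
    show "(\<lambda>z. cutoff R z * ?h z) \<in> borel_measurable lborel" for R
      by (rule borel_measurable_times[OF _ hm]) (simp add: mcut)
    show "AE z in lborel. (\<lambda>R. cutoff R z * ?h z) \<longlonglongrightarrow> ?h z"
    proof (rule AE_I2)
      fix z
      have "(\<lambda>R. cutoff R z * ?h z) \<longlonglongrightarrow> 1 * ?h z" by (intro tendsto_mult cutoff_tendsto_1 tendsto_const)
      then show "(\<lambda>R. cutoff R z * ?h z) \<longlonglongrightarrow> ?h z" by (simp only: mult_1)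
    qed
    show "AE z in lborel. norm (cutoff R z * ?h z) \<le> norm (?h z)" for R
    proof (rule AE_I2)
      fix z
      show "norm (cutoff R z * ?h z) \<le> norm (?h z)"
        unfolding norm_mult[of "cutoff R z"] using cutoff_nonneg[of R z] cutoff_le_1[of R z]
        by (intro mult_left_le_one_le) auto
    qed
  qed
  moreover have "(\<lambda>R. LINT z|lborel. cutoff R z * ?h z) \<longlonglongrightarrow> 0"
  proof (rule tendsto_rabs_zero_cancel, rule tendsto_sandwich[OF always_eventually always_eventually tendsto_const])
    show "(\<lambda>R. (C * norm T) * inverse (real (Suc R)) * (LINT z|lborel. \<bar>f z\<bar> * ginibre_weight z)) \<longlonglongrightarrow> 0"
      using tendsto_mult_left_zero[OF tendsto_mult_right_zero[OF LIMSEQ_inverse_real_of_nat]] .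
    show "\<forall>R. \<bar>LINT z|lborel. cutoff R z * ?h z\<bar> \<le> (C * norm T) * inverse (real (Suc R)) * (LINT z|lborel. \<bar>f z\<bar> * ginibre_weight z)"
    proof
      fix R
      have "\<bar>LINT z|lborel. cutoff R z * ?h z\<bar> = \<bar>LINT z|lborel. frechet_derivative (cutoff R) (at z) T * f z * ginibre_weight z\<bar>"
        unfolding ibp by simp
      also have "\<dots> \<le> (LINT z|lborel. (C * norm T) * inverse (real (Suc R)) * (\<bar>f z\<bar> * ginibre_weight z))"
      proof (rule integral_abs_bound_integral)
        have cdT: "continuous_on UNIV (\<lambda>z::(complex, 'n) vec. frechet_derivative (cutoff R) (at z) T)"
          by (rule times_cont_diff_continuous[OF times_cont_diff_deriv[OF times_cont_diff_cutoff]])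
        have le: "\<bar>frechet_derivative (cutoff R) (at z) T * f z * ginibre_weight z\<bar> \<le> (C * norm T) * inverse (real (Suc R)) * (\<bar>f z\<bar> * ginibre_weight z)" for z
        proof -
          have "\<bar>frechet_derivative (cutoff R) (at z) T * f z * ginibre_weight z\<bar> = \<bar>frechet_derivative (cutoff R) (at z) T\<bar> * (\<bar>f z\<bar> * ginibre_weight z)"
            using ginibre_weight_nonneg[of z] by (simp add: abs_mult mult.assoc)
          also have "\<dots> \<le> ((C * norm T) * inverse (real (Suc R))) * (\<bar>f z\<bar> * ginibre_weight z)"
            using C(2)[of R z T] ginibre_weight_nonneg[of z] by (intro mult_right_mono) (auto simp: divide_inverse simp del: of_nat_Suc)
          finally show ?thesis .
        qed
        show i: "integrable lborel (\<lambda>z. (C * norm T) * inverse (real (Suc R)) * (\<bar>f z\<bar> * ginibre_weight z))"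
          by (rule integrable_mult_right[OF if1])
        show "integrable lborel (\<lambda>z. frechet_derivative (cutoff R) (at z) T * f z * ginibre_weight z)"
        proof (rule Bochner_Integration.integrable_bound[OF i])
          show "(\<lambda>z. frechet_derivative (cutoff R) (at z) T * f z * ginibre_weight z) \<in> borel_measurable lborel"
            using borel_measurable_continuous_onI[OF cdT] linear_measurable by measurable
          show "AE z in lborel. norm (frechet_derivative (cutoff R) (at z) T * f z * ginibre_weight z) \<le> norm ((C * norm T) * inverse (real (Suc R)) * (\<bar>f z\<bar> * ginibre_weight z))"
            unfolding real_norm_def by (intro AE_I2 order_trans[OF le abs_ge_self])
        qed
        show "\<bar>frechet_derivative (cutoff R) (at z) T * f z * ginibre_weight z\<bar> \<le> (C * norm T) * inverse (real (Suc R)) * (\<bar>f z\<bar> * ginibre_weight z)" for z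
          by (rule le)
      qed
      also have "\<dots> = (C * norm T) * inverse (real (Suc R)) * (LINT z|lborel. \<bar>f z\<bar> * ginibre_weight z)" by (rule integral_mult_right_zero)
      finally show "\<bar>LINT z|lborel. cutoff R z * ?h z\<bar> \<le> (C * norm T) * inverse (real (Suc R)) * (LINT z|lborel. \<bar>f z\<bar> * ginibre_weight z)" .
    qed
  qed simp
  ultimately have "(LINT z|lborel. ?h z) = 0" by (rule LIMSEQ_unique)
  moreover have "(LINT z|lborel. ?h z) = (LINT z|lborel. (norm T)\<^sup>2 * ginibre_weight z - (2 * ?n) * ((f z)\<^sup>2 * ginibre_weight z))"
    by (rule Bochner_Integration.integral_cong) (auto simp: algebra_simps)
  moreover have "\<dots> = (norm T)\<^sup>2 * ?c - (2 * ?n) * (LINT z|lborel. (f z)\<^sup>2 * ginibre_weight z)"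
    by (subst Bochner_Integration.integral_diff[OF integrable_mult_right[OF ginibre_weight_integrable] integrable_mult_right[OF linear_weight_integrable]])
       (simp only: integral_mult_right_zero ginibre_const_def)
  ultimately have "(2 * ?n) * (LINT z|lborel. (f z)\<^sup>2 * ginibre_weight z) = (norm T)\<^sup>2 * ?c" by simp
  then show ?thesis unfolding integral_ginibre(1)[OF mf2] using c by (simp add: field_simps)
qed

end

lemma grad_closure_H1_grad: "f \<in> H1 M \<Longrightarrow> grad_closure M f (H1_grad M f)"
  unfolding H1_def H1_grad_def by (simp add: someI_ex)

theorem theorem1p1:
  shows "(\<forall>f :: complex ^ 'n::{finite,linorder} \<Rightarrow> real.
            f \<in> H1 ginibre \<and> symmetric_fun f \<longrightarrow>
            Var ginibre f \<le> 1 / 2 * dirichlet_energy ginibre f) \<and>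
         (\<forall>(a :: real) (b :: real) (f :: complex ^ 'n::{finite,linorder} \<Rightarrow> real).
            f = (\<lambda>z. a * sum_Re z + b * sum_Im z) \<longrightarrow>
            f \<in> H1 ginibre \<and> symmetric_fun f \<and>
            Var ginibre f = 1 / 2 * dirichlet_energy ginibre f)"
proof (intro conjI allI impI)
  fix f :: "complex ^ 'n::{finite,linorder} \<Rightarrow> real"
  assume f: "f \<in> H1 ginibre \<and> symmetric_fun f"
  then have "grad_closure ginibre f (H1_grad ginibre f)"
    by (intro grad_closure_H1_grad) simp
  from poincare_ginibre[OF this] f show "Var ginibre f \<le> 1 / 2 * dirichlet_energy ginibre f"
    unfolding dirichlet_energy_def by simp
next
  fix a b :: real and f :: "complex ^ 'n::{finite,linorder} \<Rightarrow> real"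
  assume f: "f = (\<lambda>z. a * sum_Re z + b * sum_Im z)"
  define T :: "complex ^ 'n::{finite,linorder}" where "T = (\<chi> k. Complex a b)"
  have fT: "f = (\<lambda>z. z \<bullet> T)"
    unfolding f T_def by (simp add: fun_eq_iff sum_Re_def sum_Im_def inner_vec_def inner_complex_def sum_distrib_left sum.distrib mult.commute)
  note lin = linear_grad_closure[of "Complex a b", where 'n='n, folded T_def, folded fT]
     linear_mean[of "Complex a b", where 'n='n, folded T_def, folded fT]
     linear_second_moment[of "Complex a b", where 'n='n, folded T_def, folded fT]
     linear_L2[of "Complex a b", where 'n='n, folded T_def, folded fT]
  show H1: "f \<in> H1 ginibre" unfolding H1_def using lin(1) by blast
  show "symmetric_fun f"
    unfolding symmetric_fun_def
  proof (intro allI impI)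
    fix \<sigma> :: "'n \<Rightarrow> 'n" and z :: "complex ^ 'n::{finite,linorder}" assume \<sigma>: "\<sigma> permutes UNIV"
    show "f (\<chi> k. z $ \<sigma> k) = f z"
      unfolding f sum_Re_def sum_Im_def
      using sum.permute[OF \<sigma>, of "\<lambda>k. Re (z $ k)"] sum.permute[OF \<sigma>, of "\<lambda>k. Im (z $ k)"] by (simp add: o_def)
  qed
  have hg: "grad_closure ginibre f (H1_grad ginibre f)"
    by (rule grad_closure_H1_grad[OF H1])
  have "L2_norm ginibre (\<lambda>z. H1_grad ginibre f z - T) = 0"
    by (rule ginibre_gradient_closable[OF hg lin(1)])
  then have "(\<lambda>m::nat. LINT z|ginibre. (norm (H1_grad ginibre f z))\<^sup>2) \<longlonglongrightarrow> (LINT z|(ginibre :: (complex ^ 'n::{finite,linorder}) measure). (norm T)\<^sup>2)"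
    using hg const_L2[of T] by (intro L2_square_tendsto) (auto simp: grad_closure_def)
  then have "(LINT z|ginibre. (norm (H1_grad ginibre f z))\<^sup>2) = (norm T)\<^sup>2"
    unfolding integral_const_ginibre by (simp only: LIMSEQ_const_iff)
  then have "1 / 2 * dirichlet_energy ginibre f = 1 / (2 * real CARD('n)) * (norm T)\<^sup>2" unfolding dirichlet_energy_def by simp
  also have "\<dots> = (LINT z|ginibre. (f z)\<^sup>2)" unfolding lin(3)[symmetric] by (simp add: fT)
  also have "\<dots> = Var ginibre f" unfolding Var_def using lin(2) by (simp add: fT)
  finally show "Var ginibre f = 1 / 2 * dirichlet_energy ginibre f" ..
qed

end
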